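(* Assume that $\mathbb{L}$ and its Green function $G^\Omega$ satisfy properties (L1)–(L4) and (G1) listed in the context. (i) Let $f\in L^1(\Omega,\delta^\gamma)$ and put $u=\mathbb{G}^\Omega[f]$. Then $$\int_\Omega|u|\xi\,dx\le\int_\Omega\operatorname{sign}(u)\,f\,\mathbb{G}^\Omega[\xi]\,dx,\qquad \int_\Omega u^+\xi\,dx\le\int_\Omega\operatorname{sign}^+(u)\,f\,\mathbb{G}^\Omega[\xi]\,dx,$$ for all $\xi\in\delta^\gamma L^\infty(\Omega)$ such that $\mathbb{G}^\Omega[\xi]\ge0$ a.e. in $\Omega$. (ii) Assume in addition that properties (G2) and (G3) listed in the context hold. Let $f\in L^1(\Omega,\delta^\gamma)$, $\mu\in\mathcal{M}(\Omega,\delta^\gamma)$ and put $u=\mathbb{G}^\Omega[f]+\mathbb{G}^\Omega[\mu]$. Then $$\int_\Omega u^+\xi\,dx\le\int_\Omega\operatorname{sign}^+(u)\,\mathbb{G}^\Omega[\xi]f\,dx+\int_\Omega\mathbb{G}^\Omega[\xi]\,d\mu^+,$$ $$\int_\Omega|u|\xi\,dx\le\int_\Omega\operatorname{sign}(u)\,\mathbb{G}^\Omega[\xi]f\,dx+\int_\Omega\mathbb{G}^\Omega[\xi]\,d\mu^+,$$ for all $\xi\in\delta^\gamma L^\infty(\Omega)$ such that $\mathbb{G}^\Omega[\xi]\ge0$ a.e. in $\Omega$.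
   Context: Throughout, $N\ge 3$, $\Omega\subset\mathbb{R}^N$ is a bounded $C^2$ domain, $\delta(x)=\operatorname{dist}(x,\mathbb{R}^N\setminus\Omega)$, $D_\Omega=\{(x,x):x\in\Omega\}$, $a\wedge b=\min\{a,b\}$; $f\asymp g$ means $C^{-1}g\le f\le Cg$ for some constant $C>0$. $u^+=\max\{u,0\}$, $\operatorname{sign}(t)=1,0,-1$ for $t>0$, $t=0$, $t<0$, and $\operatorname{sign}^+=\max\{\operatorname{sign},0\}$. Operator: (L1) $\mathbb{L}:C_c^\infty(\Omega)\to L^2(\Omega)$ is given by $\mathbb{L}u(x)=\lim_{\varepsilon\to0^+}\mathbb{L}_\varepsilon u(x)$, where $\mathbb{L}_\varepsilon u(x)=\int_{\{y\in\Omega:|x-y|>\varepsilon\}}J(x,y)(u(x)-u(y))\,dy+B(x)u(x)$; $J,B$ are measurable, $J$ is nonnegative, symmetric, finite on $(\Omega\times\Omega)\setminus D_\Omega$, $\int_\Omega\int_\Omega|x-y|^2J(x,y)\,dx\,dy<\infty$, and $B$ is nonnegative and locally bounded in $\Omega$. (L2) For every $u\in C_c^\infty(\Omega)$ there exist $\varphi_u\in L^1_{\rm loc}(\Omega)$ and $\varepsilon_0>0$ with $|\mathbb{L}_\varepsilon u|\le\varphi_u$ a.e. in $\Omega$ for all $\varepsilon\in(0,\varepsilon_0]$. Put $\mathcal{E}(u,v)=\frac12\int_\Omega\int_\Omega J(x,y)(u(x)-u(y))(v(x)-v(y))\,dx\,dy+\int_\Omega Buv\,dx$ on $\mathcal{D}(\mathcal{E})=\{u\in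 L^2(\Omega):\mathcal{E}(u,u)<\infty\}$, with inner product $\langle u,v\rangle_{L^2(\Omega)}+\mathcal{E}(u,v)$; $\mathbb{H}(\Omega)$ is the closure of $C_c^\infty(\Omega)$ in $\mathcal{D}(\mathcal{E})$. $\mathbb{L}$ also denotes its Friedrichs extension, the nonnegative self-adjoint operator on $L^2(\Omega)$ associated with $\mathcal{E}|_{\mathbb{H}(\Omega)\times\mathbb{H}(\Omega)}$. (L3) There is $\Lambda>0$ with $\|u\|_{L^2(\Omega)}^2\le\Lambda\langle\mathbb{L}u,u\rangle_{L^2(\Omega)}$ for all $u\in C_c^\infty(\Omega)$. (L4) $\mathbb{H}(\Omega)=H^s_{00}(\Omega):=\{u\in H^s(\Omega):u/\delta^s\in L^2(\Omega)\}$, a Banach space with norm $\|u\|^2_{H^s_{00}(\Omega)}=\int_\Omega(1+\delta^{-2s})|u|^2dx+\int_\Omega\int_\Omega\frac{|u(x)-u(y)|^2}{|x-y|^{N+2s}}dx\,dy$ ($s$ as in (G1)). Green operator: for $f\in L^2(\Omega)$, $\mathbb{G}^\Omega[f]$ is the unique $u\in\mathbb{H}(\Omega)$ with $\mathcal{E}(u,v)=\int_\Omega fv\,dx$ for all $v\in\mathbb{H}(\Omega)$. (G1) $\mathbb{G}^\Omega[f](x)=\int_\Omega G^\Omega(x,y)f(y)\,dy$, where the Green function $G^\Omega:(\Omega\times\Omega)\setminus D_\Omega\to(0,\infty)$ is Borel measurable, symmetric, and for some $s,\gamma\in(0,1]$, $N>2s$, $$G^\Omega(x,y)\asymp\frac{1}{|x-y|^{N-2s}}\Big(\frac{\delta(x)}{|x-y|}\wedge1\Big)^\gamma\Big(\frac{\delta(y)}{|x-y|}\wedge1\Big)^\gamma,\quad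 x,y\in\Omega,\ x\ne y.$$ (G2) $G^\Omega$ is jointly continuous in $(\Omega\times\Omega)\setminus D_\Omega$. (G3) For every $x_0\in\Omega$, $z_0\in\partial\Omega$ the limit $M^\Omega(x_0,z_0)=\lim_{(x,y)\to(x_0,z_0)}\frac{G^\Omega(x,y)}{\delta(y)^\gamma}$ exists, and $M^\Omega:\Omega\times\partial\Omega\to\mathbb{R}^+$ is continuous. Spaces: $L^1(\Omega,\delta^\gamma)$ has norm $\int_\Omega|u|\delta^\gamma dx$; $\delta^\gamma L^\infty(\Omega)=\{\delta^\gamma u:u\in L^\infty(\Omega)\}$; $\mathcal{M}(\Omega,\delta^\gamma)$ is the space of signed Radon measures $\mu$ on $\Omega$ with $\int_\Omega\delta^\gamma d|\mu|<\infty$, where $|\mu|$ is the total variation; $\mu^+$ is the positive part of $\mu$. For such $\mu$, $\mathbb{G}^\Omega[\mu](x)=\int_\Omega G^\Omega(x,y)\,d\mu(y)$, and for $f\in L^1(\Omega,\delta^\gamma)$, $\mathbb{G}^\Omega[f](x)=\int_\Omega G^\Omega(x,y)f(y)\,dy$.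
   Formalization: In (ii), the inequality for |u| is proved with the total variation |μ| in place of μ⁺ in the last integral; as printed it fails, e.g. for f = 0, μ = −δ_{x₀} (a negative point mass), ξ = δ^γ, where the right side is 0 and the left side is positive. *)

theory Defs
  imports "HOL-Analysis.Analysis"
begin

text \<open>
  Functions on a domain are total functions of which only the values on the domain matter.
  Elements of \<open>L\<^sup>2\<close>, \<open>L\<^sup>1\<close>, \<open>L\<^sup>\<infinity>\<close> are Lebesgue measurable representatives; double integrals
  over \<open>\<Omega> \<times> \<Omega>\<close> are integrals against Lebesgue measure of the product space.
\<close>

subsection \<open>Domains and function spaces\<close>

primrec Ck_on :: "nat \<Rightarrow> ('a::euclidean_space \<Rightarrow> real) \<Rightarrow> 'a set \<Rightarrow> bool" where
  "Ck_on 0 f S \<longleftrightarrow> continuous_on S f"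
| "Ck_on (Suc k) f S \<longleftrightarrow> (\<forall>x\<in>S. f differentiable (at x)) \<and>
     (\<forall>v. Ck_on k (\<lambda>x. frechet_derivative f (at x) v) S)"

text \<open>
  Near each boundary point, in the rotated coordinates with last axis \<open>e\<close>, the domain is the
  part above the graph of a \<open>C\<^sup>2\<close> function of the remaining coordinates. The function \<open>\<phi>\<close> is
  evaluated only on the hyperplane orthogonal to \<open>e\<close>.
\<close>
definition C2_domain :: "'a::euclidean_space set \<Rightarrow> bool" where
  "C2_domain \<Omega> \<longleftrightarrow> open \<Omega> \<and> connected \<Omega> \<and> \<Omega> \<noteq> {} \<and>
     (\<forall>z\<in>frontier \<Omega>. \<exists>r>0. \<exists>e \<phi>. norm e = 1 \<and> Ck_on 2 \<phi> UNIV \<and>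
        \<Omega> \<inter> ball z r = {x \<in> ball z r. \<phi> (x - (x \<bullet> e) *\<^sub>R e) < x \<bullet> e})"

definition bdist :: "'a::euclidean_space set \<Rightarrow> 'a \<Rightarrow> real" where
  "bdist \<Omega> x = infdist x (- \<Omega>)"

definition offdiag :: "'a set \<Rightarrow> ('a \<times> 'a) set" where
  "offdiag \<Omega> = {(x, y). x \<in> \<Omega> \<and> y \<in> \<Omega> \<and> x \<noteq> y}"

definition test_functions :: "'a::euclidean_space set \<Rightarrow> ('a \<Rightarrow> real) set" where
  "test_functions \<Omega> = {u. (\<forall>k. Ck_on k u UNIV) \<and>
     compact (closure {x. u x \<noteq> 0}) \<and> closure {x. u x \<noteq> 0} \<subseteq> \<Omega>}"

definition L2_space :: "'a::euclidean_space set \<Rightarrow> ('a \<Rightarrow> real) set" where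
  "L2_space \<Omega> = {u. u \<in> borel_measurable (lebesgue_on \<Omega>) \<and>
     integrable (lebesgue_on \<Omega>) (\<lambda>x. (u x)\<^sup>2)}"

definition L1_loc :: "'a::euclidean_space set \<Rightarrow> ('a \<Rightarrow> real) set" where
  "L1_loc \<Omega> = {u. \<forall>K. compact K \<and> K \<subseteq> \<Omega> \<longrightarrow> integrable (lebesgue_on K) u}"

definition Linf_space :: "'a::euclidean_space set \<Rightarrow> ('a \<Rightarrow> real) set" where
  "Linf_space \<Omega> = {u. u \<in> borel_measurable (lebesgue_on \<Omega>) \<and>
     (\<exists>C. AE x in lebesgue_on \<Omega>. \<bar>u x\<bar> \<le> C)}"

definition L1_weighted :: "'a::euclidean_space set \<Rightarrow> real \<Rightarrow> ('a \<Rightarrow> real) set" where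
  "L1_weighted \<Omega> \<gamma> = {u. u \<in> borel_measurable (lebesgue_on \<Omega>) \<and>
     integrable (lebesgue_on \<Omega>) (\<lambda>x. \<bar>u x\<bar> * bdist \<Omega> x powr \<gamma>)}"

definition weighted_Linf :: "'a::euclidean_space set \<Rightarrow> real \<Rightarrow> ('a \<Rightarrow> real) set" where
  "weighted_Linf \<Omega> \<gamma> =
     {\<xi>. \<exists>w \<in> Linf_space \<Omega>. \<forall>x\<in>\<Omega>. \<xi> x = bdist \<Omega> x powr \<gamma> * w x}"

text \<open>
  For \<open>s < 1\<close> this is the Gagliardo (Slobodeckij) space. For \<open>s = 1\<close> it is \<open>W\<^sup>1\<^sup>,\<^sup>2\<close>, where \<open>g\<close> is
  the weak gradient; the Gagliardo integral would be infinite there unless \<open>u\<close> is constant.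
\<close>
definition Hs_space :: "'a::euclidean_space set \<Rightarrow> real \<Rightarrow> ('a \<Rightarrow> real) set" where
  "Hs_space \<Omega> s = {u \<in> L2_space \<Omega>.
     if s < 1 then
       integrable (lebesgue_on (\<Omega> \<times> \<Omega>))
         (\<lambda>(x, y). \<bar>u x - u y\<bar>\<^sup>2 / norm (x - y) powr (real DIM('a) + 2 * s))
     else
       (\<exists>g :: 'a \<Rightarrow> 'a. \<forall>b\<in>Basis. (\<lambda>x. g x \<bullet> b) \<in> L2_space \<Omega> \<and>
         (\<forall>\<phi>\<in>test_functions \<Omega>.
            (\<integral>x. u x * frechet_derivative \<phi> (at x) b \<partial>lebesgue_on \<Omega>) =
              - (\<integral>x. (g x \<bullet> b) * \<phi> x \<partial>lebesgue_on \<Omega>)))}"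

definition Hs00_space :: "'a::euclidean_space set \<Rightarrow> real \<Rightarrow> ('a \<Rightarrow> real) set" where
  "Hs00_space \<Omega> s = {u \<in> Hs_space \<Omega> s. (\<lambda>x. u x / bdist \<Omega> x powr s) \<in> L2_space \<Omega>}"

subsection \<open>The operator and its form\<close>

definition L_eps :: "'a::euclidean_space set \<Rightarrow> ('a \<Rightarrow> 'a \<Rightarrow> real) \<Rightarrow> ('a \<Rightarrow> real) \<Rightarrow>
    real \<Rightarrow> ('a \<Rightarrow> real) \<Rightarrow> 'a \<Rightarrow> real" where
  "L_eps \<Omega> J B \<epsilon> u x =
     (\<integral>y. J x y * (u x - u y) \<partial>lebesgue_on {y \<in> \<Omega>. \<epsilon> < norm (x - y)}) + B x * u x"

definition L_op :: "'a::euclidean_space set \<Rightarrow> ('a \<Rightarrow> 'a \<Rightarrow> real) \<Rightarrow> ('a \<Rightarrow> real) \<Rightarrow>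
    ('a \<Rightarrow> real) \<Rightarrow> 'a \<Rightarrow> real" where
  "L_op \<Omega> J B u x = Lim (at_right 0) (\<lambda>\<epsilon>. L_eps \<Omega> J B \<epsilon> u x)"

definition cond_L1 :: "'a::euclidean_space set \<Rightarrow> ('a \<Rightarrow> 'a \<Rightarrow> real) \<Rightarrow> ('a \<Rightarrow> real) \<Rightarrow> bool" where
  "cond_L1 \<Omega> J B \<longleftrightarrow>
     (\<lambda>(x, y). J x y) \<in> borel_measurable (lebesgue_on (offdiag \<Omega>)) \<and>
     (\<forall>(x, y)\<in>offdiag \<Omega>. 0 \<le> J x y \<and> J x y = J y x) \<and>
     integrable (lebesgue_on (\<Omega> \<times> \<Omega>)) (\<lambda>(x, y). (norm (x - y))\<^sup>2 * J x y) \<and>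
     B \<in> borel_measurable (lebesgue_on \<Omega>) \<and>
     (\<forall>x\<in>\<Omega>. 0 \<le> B x) \<and>
     (\<forall>K. compact K \<and> K \<subseteq> \<Omega> \<longrightarrow> bounded (B ` K)) \<and>
     (\<forall>u\<in>test_functions \<Omega>.
        (AE x in lebesgue_on \<Omega>.
           ((\<lambda>\<epsilon>. L_eps \<Omega> J B \<epsilon> u x) \<longlongrightarrow> L_op \<Omega> J B u x) (at_right 0)) \<and>
        L_op \<Omega> J B u \<in> L2_space \<Omega>)"

definition cond_L2 :: "'a::euclidean_space set \<Rightarrow> ('a \<Rightarrow> 'a \<Rightarrow> real) \<Rightarrow> ('a \<Rightarrow> real) \<Rightarrow> bool" where
  "cond_L2 \<Omega> J B \<longleftrightarrow>
     (\<forall>u\<in>test_functions \<Omega>. \<exists>\<phi> \<in> L1_loc \<Omega>. \<exists>\<epsilon>0>0. \<forall>\<epsilon>. 0 < \<epsilon> \<and> \<epsilon> \<le> \<epsilon>0 \<longrightarrow>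
        (AE x in lebesgue_on \<Omega>. \<bar>L_eps \<Omega> J B \<epsilon> u x\<bar> \<le> \<phi> x))"

definition cond_L3 :: "'a::euclidean_space set \<Rightarrow> ('a \<Rightarrow> 'a \<Rightarrow> real) \<Rightarrow> ('a \<Rightarrow> real) \<Rightarrow> bool" where
  "cond_L3 \<Omega> J B \<longleftrightarrow>
     (\<exists>\<Lambda>>0. \<forall>u\<in>test_functions \<Omega>.
        (\<integral>x. (u x)\<^sup>2 \<partial>lebesgue_on \<Omega>) \<le> \<Lambda> * (\<integral>x. L_op \<Omega> J B u x * u x \<partial>lebesgue_on \<Omega>))"

definition energy :: "'a::euclidean_space set \<Rightarrow> ('a \<Rightarrow> 'a \<Rightarrow> real) \<Rightarrow> ('a \<Rightarrow> real) \<Rightarrow>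
    ('a \<Rightarrow> real) \<Rightarrow> ('a \<Rightarrow> real) \<Rightarrow> real" where
  "energy \<Omega> J B u v =
     1 / 2 * integral\<^sup>L (lebesgue_on (\<Omega> \<times> \<Omega>)) (\<lambda>(x, y). J x y * (u x - u y) * (v x - v y)) +
     (\<integral>x. B x * u x * v x \<partial>lebesgue_on \<Omega>)"

text \<open>
  Both terms of \<open>\<E>(u, u)\<close> have nonnegative integrands, so \<open>\<E>(u, u) < \<infinity>\<close> means that both are
  integrable.
\<close>
definition energy_domain :: "'a::euclidean_space set \<Rightarrow> ('a \<Rightarrow> 'a \<Rightarrow> real) \<Rightarrow> ('a \<Rightarrow> real) \<Rightarrow>
    ('a \<Rightarrow> real) set" where
  "energy_domain \<Omega> J B = {u \<in> L2_space \<Omega>.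
     integrable (lebesgue_on (\<Omega> \<times> \<Omega>)) (\<lambda>(x, y). J x y * (u x - u y)\<^sup>2) \<and>
     integrable (lebesgue_on \<Omega>) (\<lambda>x. B x * (u x)\<^sup>2)}"

definition H_space :: "'a::euclidean_space set \<Rightarrow> ('a \<Rightarrow> 'a \<Rightarrow> real) \<Rightarrow> ('a \<Rightarrow> real) \<Rightarrow>
    ('a \<Rightarrow> real) set" where
  "H_space \<Omega> J B = {u \<in> energy_domain \<Omega> J B. \<forall>\<epsilon>>0. \<exists>\<phi>\<in>test_functions \<Omega>.
     (\<integral>x. (u x - \<phi> x)\<^sup>2 \<partial>lebesgue_on \<Omega>) +
       energy \<Omega> J B (\<lambda>x. u x - \<phi> x) (\<lambda>x. u x - \<phi> x) < \<epsilon>}"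

definition cond_L4 :: "'a::euclidean_space set \<Rightarrow> ('a \<Rightarrow> 'a \<Rightarrow> real) \<Rightarrow> ('a \<Rightarrow> real) \<Rightarrow>
    real \<Rightarrow> bool" where
  "cond_L4 \<Omega> J B s \<longleftrightarrow> H_space \<Omega> J B = Hs00_space \<Omega> s"

subsection \<open>The Green function\<close>

text \<open>
  \<open>G\<close> is meaningful only off the diagonal. Removing the point \<open>x\<close> does not change the integral
  against Lebesgue measure.
\<close>
definition green_op :: "'a::euclidean_space set \<Rightarrow> ('a \<Rightarrow> 'a \<Rightarrow> real) \<Rightarrow> ('a \<Rightarrow> real) \<Rightarrow>
    'a \<Rightarrow> real" where
  "green_op \<Omega> G f x = (\<integral>y. G x y * f y \<partial>lebesgue_on (\<Omega> - {x}))"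

definition green_solution :: "'a::euclidean_space set \<Rightarrow> ('a \<Rightarrow> 'a \<Rightarrow> real) \<Rightarrow> ('a \<Rightarrow> real) \<Rightarrow>
    ('a \<Rightarrow> real) \<Rightarrow> ('a \<Rightarrow> real) \<Rightarrow> bool" where
  "green_solution \<Omega> J B f u \<longleftrightarrow> u \<in> H_space \<Omega> J B \<and>
     (\<forall>v\<in>H_space \<Omega> J B. energy \<Omega> J B u v = (\<integral>x. f x * v x \<partial>lebesgue_on \<Omega>))"

definition green_profile :: "'a::euclidean_space set \<Rightarrow> real \<Rightarrow> real \<Rightarrow> 'a \<Rightarrow> 'a \<Rightarrow> real" where
  "green_profile \<Omega> s \<gamma> x y =
     1 / norm (x - y) powr (real DIM('a) - 2 * s) *
     min (bdist \<Omega> x / norm (x - y)) 1 powr \<gamma> *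
     min (bdist \<Omega> y / norm (x - y)) 1 powr \<gamma>"

definition cond_G1 :: "'a::euclidean_space set \<Rightarrow> ('a \<Rightarrow> 'a \<Rightarrow> real) \<Rightarrow> ('a \<Rightarrow> real) \<Rightarrow>
    ('a \<Rightarrow> 'a \<Rightarrow> real) \<Rightarrow> real \<Rightarrow> real \<Rightarrow> bool" where
  "cond_G1 \<Omega> J B G s \<gamma> \<longleftrightarrow>
     0 < s \<and> s \<le> 1 \<and> 0 < \<gamma> \<and> \<gamma> \<le> 1 \<and> 2 * s < real DIM('a) \<and>
     (\<lambda>(x, y). G x y) \<in> borel_measurable (restrict_space borel (offdiag \<Omega>)) \<and>
     (\<forall>(x, y)\<in>offdiag \<Omega>. 0 < G x y \<and> G x y = G y x) \<and>
     (\<exists>C>0. \<forall>(x, y)\<in>offdiag \<Omega>.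
        green_profile \<Omega> s \<gamma> x y / C \<le> G x y \<and> G x y \<le> C * green_profile \<Omega> s \<gamma> x y) \<and>
     (\<forall>f\<in>L2_space \<Omega>. green_solution \<Omega> J B f (green_op \<Omega> G f))"

definition cond_G2 :: "'a::euclidean_space set \<Rightarrow> ('a \<Rightarrow> 'a \<Rightarrow> real) \<Rightarrow> bool" where
  "cond_G2 \<Omega> G \<longleftrightarrow> continuous_on (offdiag \<Omega>) (\<lambda>(x, y). G x y)"

definition cond_G3 :: "'a::euclidean_space set \<Rightarrow> ('a \<Rightarrow> 'a \<Rightarrow> real) \<Rightarrow> real \<Rightarrow> bool" where
  "cond_G3 \<Omega> G \<gamma> \<longleftrightarrow>
     (\<exists>M. (\<forall>x0\<in>\<Omega>. \<forall>z0\<in>frontier \<Omega>. 0 < M x0 z0 \<and>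
            ((\<lambda>(x, y). G x y / bdist \<Omega> y powr \<gamma>) \<longlongrightarrow> M x0 z0)
              (at (x0, z0) within offdiag \<Omega>)) \<and>
          continuous_on (\<Omega> \<times> frontier \<Omega>) (\<lambda>(x, z). M x z))"

subsection \<open>Signed Radon measures\<close>

text \<open>
  A signed Radon measure on \<open>\<Omega>\<close> need not be defined on all Borel subsets of \<open>\<Omega>\<close>, since its
  positive and negative parts may both be infinite. It is a real set function that is countably
  additive on the Borel subsets of each compact subset of \<open>\<Omega>\<close>.
\<close>
definition signed_radon :: "'a::euclidean_space set \<Rightarrow> ('a set \<Rightarrow> real) \<Rightarrow> bool" where
  "signed_radon \<Omega> \<mu> \<longleftrightarrow>
     (\<forall>K. compact K \<and> K \<subseteq> \<Omega> \<longrightarrow>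
        (\<forall>A :: nat \<Rightarrow> 'a set. disjoint_family A \<and> (\<forall>i. A i \<in> sets borel \<and> A i \<subseteq> K) \<longrightarrow>
           (\<lambda>i. \<mu> (A i)) sums \<mu> (\<Union>i. A i)))"

text \<open>The Jordan positive part as upper variation; \<^term>\<open>ennreal\<close> sends negative values to 0.\<close>
definition pos_part :: "'a::euclidean_space set \<Rightarrow> ('a set \<Rightarrow> real) \<Rightarrow> 'a measure" where
  "pos_part \<Omega> \<mu> = measure_of \<Omega> (sets (restrict_space borel \<Omega>))
     (\<lambda>A. SUP E \<in> {E \<in> sets borel. E \<subseteq> A \<and> (\<exists>K. compact K \<and> K \<subseteq> \<Omega> \<and> E \<subseteq> K)}. ennreal (\<mu> E))"

definition neg_part :: "'a::euclidean_space set \<Rightarrow> ('a set \<Rightarrow> real) \<Rightarrow> 'a measure" where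
  "neg_part \<Omega> \<mu> = pos_part \<Omega> (\<lambda>A. - \<mu> A)"

definition total_variation :: "'a::euclidean_space set \<Rightarrow> ('a set \<Rightarrow> real) \<Rightarrow> 'a measure" where
  "total_variation \<Omega> \<mu> = measure_of \<Omega> (sets (restrict_space borel \<Omega>))
     (\<lambda>A. emeasure (pos_part \<Omega> \<mu>) A + emeasure (neg_part \<Omega> \<mu>) A)"

definition weighted_measures :: "'a::euclidean_space set \<Rightarrow> real \<Rightarrow> ('a set \<Rightarrow> real) set" where
  "weighted_measures \<Omega> \<gamma> = {\<mu>. signed_radon \<Omega> \<mu> \<and>
     (\<integral>\<^sup>+x. ennreal (bdist \<Omega> x powr \<gamma>) \<partial>total_variation \<Omega> \<mu>) < \<infinity>}"

text \<open>
  Leaving out \<open>y = x\<close>, where \<open>G\<close> is undefined, matters only at the atoms of \<open>\<mu>\<close>; these form a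
  countable, hence Lebesgue null, set of points \<open>x\<close>.
\<close>
definition green_op_measure :: "'a::euclidean_space set \<Rightarrow> ('a \<Rightarrow> 'a \<Rightarrow> real) \<Rightarrow>
    ('a set \<Rightarrow> real) \<Rightarrow> 'a \<Rightarrow> real" where
  "green_op_measure \<Omega> G \<mu> x =
     (\<integral>y. G x y \<partial>restrict_space (pos_part \<Omega> \<mu>) (\<Omega> - {x})) -
     (\<integral>y. G x y \<partial>restrict_space (neg_part \<Omega> \<mu>) (\<Omega> - {x}))"

definition sgn_plus :: "real \<Rightarrow> real" where
  "sgn_plus t = max (sgn t) 0"

end

theory Submission
  imports Defs
begin

text \<open>
  For square integrable data, test the equation of \<open>u\<close> with \<open>v p(u)\<close> and that of the Green potential
  \<open>v\<close> of \<open>\<xi>\<close> with \<open>P(u)\<close>, where \<open>P\<close> is a smooth convex approximation of the absolute value or of the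
  positive part and \<open>p\<close> is its derivative. By convexity of \<open>P\<close>,
  \<open>(P(a) - P(b)) (v - v') \<le> (a - b) (v p(a) - v' p(b))\<close> for \<open>v, v' \<ge> 0\<close>, which gives the inequality for
  \<open>(p, P)\<close>. The test functions lie in the form domain because for \<open>s < 1\<close> it is a Gagliardo space by
  (L4). The case \<open>s = 1\<close> is empty: the bound on the Green function makes capacities of small balls too
  large for a form with \<open>\<bar>x - y\<bar>\<^sup>2 J\<close> integrable.

  Integrable data are truncated and measures are mollified. Both limits, and the one from \<open>p\<close> to the
  sign function, are taken by dominated convergence: the Green function times \<open>\<delta>\<^sup>\<gamma>(x)\<close> is at most a
  constant times \<open>\<delta>\<^sup>\<gamma>(y)\<close> times the Riesz kernel. For measures, joint continuity of the Green function
  gives convergence of the mollified potentials, and the integrals of the Green potential of \<open>\<xi>\<close>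
  against them converge by symmetry.
\<close>

subsection \<open>Lebesgue measure on products and the Riesz kernel\<close>

text \<open>The sign of \<open>u\<close> jumps, so its product with \<open>v\<close> is in general
  no test function; a Lipschitz \<open>p\<close> and a bounded \<open>v\<close> are what keep
  \<open>v p(u)\<close> in a Gagliardo space. Since \<open>\<xi>\<close> is only bounded by a
  multiple of the weight \<delta>^\<gamma>, potentials have to be controlled only after
  multiplication by the weight. One quantity does this for functions and measures alike: the Riesz
  potential of the weighted measure. It is integrable over the domain, hence finite almost
  everywhere, and at a point where it is finite the measure has no atom. For measure data the factor
  \<open>p(u)\<close> cannot be carried to the limit: the potentials converge only up to Lebesgue
  null sets, which a singular measure may charge. Hence on the mollified measures \<open>p\<close>
  is replaced by its bounds \<open>-c \<le> p \<le> 1\<close> before the limit. A nonnegative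
  \<open>p\<close> has \<open>c = 0\<close>, which leaves the positive part of the measure alone;
  the absolute value has \<open>c = 1\<close>, and both parts remain.\<close>

lemma measurable_fst_lebesgue:
  "fst \<in> measurable (lebesgue :: ('a::euclidean_space \<times> 'a) measure) lebesgue"
proof (rule measurableI)
  fix A :: "'a set" assume "A \<in> sets lebesgue"
  then obtain S N N' where A: "A = S \<union> N" "N \<subseteq> N'" "N' \<in> null_sets lborel" "S \<in> sets lborel"
    by (auto elim: sets_completionE)
  \<comment> \<open>\<open>lebesgue\<close> on pairs is the completion of the Borel product measure,
    so Borel measurability of \<open>fst\<close> does not suffice: null sets must pull back to null
    sets, and the cylinder over one has measure \<open>0 * \<infinity> = 0\<close>.\<close>
  have "N' \<times> (UNIV::'a set) \<in> null_sets lborel"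
    using A(3) by (auto simp: null_sets_def lborel_prod[symmetric] lborel.emeasure_pair_measure_Times)
  moreover have "N \<times> (UNIV::'a set) \<subseteq> N' \<times> UNIV" using A by auto
  ultimately have "N \<times> (UNIV::'a set) \<in> sets lebesgue"
    using null_sets_completion_subset null_sets_completionI by blast
  moreover have "S \<times> (UNIV::'a set) \<in> sets lebesgue"
  proof -
    have "S \<times> (UNIV::'a set) \<in> sets lborel"
      using A(4) by (auto simp: lborel_prod[symmetric])
    then show ?thesis by simp
  qed
  moreover have "fst -` A \<inter> space lebesgue = S \<times> (UNIV::'a set) \<union> N \<times> UNIV"
    using A(1) by auto
  ultimately show "fst -` A \<inter> space lebesgue \<in> sets (lebesgue :: ('a \<times> 'a) measure)"
    by simp
qed auto

lemma measurable_snd_lebesgue: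
  "snd \<in> measurable (lebesgue :: ('a::euclidean_space \<times> 'a) measure) lebesgue"
proof (rule measurableI)
  fix A :: "'a set" assume "A \<in> sets lebesgue"
  then obtain S N N' where A: "A = S \<union> N" "N \<subseteq> N'" "N' \<in> null_sets lborel" "S \<in> sets lborel"
    by (auto elim: sets_completionE)
  have "(UNIV::'a set) \<times> N' \<in> null_sets lborel"
    using A(3) by (auto simp: null_sets_def lborel_prod[symmetric] lborel.emeasure_pair_measure_Times)
  moreover have "(UNIV::'a set) \<times> N \<subseteq> UNIV \<times> N'" using A by auto
  ultimately have "(UNIV::'a set) \<times> N \<in> sets lebesgue"
    using null_sets_completion_subset null_sets_completionI by blast
  moreover have "(UNIV::'a set) \<times> S \<in> sets lborel"
    using A(4) by (auto simp: lborel_prod[symmetric])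
  moreover have "snd -` A \<inter> space lebesgue = (UNIV::'a set) \<times> S \<union> UNIV \<times> N"
    using A(1) by auto
  ultimately show "snd -` A \<inter> space lebesgue \<in> sets (lebesgue :: ('a \<times> 'a) measure)"
    by (simp add: sets.Un)
qed auto

lemma measurable_lebesgue_on_Times_fst:
  fixes u :: "'a::euclidean_space \<Rightarrow> real"
  assumes "u \<in> borel_measurable (lebesgue_on S)"
  shows "(\<lambda>z. u (fst z)) \<in> borel_measurable (lebesgue_on (S \<times> S))"
proof -
  have "fst \<in> measurable (lebesgue_on (S \<times> S)) (lebesgue_on S)"
    by (rule measurable_restrict_space2[OF _ measurable_restrict_space1[OF measurable_fst_lebesgue]]) auto
  from measurable_compose[OF this assms] show ?thesis .
qed

lemma measurable_lebesgue_on_Times_snd: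
  fixes u :: "'a::euclidean_space \<Rightarrow> real"
  assumes "u \<in> borel_measurable (lebesgue_on S)"
  shows "(\<lambda>z. u (snd z)) \<in> borel_measurable (lebesgue_on (S \<times> S))"
proof -
  have "snd \<in> measurable (lebesgue_on (S \<times> S)) (lebesgue_on S)"
    by (rule measurable_restrict_space2[OF _ measurable_restrict_space1[OF measurable_snd_lebesgue]]) auto
  from measurable_compose[OF this assms] show ?thesis .
qed

text \<open>An exceptional null set spoils only two cylinders of the square, and these are
  null.\<close>

lemma AE_lebesgue_on_Times:
  fixes Q :: "'a::euclidean_space \<Rightarrow> bool"
  assumes S: "S \<in> sets lebesgue" "S \<times> S \<in> sets lebesgue" and Q: "AE x in lebesgue_on S. Q x"
  shows "AE z in lebesgue_on (S \<times> S). Q (fst z) \<and> Q (snd z)"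
proof -
  have Q': "AE x in lebesgue. x \<in> S \<longrightarrow> Q x" using Q S by (simp add: AE_restrict_space_iff)
  then obtain N0 where N0: "N0 \<in> null_sets lebesgue" "{x \<in> space lebesgue. \<not> (x \<in> S \<longrightarrow> Q x)} \<subseteq> N0"
    unfolding eventually_ae_filter by blast
  then obtain N where "N \<in> null_sets lborel" "N0 \<subseteq> N"
    unfolding null_sets_completion_iff2 by blast
  with N0 have N: "N \<in> null_sets lborel" "{x. \<not> (x \<in> S \<longrightarrow> Q x)} \<subseteq> N" by auto
  have "(UNIV::'a set) \<times> N \<in> null_sets lborel" "N \<times> (UNIV::'a set) \<in> null_sets lborel"
    using N(1) by (auto simp: null_sets_def lborel_prod[symmetric] lborel.emeasure_pair_measure_Times)
  then have "UNIV \<times> N \<union> N \<times> UNIV \<in> null_sets (lebesgue :: ('a \<times> 'a) measure)"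
    by (intro null_sets.Un null_sets_completionI)
  then have "AE z in lebesgue. z \<notin> UNIV \<times> N \<union> N \<times> UNIV" by (rule AE_not_in)
  then have "AE z in lebesgue. z \<in> S \<times> S \<longrightarrow> Q (fst z) \<and> Q (snd z)"
    by eventually_elim (use N(2) in auto)
  then show ?thesis
    using S(2) by (subst AE_restrict_space_iff) auto
qed

lemma ennreal_le_suminf: "f k \<le> (\<Sum>i. f i)" for f :: "nat \<Rightarrow> ennreal"
proof -
  have "sum f {k} \<le> (\<Sum>i. f i)"
    by (rule sum_le_suminf[OF summableI]) auto
  then show ?thesis by simp
qed

text \<open>Dyadic radii \<open>r k = R / 2^k\<close>: where
  \<open>r (k + 1) \<le> \<bar>x - y\<bar> < r k\<close>, the kernel is at most its value at the
  inner radius, and the ball of radius \<open>r k\<close> has volume \<open>V (r k)^n\<close>. The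
  contributions form a geometric series with ratio \<open>2 powr (-\<beta>)\<close>, convergent
  because \<open>\<beta> > 0\<close>; its sum is the origin of \<open>C\<close>.\<close>

lemma nn_integral_riesz_kernel_ball:
  fixes \<beta> :: real
  assumes "0 < \<beta>" "\<beta> \<le> DIM('a::euclidean_space)"
  shows "\<exists>C>0. \<forall>(x::'a) R. 0 < R \<longrightarrow>
    (\<integral>\<^sup>+y. ennreal (norm (x - y) powr (\<beta> - DIM('a))) * indicator (ball x R) y \<partial>lborel)
      \<le> ennreal (C * R powr \<beta>)"
proof -
  define n where "n = real DIM('a)"
  define V where "V = unit_ball_vol n"
  define C where "C = V * 2 powr (n - \<beta>) * (1 / (1 - 2 powr (-\<beta>)))"
  have V: "0 < V" by (simp add: V_def n_def)
  have q: "2 powr (-\<beta>) < (1::real)" using assms by (simp add: powr_less_one)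
  have C: "0 < C" using V q by (simp add: C_def)
  have main: "(\<integral>\<^sup>+y. ennreal (norm (x - y) powr (\<beta> - n)) * indicator (ball x R) y \<partial>lborel)
      \<le> ennreal (C * R powr \<beta>)" if R: "0 < R" for x :: 'a and R
  proof -
    define r where "r k = R / 2 ^ k" for k :: nat
    have r0: "0 < r k" for k using R by (simp add: r_def)
    have pt: "ennreal (norm (x - y) powr (\<beta> - n)) * indicator (ball x R) y
        \<le> (\<Sum>k. ennreal (r (Suc k) powr (\<beta> - n)) * indicator (ball x (r k)) y)"
      for y
    \<comment> \<open>At \<open>y = x\<close> the left side is 0, since
      \<open>0 powr a = 0\<close>.\<close>
    proof (cases "y \<in> ball x R \<and> y \<noteq> x")
      case True
      define t where "t = norm (x - y)"
      have t: "0 < t" "t < R" using True by (auto simp: t_def dist_norm)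
      have ex: "\<exists>k. r k \<le> t"
      proof -
        obtain k where "(1/2)^k < t / R" using t R real_arch_pow_inv[of "t/R" "1/2"] by auto
        then have "r k \<le> t" using R by (simp add: r_def field_simps)
        then show ?thesis ..
      qed
      define m where "m = (LEAST k. r k \<le> t)"
      have m1: "r m \<le> t" unfolding m_def by (rule LeastI_ex[OF ex])
      have "m \<noteq> 0" using m1 t by (auto simp: r_def intro: ccontr)
      then obtain k where k: "m = Suc k" by (cases m) auto
      have "t < r k" using not_less_Least[of k "\<lambda>k. r k \<le> t"] k by (auto simp: m_def)
      then have "y \<in> ball x (r k)" by (simp add: t_def dist_norm)
      moreover have "t powr (\<beta> - n) \<le> r (Suc k) powr (\<beta> - n)"
        using m1 k assms r0 by (intro powr_mono2') (auto simp: n_def)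
      ultimately have "ennreal (norm (x - y) powr (\<beta> - n)) * indicator (ball x R) y
          \<le> ennreal (r (Suc k) powr (\<beta> - n)) * indicator (ball x (r k)) y"
        using True by (auto simp: t_def ennreal_leI)
      also have "\<dots> \<le> (\<Sum>k. ennreal (r (Suc k) powr (\<beta> - n)) * indicator (ball x (r k)) y)"
        using ennreal_le_suminf[of "\<lambda>k. ennreal (r (Suc k) powr (\<beta> - n)) * indicator (ball x (r k)) y" k] .
      finally show ?thesis .
    qed (auto simp: indicator_def)
    have "(\<integral>\<^sup>+y. ennreal (norm (x - y) powr (\<beta> - n)) * indicator (ball x R) y \<partial>lborel)
       \<le> (\<integral>\<^sup>+y. (\<Sum>k. ennreal (r (Suc k) powr (\<beta> - n)) * indicator (ball x (r k)) y) \<partial>lborel)"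
      by (rule nn_integral_mono) (rule pt)
    also have "\<dots> = (\<Sum>k. \<integral>\<^sup>+y. ennreal (r (Suc k) powr (\<beta> - n)) * indicator (ball x (r k)) y \<partial>lborel)"
      apply (rule nn_integral_suminf)
      apply (intro borel_measurable_times_ennreal borel_measurable_const borel_measurable_indicator)
      apply simp
      done
    also have "\<dots> = (\<Sum>k. ennreal (V * 2 powr (n - \<beta>) * R powr \<beta> * (2 powr (-\<beta>)) ^ k))"
    proof (rule suminf_cong)
      fix k
      have "(\<integral>\<^sup>+y. ennreal (r (Suc k) powr (\<beta> - n)) * indicator (ball x (r k)) y \<partial>lborel)
          = ennreal (r (Suc k) powr (\<beta> - n)) * ennreal (V * r k ^ DIM('a))"
        using r0[of k] by (subst nn_integral_cmult_indicator) (auto simp: emeasure_ball V_def n_def)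
      also have "\<dots> = ennreal (r (Suc k) powr (\<beta> - n) * (V * r k ^ DIM('a)))"
        by (simp add: ennreal_mult' V_def n_def r0 less_imp_le)
      also have "r (Suc k) powr (\<beta> - n) * (V * r k ^ DIM('a))
          = V * 2 powr (n - \<beta>) * R powr \<beta> * (2 powr (-\<beta>)) ^ k"
      proof -
        have e: "r (Suc k) = r k / 2" by (simp add: r_def)
        have a: "r (Suc k) powr (\<beta> - n) = r k powr (\<beta> - n) * 2 powr (n - \<beta>)"
          unfolding e using r0[of k] by (simp add: powr_divide powr_diff field_simps)
        have b: "r k ^ DIM('a) = r k powr n" using r0[of k] by (simp add: n_def powr_realpow)
        have c: "r k powr (\<beta> - n) * r k powr n = r k powr \<beta>"
          using r0[of k] by (simp add: powr_add[symmetric])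
        have d: "r k powr \<beta> = R powr \<beta> * (2 powr (-\<beta>)) ^ k"
        proof -
          have "r k = R * 2 powr (- real k)" by (simp add: r_def powr_minus powr_realpow field_simps)
          then have "r k powr \<beta> = R powr \<beta> * (2 powr (- real k)) powr \<beta>"
            using R by (simp add: powr_mult)
          also have "(2 powr (- real k)) powr \<beta> = (2 powr (-\<beta>)) powr real k"
            by (simp add: powr_powr mult.commute)
          also have "\<dots> = (2 powr (-\<beta>)) ^ k" by (simp add: powr_realpow)
          finally show ?thesis .
        qed
        show ?thesis unfolding a b using c d by (simp add: algebra_simps)
      qed
      finally show "(\<integral>\<^sup>+y. ennreal (r (Suc k) powr (\<beta> - n)) * indicator (ball x (r k)) y \<partial>lborel)
          = ennreal (V * 2 powr (n - \<beta>) * R powr \<beta> * (2 powr (-\<beta>)) ^ k)" .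
    qed
    also have "\<dots> = ennreal (\<Sum>k. V * 2 powr (n - \<beta>) * R powr \<beta> * (2 powr (-\<beta>)) ^ k)"
      using q V R by (intro suminf_ennreal2) (auto intro!: summable_mult summable_geometric)
    also have "(\<Sum>k. V * 2 powr (n - \<beta>) * R powr \<beta> * (2 powr (-\<beta>)) ^ k) = C * R powr \<beta>"
      using q by (simp add: suminf_mult suminf_geometric summable_geometric C_def)
    finally show ?thesis .
  qed
  then show ?thesis using C unfolding n_def by blast
qed

subsection \<open>Weighted estimates for the Green kernel\<close>

locale green_kernel =
  fixes \<Omega> :: "'a::euclidean_space set" and G :: "'a \<Rightarrow> 'a \<Rightarrow> real" and s \<gamma> C :: real
  assumes open_dom: "open \<Omega>" and bounded_dom: "bounded \<Omega>"
    and s_pos: "0 < s" and s_dim: "2 * s < real DIM('a)" and \<gamma>_pos: "0 < \<gamma>" and C_pos: "0 < C"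
    and G_meas: "(\<lambda>(x, y). G x y) \<in> borel_measurable (restrict_space borel (offdiag \<Omega>))"
    and G_pos: "\<And>x y. x \<in> \<Omega> \<Longrightarrow> y \<in> \<Omega> \<Longrightarrow> x \<noteq> y \<Longrightarrow> 0 < G x y"
    and G_sym: "\<And>x y. x \<in> \<Omega> \<Longrightarrow> y \<in> \<Omega> \<Longrightarrow> x \<noteq> y \<Longrightarrow> G x y = G y x"
    and G_upper: "\<And>x y. x \<in> \<Omega> \<Longrightarrow> y \<in> \<Omega> \<Longrightarrow> x \<noteq> y \<Longrightarrow> G x y \<le> C * green_profile \<Omega> s \<gamma> x y"
begin

abbreviation Leb :: "'a measure" where
  "Leb \<equiv> lebesgue_on \<Omega>"

abbreviation Leb2 :: "('a \<times> 'a) measure" where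
  "Leb2 \<equiv> lebesgue_on (\<Omega> \<times> \<Omega>)"

definition weight :: "'a \<Rightarrow> real" where
  "weight x = bdist \<Omega> x powr \<gamma>"

text \<open>Extension by zero makes the kernel a symmetric Borel function on the whole product
  space, so that Fubini applies with any measure on the domain. The zero on the diagonal matches the
  removal of \<open>y = x\<close> in \<open>green_op\<close> and
  \<open>green_op_measure\<close>.\<close>

definition green0 :: "'a \<Rightarrow> 'a \<Rightarrow> real" where
  "green0 x y = (if (x, y) \<in> offdiag \<Omega> then G x y else 0)"

definition riesz :: "'a \<Rightarrow> 'a \<Rightarrow> real" where
  "riesz x y = norm (x - y) powr (2 * s - DIM('a))"

text \<open>The value \<open>\<infinity>\<close> on the diagonal makes the finiteness of the potential of a measure at \<open>x\<close>
  exclude an atom at \<open>x\<close>.\<close>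
definition riesz_top :: "'a \<Rightarrow> 'a \<Rightarrow> ennreal" where
  "riesz_top x y = (if x = y then \<infinity> else ennreal (riesz x y))"

lemma green0_nonneg: "0 \<le> green0 x y"
  using G_pos[of x y] by (auto simp: green0_def offdiag_def)

lemma green0_sym: "green0 x y = green0 y x"
  using G_sym[of x y] by (auto simp: green0_def offdiag_def)

lemma riesz_top_sym: "riesz_top x y = riesz_top y x"
  by (auto simp: riesz_top_def riesz_def norm_minus_commute)

lemma weight_nonneg: "0 \<le> weight x"
  by (simp add: weight_def)

lemma compl_nonempty: "- \<Omega> \<noteq> {}"
  using bounded_dom not_bounded_UNIV by (metis Compl_empty_eq double_complement)

lemma bdist_pos: "x \<in> \<Omega> \<Longrightarrow> 0 < bdist \<Omega> x"
  unfolding bdist_def using open_dom compl_nonempty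
  by (intro infdist_pos_not_in_closed) auto

lemma bdist_triangle: "bdist \<Omega> x \<le> bdist \<Omega> y + norm (x - y)"
  unfolding bdist_def using infdist_triangle[of x "- \<Omega>" y] by (simp add: dist_norm)

lemma weight_pos: "x \<in> \<Omega> \<Longrightarrow> 0 < weight x"
  using bdist_pos[of x] by (simp add: weight_def)

lemma bdist_measurable [measurable]: "bdist \<Omega> \<in> borel_measurable borel"
  unfolding bdist_def by (intro borel_measurable_continuous_onI continuous_intros)

lemma weight_measurable [measurable]: "weight \<in> borel_measurable borel"
  unfolding weight_def[abs_def] by measurable

lemma weight_bounded: "\<exists>D>0. \<forall>x\<in>\<Omega>. weight x \<le> D"
proof -
  obtain z where z: "z \<in> - \<Omega>" using compl_nonempty by auto
  obtain R where R: "\<And>x. x \<in> \<Omega> \<Longrightarrow> norm x \<le> R" using bounded_dom by (auto simp: bounded_iff)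
  have "weight x \<le> (\<bar>R\<bar> + norm z + 1) powr \<gamma>" if "x \<in> \<Omega>" for x
  proof -
    have "bdist \<Omega> x \<le> dist x z" unfolding bdist_def using z by (rule infdist_le)
    also have "\<dots> \<le> norm x + norm z" by (simp add: dist_norm norm_triangle_ineq4)
    finally have "bdist \<Omega> x \<le> \<bar>R\<bar> + norm z + 1" using R[OF that] by linarith
    then show ?thesis unfolding weight_def using \<gamma>_pos bdist_pos[OF that] by (intro powr_mono2) auto
  qed
  moreover have "0 < (\<bar>R\<bar> + norm z + 1) powr \<gamma>"
    using norm_ge_zero[of z] abs_ge_zero[of R] by (simp del: norm_ge_zero abs_ge_zero)
  ultimately show ?thesis by blast
qed

text \<open>With \<open>a\<close>, \<open>b\<close> the distances of \<open>x\<close>,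
  \<open>y\<close> to the boundary and \<open>t = \<bar>x - y\<bar>\<close>, the inequality
  \<open>a \<le> b + t\<close> gives \<open>min (b / t) 1 * a \<le> 2 * b\<close>; raised to the
  power \<gamma> it yields the factor \<open>2 powr \<gamma>\<close>.\<close>

definition green_const :: real where "green_const = C * 2 powr \<gamma>"

lemma green_const_pos: "0 < green_const" using C_pos by (simp add: green_const_def)

lemma riesz_nonneg: "0 \<le> riesz x y" by (simp add: riesz_def)

text \<open>The triangle inequality \<open>bdist x \<le> bdist y + \<bar>x - y\<bar>\<close> lets the weight move from one
  variable of \<open>G\<close> to the other.\<close>
lemma green0_wt_bound: "x \<in> \<Omega> \<Longrightarrow> y \<in> \<Omega> \<Longrightarrow> green0 x y * weight x \<le> green_const * (weight y * riesz x y)"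
proof (cases "x = y")
  case True
  then show ?thesis using green_const_pos by (simp add: green0_def offdiag_def weight_def riesz_nonneg)
next
  case False
  assume x: "x \<in> \<Omega>" and y: "y \<in> \<Omega>"
  define t where "t = norm (x - y)"
  define a where "a = bdist \<Omega> x"
  define b where "b = bdist \<Omega> y"
  have t: "0 < t" using False by (simp add: t_def)
  have ab: "0 < a" "0 < b" "a \<le> b + t" using bdist_pos x y bdist_triangle by (auto simp: a_def b_def t_def)
  have m: "min (b / t) 1 * a \<le> 2 * b"
  proof (cases "b \<le> t")
    case True
    have "b * a \<le> b * (2 * t)" using ab True by (intro mult_left_mono) auto
    then show ?thesis using True t ab by (simp add: min_def field_simps)
  next
    case False then show ?thesis using ab t by (simp add: min_def field_simps)
  qed
  have e: "min (b / t) 1 powr \<gamma> * weight x \<le> 2 powr \<gamma> * weight y"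
  proof -
    have "min (b / t) 1 powr \<gamma> * weight x = (min (b / t) 1 * a) powr \<gamma>"
      using ab t by (simp add: weight_def a_def powr_mult)
    also have "\<dots> \<le> (2 * b) powr \<gamma>" using m ab t \<gamma>_pos by (intro powr_mono2) auto
    also have "\<dots> = 2 powr \<gamma> * weight y" using ab by (simp add: weight_def b_def powr_mult)
    finally show ?thesis .
  qed
  have k: "1 / t powr (real DIM('a) - 2 * s) = riesz x y"
    using t by (simp add: riesz_def t_def powr_minus[symmetric] inverse_eq_divide[symmetric])
  have "green0 x y * weight x \<le> (C * green_profile \<Omega> s \<gamma> x y) * weight x"
    using G_upper[OF x y False] x y False weight_nonneg by (auto simp: green0_def offdiag_def intro!: mult_right_mono)
  also have "\<dots> = C * riesz x y * min (a / t) 1 powr \<gamma> * (min (b / t) 1 powr \<gamma> * weight x)"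
    by (simp add: green_profile_def k[symmetric] a_def b_def t_def)
  also have "\<dots> \<le> C * riesz x y * 1 * (2 powr \<gamma> * weight y)"
    using ab t C_pos \<gamma>_pos
    by (intro mult_mono e) (auto simp: riesz_nonneg weight_nonneg powr_le1 intro!: mult_nonneg_nonneg)
  finally show ?thesis by (simp add: green_const_def algebra_simps)
qed

lemma offdiag_open: "open (offdiag \<Omega>)"
proof -
  have "closed {z :: 'a \<times> 'a. fst z = snd z}" by (intro closed_Collect_eq continuous_intros)
  then have "open (\<Omega> \<times> \<Omega> - {z. fst z = snd z})" using open_dom by (intro open_Diff open_Times)
  moreover have "offdiag \<Omega> = \<Omega> \<times> \<Omega> - {z. fst z = snd z}" by (auto simp: offdiag_def)
  ultimately show ?thesis by simp
qed

lemma green0_measurable: "(\<lambda>z. green0 (fst z) (snd z)) \<in> borel_measurable (borel \<Otimes>\<^sub>M borel)"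
proof -
  have "(\<lambda>z. indicator (offdiag \<Omega>) z *\<^sub>R (case z of (x, y) \<Rightarrow> G x y)) \<in> borel_measurable (borel :: ('a\<times>'a) measure)"
    using G_meas offdiag_open by (subst (asm) borel_measurable_restrict_space_iff) auto
  moreover have "(\<lambda>z. indicator (offdiag \<Omega>) z *\<^sub>R (case z of (x, y) \<Rightarrow> G x y)) = (\<lambda>z. green0 (fst z) (snd z))"
    by (auto simp: green0_def fun_eq_iff)
  ultimately show ?thesis by (simp add: borel_prod)
qed

lemma riesz_measurable: "(\<lambda>z. riesz (fst z) (snd z)) \<in> borel_measurable (borel \<Otimes>\<^sub>M borel)"
  unfolding riesz_def by measurable

lemma riesz_top_measurable: "(\<lambda>z. riesz_top (fst z) (snd z)) \<in> borel_measurable (borel \<Otimes>\<^sub>M borel)"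
  unfolding riesz_top_def riesz_def by measurable

lemma
  shows green0_measurable1: "green0 x \<in> borel_measurable borel"
    and riesz_measurable1: "riesz x \<in> borel_measurable borel"
    and riesz_top_measurable1: "riesz_top x \<in> borel_measurable borel"
  using measurable_compose[OF measurable_Pair1' green0_measurable, of x]
    measurable_compose[OF measurable_Pair1' riesz_measurable, of x]
    measurable_compose[OF measurable_Pair1' riesz_top_measurable, of x]
  by auto

lemma dom_sets [simp, intro]: "\<Omega> \<in> sets lebesgue" "\<Omega> \<in> sets borel" "\<Omega> \<in> lmeasurable"
  using open_dom bounded_dom by (auto simp: lmeasurable_open)

sublocale finite_measure "Leb"
  by (rule finite_measure_lebesgue_on) simp

lemma id_measurable: "(\<lambda>x. x) \<in> borel_measurable Leb"
  by (intro measurable_restrict_space1 measurable_completion) simp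

lemma riesz_ball: "\<exists>A>0. \<forall>x R. 0 < R \<longrightarrow>
    (\<integral>\<^sup>+y. ennreal (riesz x y) * indicator (ball x R) y \<partial>lborel) \<le> ennreal (A * R powr (2 * s))"
  unfolding riesz_def by (rule nn_integral_riesz_kernel_ball) (use s_pos s_dim in auto)

text \<open>The domain lies in a ball of one fixed radius around each of its points. The value
  \<infinity> on the diagonal does not count, since a point is Lebesgue null.\<close>

lemma riesz_top_integral_bound: "\<exists>K>0. \<forall>y\<in>\<Omega>. (\<integral>\<^sup>+x. riesz_top x y \<partial>Leb) \<le> ennreal K"
proof -
  obtain R where R: "\<And>x. x \<in> \<Omega> \<Longrightarrow> norm x < R" "0 < R"
    using bounded_dom by (meson bounded_pos_less)
  obtain A where A: "0 < A" and A2: "\<forall>x R. 0 < R \<longrightarrow>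
      (\<integral>\<^sup>+y. ennreal (riesz x y) * indicator (ball x R) y \<partial>lborel) \<le> ennreal (A * R powr (2 * s))"
    using riesz_ball by (elim exE conjE)
  have "(\<integral>\<^sup>+x. riesz_top x y \<partial>Leb) \<le> ennreal (A * (2 * R) powr (2 * s))" if y: "y \<in> \<Omega>" for y
  proof -
    have "(\<integral>\<^sup>+x. riesz_top x y \<partial>Leb) = (\<integral>\<^sup>+x. riesz_top x y * indicator \<Omega> x \<partial>lborel)"
      by (simp add: nn_integral_restrict_space nn_integral_completion)
    also have "\<dots> \<le> (\<integral>\<^sup>+x. ennreal (riesz y x) * indicator (ball y (2 * R)) x \<partial>lborel)"
    proof (rule nn_integral_mono_AE)
      have "AE x in lborel. x \<noteq> y" by (rule AE_lborel_singleton)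
      then show "AE x in lborel. riesz_top x y * indicator \<Omega> x
        \<le> ennreal (riesz y x) * indicator (ball y (2 * R)) x"
      proof eventually_elim
        case (elim x)
        have "x \<in> ball y (2 * R)" if "x \<in> \<Omega>"
        proof -
          have "dist y x \<le> norm y + norm x" by (simp add: dist_norm norm_triangle_ineq4)
          then show ?thesis using R(1)[OF y] R(1)[OF that] by simp
        qed
        then show ?case using elim by (auto simp: riesz_top_def riesz_def norm_minus_commute indicator_def)
      qed
    qed
    also have "\<dots> \<le> ennreal (A * (2 * R) powr (2 * s))" using R by (intro A2[rule_format]) auto
    finally show ?thesis .
  qed
  moreover have "0 < A * (2 * R) powr (2 * s)" using A R by simp
  ultimately show ?thesis by blast
qed

definition riesz_const :: real where
  "riesz_const = (SOME K. 0 < K \<and> (\<forall>y\<in>\<Omega>. (\<integral>\<^sup>+x. riesz_top x y \<partial>Leb) \<le> ennreal K))"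

lemma riesz_const: "0 < riesz_const" "y \<in> \<Omega> \<Longrightarrow> (\<integral>\<^sup>+x. riesz_top x y \<partial>Leb) \<le> ennreal riesz_const"
  using someI_ex[OF riesz_top_integral_bound] by (auto simp: riesz_const_def)

section \<open>Measures of finite weighted mass and their potentials\<close>

text \<open>Asking only that the identity be measurable into the Borel sets covers both measures on
  the Borel sets of the domain, such as the variations of \<open>\<mu>\<close>, and densities with
  respect to Lebesgue measure, whose sigma-algebra is larger.\<close>

definition admissible :: "'a measure \<Rightarrow> bool" where
  "admissible P \<longleftrightarrow> space P = \<Omega> \<and> (\<lambda>x. x) \<in> borel_measurable P \<and> (\<integral>\<^sup>+x. ennreal (weight x) \<partial>P) < \<infinity>"

lemma measurable_of_borel:
  "(\<lambda>x. x) \<in> borel_measurable P \<Longrightarrow> f \<in> measurable borel N \<Longrightarrow> f \<in> measurable P N"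
  by (rule measurable_compose)

lemma measurable_of_borel_pair:
  assumes "(\<lambda>x. x) \<in> borel_measurable P" "(\<lambda>x. x) \<in> borel_measurable Q"
    and "f \<in> measurable (borel \<Otimes>\<^sub>M borel) N"
  shows "f \<in> measurable (P \<Otimes>\<^sub>M Q) N"
proof -
  have "(\<lambda>z. (fst z, snd z)) \<in> measurable (P \<Otimes>\<^sub>M Q) (borel \<Otimes>\<^sub>M borel)"
    by (intro measurable_Pair measurable_compose[OF measurable_fst assms(1)]
        measurable_compose[OF measurable_snd assms(2)])
  from measurable_compose[OF this assms(3)] show ?thesis by simp
qed

lemma admissible_id: "admissible P \<Longrightarrow> (\<lambda>x. x) \<in> borel_measurable P"
  by (simp add: admissible_def)

lemma weight_ennreal_measurable: "(\<lambda>x. ennreal (weight x)) \<in> borel_measurable borel"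
  by measurable

text \<open>The sets where the weight is at least \<open>1 / (n + 1)\<close> have finite measure by
  Markov's inequality and exhaust the domain, on which the weight is positive. This gives access to
  Fubini.\<close>

lemma admissible_sigma_finite: "admissible P \<Longrightarrow> sigma_finite_measure P"
proof
  assume P: "admissible P"
  note [measurable] = measurable_of_borel[OF admissible_id[OF P] weight_ennreal_measurable]
  define A where "A n = {x \<in> space P. 1 \<le> ennreal (real (Suc n)) * ennreal (weight x)}" for n
  have As: "A n \<in> sets P" for n unfolding A_def by measurable
  have "emeasure P (A n) < \<infinity>" for n
  proof -
    have "emeasure P (A n) \<le> ennreal (real (Suc n)) * (\<integral>\<^sup>+x. ennreal (weight x) * indicator (space P) x \<partial>P)"
      using nn_integral_Markov_inequality[of "\<lambda>x. ennreal (weight x)" "space P" P "ennreal (real (Suc n))"]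
      by (simp add: A_def)
    also have "\<dots> = ennreal (real (Suc n)) * (\<integral>\<^sup>+x. ennreal (weight x) \<partial>P)"
      by (intro arg_cong2[where f="(*)"] nn_integral_cong) auto
    also have "\<dots> < \<infinity>" using P by (auto simp: admissible_def ennreal_mult_less_top)
    finally show ?thesis .
  qed
  moreover have "(\<Union>n. A n) = space P"
  proof safe
    fix x assume x: "x \<in> space P"
    then have "0 < weight x" using P weight_pos by (auto simp: admissible_def)
    obtain n where "1 / weight x < real n" using reals_Archimedean2 by blast
    then have "1 / weight x < real (Suc n)" by simp
    then have "1 \<le> real (Suc n) * weight x" using \<open>0 < weight x\<close> by (simp add: field_simps del: of_nat_Suc)
    then have "ennreal 1 \<le> ennreal (real (Suc n) * weight x)" by (rule ennreal_leI)
    then have "x \<in> A n" using x weight_nonneg[of x] by (simp add: A_def ennreal_mult del: of_nat_Suc)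
    then show "x \<in> (\<Union>n. A n)" by blast
  qed (auto simp: A_def)
  ultimately show "\<exists>A. countable A \<and> A \<subseteq> sets P \<and> \<Union> A = space P \<and> (\<forall>a\<in>A. emeasure P a \<noteq> \<infinity>)"
    using As by (intro exI[of _ "range A"]) (auto simp: less_top)
qed

text \<open>Up to \<open>green_const\<close> it dominates \<open>weight x\<close> times the Green
  potential of \<open>P\<close>. Its finiteness at \<open>x\<close> is the single criterion under
  which that potential converges at \<open>x\<close>.\<close>

definition riesz_pot :: "'a measure \<Rightarrow> 'a \<Rightarrow> ennreal" where
  "riesz_pot P x = (\<integral>\<^sup>+y. riesz_top x y * ennreal (weight y) \<partial>P)"

lemma riesz_pot_kernel_measurable:
  "(\<lambda>z. riesz_top (fst z) (snd z) * ennreal (weight (snd z))) \<in> borel_measurable (borel \<Otimes>\<^sub>M borel)"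
  using riesz_top_measurable by measurable

lemma riesz_pot_measurable:
  assumes P: "admissible P"
  shows "riesz_pot P \<in> borel_measurable Leb"
proof -
  interpret sigma_finite_measure P by (rule admissible_sigma_finite[OF P])
  have "(\<lambda>z. riesz_top (fst z) (snd z) * ennreal (weight (snd z))) \<in> borel_measurable (Leb \<Otimes>\<^sub>M P)"
    by (rule measurable_of_borel_pair[OF id_measurable admissible_id[OF P] riesz_pot_kernel_measurable])
  then show ?thesis
    unfolding riesz_pot_def[abs_def] using borel_measurable_nn_integral_fst[of "\<lambda>z. riesz_top (fst z) (snd z) * ennreal (weight (snd z))" "Leb"]
    by simp
qed

text \<open>By Tonelli the inner integral becomes that of the Riesz kernel in \<open>x\<close>,
  bounded uniformly in \<open>y\<close>; what remains is the weighted mass of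
  \<open>P\<close>.\<close>

lemma riesz_pot_integral:
  assumes P: "admissible P"
  shows "(\<integral>\<^sup>+x. riesz_pot P x \<partial>Leb) < \<infinity>"
proof -
  interpret P: sigma_finite_measure P by (rule admissible_sigma_finite[OF P])
  interpret pair_sigma_finite P "Leb" ..
  have m: "(\<lambda>z. riesz_top (snd z) (fst z) * ennreal (weight (fst z))) \<in> borel_measurable (P \<Otimes>\<^sub>M Leb)"
  proof (rule measurable_of_borel_pair[OF admissible_id[OF P] id_measurable])
    show "(\<lambda>z. riesz_top (snd z) (fst z) * ennreal (weight (fst z))) \<in> borel_measurable (borel \<Otimes>\<^sub>M borel)"
      by (subst riesz_top_sym) (use riesz_top_measurable in measurable)
  qed
  have "(\<integral>\<^sup>+x. riesz_pot P x \<partial>Leb) = (\<integral>\<^sup>+y. (\<integral>\<^sup>+x. riesz_top x y * ennreal (weight y) \<partial>Leb) \<partial>P)"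
    unfolding riesz_pot_def using Fubini[OF m] by simp
  also have "\<dots> = (\<integral>\<^sup>+y. (\<integral>\<^sup>+x. riesz_top x y \<partial>Leb) * ennreal (weight y) \<partial>P)"
    by (intro nn_integral_cong nn_integral_multc measurable_of_borel[OF id_measurable])
       (subst riesz_top_sym, rule riesz_top_measurable1)
  also have "\<dots> \<le> (\<integral>\<^sup>+y. ennreal riesz_const * ennreal (weight y) \<partial>P)"
    using P by (intro nn_integral_mono mult_right_mono riesz_const) (auto simp: admissible_def)
  also have "\<dots> = ennreal riesz_const * (\<integral>\<^sup>+y. ennreal (weight y) \<partial>P)"
    by (rule nn_integral_cmult) (rule measurable_of_borel[OF admissible_id[OF P] weight_ennreal_measurable])
  also have "\<dots> < \<infinity>" using P by (auto simp: admissible_def ennreal_mult_less_top)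
  finally show ?thesis .
qed

lemma riesz_pot_finite_AE:
  assumes P: "admissible P"
  shows "AE x in Leb. riesz_pot P x < \<infinity>"
  using nn_integral_noteq_infinite[OF riesz_pot_measurable[OF P]] riesz_pot_integral[OF P]
  by (auto simp: top.not_eq_extremum)

lemma riesz_pot_integrable:
  assumes P: "admissible P"
  shows "integrable Leb (\<lambda>x. enn2real (riesz_pot P x))"
proof (rule integrableI_bounded)
  show "(\<lambda>x. enn2real (riesz_pot P x)) \<in> borel_measurable Leb"
    using riesz_pot_measurable[OF P] by measurable
  have "(\<integral>\<^sup>+x. ennreal (norm (enn2real (riesz_pot P x))) \<partial>Leb) \<le> (\<integral>\<^sup>+x. riesz_pot P x \<partial>Leb)"
    by (intro nn_integral_mono) (simp add: ennreal_enn2real_if)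
  also have "\<dots> < \<infinity>" by (rule riesz_pot_integral[OF P])
  finally show "(\<integral>\<^sup>+x. ennreal (norm (enn2real (riesz_pot P x))) \<partial>Leb) < \<infinity>" .
qed

lemma
  assumes P: "admissible P" and x: "x \<in> \<Omega>" and fin: "riesz_pot P x < \<infinity>"
  shows riesz_pot_AE_neq: "AE y in P. y \<noteq> x"
    and riesz_wt_integrable: "integrable P (\<lambda>y. weight y * riesz x y)"
    and riesz_wt_integral: "(\<integral>y. weight y * riesz x y \<partial>P) \<le> enn2real (riesz_pot P x)"
proof -
  note m = measurable_of_borel[OF admissible_id[OF P]]
  have sp: "space P = \<Omega>" using P by (simp add: admissible_def)
  have "AE y in P. riesz_top x y * ennreal (weight y) \<noteq> \<infinity>"
    using fin unfolding riesz_pot_def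
    by (intro nn_integral_noteq_infinite m borel_measurable_times_ennreal riesz_top_measurable1 weight_ennreal_measurable) auto
  then show "AE y in P. y \<noteq> x"
    using AE_space
  proof eventually_elim
    case (elim y)
    then show ?case using weight_pos[of y] sp by (auto simp: riesz_top_def ennreal_top_mult)
  qed
  have le: "(\<integral>\<^sup>+y. ennreal (weight y * riesz x y) \<partial>P) \<le> riesz_pot P x"
    unfolding riesz_pot_def
    by (intro nn_integral_mono) (auto simp: riesz_top_def riesz_nonneg weight_nonneg ennreal_mult mult.commute riesz_def)
  show i: "integrable P (\<lambda>y. weight y * riesz x y)"
  proof (rule integrableI_bounded)
    show "(\<integral>\<^sup>+y. ennreal (norm (weight y * riesz x y)) \<partial>P) < \<infinity>"
      using le fin by (simp add: weight_nonneg riesz_nonneg abs_mult)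
  qed (intro m borel_measurable_times riesz_measurable1 weight_measurable)
  have "ennreal (\<integral>y. weight y * riesz x y \<partial>P) = (\<integral>\<^sup>+y. ennreal (weight y * riesz x y) \<partial>P)"
    by (rule nn_integral_eq_integral[symmetric, OF i]) (simp add: weight_nonneg riesz_nonneg)
  with le fin have "enn2real (ennreal (\<integral>y. weight y * riesz x y \<partial>P)) \<le> enn2real (riesz_pot P x)"
    by (intro enn2real_mono) auto
  then show "(\<integral>y. weight y * riesz x y \<partial>P) \<le> enn2real (riesz_pot P x)"
    by (simp add: weight_nonneg riesz_nonneg)
qed

lemma green0_le: "x \<in> \<Omega> \<Longrightarrow> y \<in> \<Omega> \<Longrightarrow> green0 x y \<le> green_const / weight x * (weight y * riesz x y)"
  using green0_wt_bound[of x y] weight_pos[of x] by (simp add: field_simps)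

lemma
  assumes P: "admissible P" and x: "x \<in> \<Omega>" and fin: "riesz_pot P x < \<infinity>"
  shows green0_integrable: "integrable P (green0 x)"
    and green0_integral: "weight x * (\<integral>y. green0 x y \<partial>P) \<le> green_const * enn2real (riesz_pot P x)"
proof -
  note m = measurable_of_borel[OF admissible_id[OF P]]
  have sp: "space P = \<Omega>" using P by (simp add: admissible_def)
  show i: "integrable P (green0 x)"
  proof (rule Bochner_Integration.integrable_bound)
    show "integrable P (\<lambda>y. green_const / weight x * (weight y * riesz x y))"
      by (intro integrable_mult_right riesz_wt_integrable assms)
    show "AE y in P. norm (green0 x y) \<le> norm (green_const / weight x * (weight y * riesz x y))"
      using AE_space
    proof eventually_elim
      case (elim y)
      then have "y \<in> \<Omega>" using sp by simp
      from order_trans[OF green0_le[OF x this] abs_ge_self] show ?case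
        using green0_nonneg[of x y] by simp
    qed
  qed (intro m green0_measurable1)
  have "(\<integral>y. green0 x y \<partial>P) \<le> (\<integral>y. green_const / weight x * (weight y * riesz x y) \<partial>P)"
    using sp by (intro integral_mono i integrable_mult_right riesz_wt_integrable assms green0_le) auto
  also have "\<dots> = green_const / weight x * (\<integral>y. weight y * riesz x y \<partial>P)" by simp
  also have "\<dots> \<le> green_const / weight x * enn2real (riesz_pot P x)"
    using green_const_pos weight_nonneg by (intro mult_left_mono riesz_wt_integral assms) auto
  finally show "weight x * (\<integral>y. green0 x y \<partial>P) \<le> green_const * enn2real (riesz_pot P x)"
    using weight_pos[OF x] by (simp add: field_simps)
qed

lemma green_op_eq: "x \<in> \<Omega> \<Longrightarrow> green_op \<Omega> G f x = (\<integral>y. green0 x y * f y \<partial>Leb)"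
proof -
  assume x: "x \<in> \<Omega>"
  have "\<Omega> - {x} \<in> sets lebesgue" by (intro sets.Diff) auto
  then show ?thesis using x
    unfolding green_op_def
    by (simp add: integral_restrict_space, intro Bochner_Integration.integral_cong)
       (auto simp: green0_def offdiag_def indicator_def)
qed

end

subsection \<open>Kato inequality for square integrable data\<close>

text \<open>\<open>P\<close> is a convex function in place of the absolute value or the positive part, and \<open>p\<close> is a
  bounded Lipschitz continuous subgradient of it.\<close>
definition kato_pair :: "(real \<Rightarrow> real) \<Rightarrow> (real \<Rightarrow> real) \<Rightarrow> bool" where
  "kato_pair p P \<longleftrightarrow> (\<exists>L. \<forall>a b. \<bar>p a - p b\<bar> \<le> L * \<bar>a - b\<bar>) \<and> (\<forall>a. \<bar>p a\<bar> \<le> 1) \<and>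
     P 0 = 0 \<and> (\<forall>a b. P a - P b \<le> p a * (a - b))"

lemma kato_pair_lipschitz: "kato_pair p P \<Longrightarrow> \<bar>P a - P b\<bar> \<le> \<bar>a - b\<bar>"
proof -
  assume k: "kato_pair p P"
  have "P a - P b \<le> \<bar>a - b\<bar>" for a b
  proof -
    have "P a - P b \<le> p a * (a - b)" using k by (simp add: kato_pair_def)
    also have "\<dots> \<le> \<bar>p a\<bar> * \<bar>a - b\<bar>" by (metis abs_ge_self abs_mult)
    also have "\<dots> \<le> 1 * \<bar>a - b\<bar>" using k by (intro mult_right_mono) (auto simp: kato_pair_def)
    finally show ?thesis by simp
  qed
  from this[of a b] this[of b a] show ?thesis by linarith
qed

lemma kato_pair_abs_le: "kato_pair p P \<Longrightarrow> \<bar>P a\<bar> \<le> \<bar>a\<bar>"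
  using kato_pair_lipschitz[of p P a 0] by (simp add: kato_pair_def)

lemma lipschitz_isCont:
  fixes p :: "real \<Rightarrow> real"
  assumes "\<And>a b. \<bar>p a - p b\<bar> \<le> L * \<bar>a - b\<bar>"
  shows "isCont p x"
proof -
  have "((\<lambda>a. L * \<bar>a - x\<bar>) \<longlongrightarrow> L * \<bar>x - x\<bar>) (at x)" by (intro tendsto_intros)
  then have "((\<lambda>a. p a - p x) \<longlongrightarrow> 0) (at x)"
    by (intro Lim_null_comparison[of "\<lambda>a. p a - p x" "\<lambda>a. L * \<bar>a - x\<bar>"]) (auto intro!: always_eventually assms)
  then show ?thesis by (simp add: isCont_def LIM_zero_iff)
qed

lemma kato_pair_isCont:
  assumes "kato_pair p P"
  shows "isCont p x" "isCont P x"
proof -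
  obtain L where "\<And>a b. \<bar>p a - p b\<bar> \<le> L * \<bar>a - b\<bar>" using assms by (auto simp: kato_pair_def)
  then show "isCont p x" by (rule lipschitz_isCont)
  show "isCont P x" using kato_pair_lipschitz[OF assms] by (intro lipschitz_isCont[of P 1]) auto
qed

lemma kato_pair_measurable:
  assumes "kato_pair p P"
  shows "p \<in> borel_measurable borel" "P \<in> borel_measurable borel"
  using kato_pair_isCont[OF assms]
  by (auto intro!: borel_measurable_continuous_onI continuous_at_imp_continuous_on)

lemma sum_square_bound:
  fixes a b c A :: real
  assumes "\<bar>c\<bar> \<le> A * (\<bar>a\<bar> + \<bar>b\<bar>)"
  shows "c\<^sup>2 \<le> 2 * A\<^sup>2 * (a\<^sup>2 + b\<^sup>2)"
proof -
  have "c\<^sup>2 = \<bar>c\<bar>\<^sup>2" by simp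
  also have "\<dots> \<le> (A * (\<bar>a\<bar> + \<bar>b\<bar>))\<^sup>2" using assms by (intro power_mono) auto
  also have "\<dots> = A\<^sup>2 * (\<bar>a\<bar> + \<bar>b\<bar>)\<^sup>2" by (simp add: power_mult_distrib)
  also have "\<dots> \<le> A\<^sup>2 * (2 * (a\<^sup>2 + b\<^sup>2))"
  proof (rule mult_left_mono)
    have "0 \<le> (\<bar>a\<bar> - \<bar>b\<bar>)\<^sup>2" by simp
    then show "(\<bar>a\<bar> + \<bar>b\<bar>)\<^sup>2 \<le> 2 * (a\<^sup>2 + b\<^sup>2)" by (simp add: power2_sum power2_diff)
  qed simp
  finally show ?thesis by (simp add: algebra_simps)
qed

lemma integrable_square_bound:
  fixes f g h :: "'b \<Rightarrow> real"
  assumes "integrable N (\<lambda>x. (f x)\<^sup>2)" "integrable N (\<lambda>x. (g x)\<^sup>2)" "h \<in> borel_measurable N"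
    and "\<And>x. x \<in> space N \<Longrightarrow> \<bar>h x\<bar> \<le> A * (\<bar>f x\<bar> + \<bar>g x\<bar>)"
  shows "integrable N (\<lambda>x. (h x)\<^sup>2)"
proof (rule Bochner_Integration.integrable_bound)
  show "integrable N (\<lambda>x. 2 * A\<^sup>2 * ((f x)\<^sup>2 + (g x)\<^sup>2))" using assms(1,2) by auto
  show "AE x in N. norm ((h x)\<^sup>2) \<le> norm (2 * A\<^sup>2 * ((f x)\<^sup>2 + (g x)\<^sup>2))"
    using sum_square_bound[OF assms(4)] by (intro AE_I2) auto
qed (use assms(3) in measurable)

context green_kernel
begin

lemma Times_sets [simp, intro]: "\<Omega> \<times> \<Omega> \<in> sets lebesgue"
  using open_Times[OF open_dom open_dom] by (auto intro!: sets_completionI_sets)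

lemma gagliardo_kernel_measurable:
  "(\<lambda>z. norm (fst z - snd z) powr t) \<in> borel_measurable Leb2"
  for t :: real
proof -
  have "(\<lambda>z :: 'a \<times> 'a. norm (fst z - snd z)) \<in> borel_measurable borel"
    by (intro borel_measurable_continuous_onI continuous_intros)
  then have "(\<lambda>z :: 'a \<times> 'a. norm (fst z - snd z) powr t) \<in> borel_measurable borel"
    by measurable
  then show ?thesis by (intro measurable_restrict_space1 measurable_completion) simp
qed

lemma Hs00_space_dominated:
  assumes s: "s < 1" and u: "u \<in> Hs00_space \<Omega> s" and v: "v \<in> Hs00_space \<Omega> s"
    and w: "w \<in> borel_measurable Leb"
    and A: "\<And>x. x \<in> \<Omega> \<Longrightarrow> \<bar>w x\<bar> \<le> A * (\<bar>u x\<bar> + \<bar>v x\<bar>)"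
      "\<And>x y. x \<in> \<Omega> \<Longrightarrow> y \<in> \<Omega> \<Longrightarrow> \<bar>w x - w y\<bar> \<le> A * (\<bar>u x - u y\<bar> + \<bar>v x - v y\<bar>)"
  shows "w \<in> Hs00_space \<Omega> s"
proof -
  \<comment> \<open>Square root of the Gagliardo denominator: the integrand becomes the square of
    the quotient \<open>Q\<close>, and one comparison of squares serves all three integrals.\<close>
  define k where "k z = norm (fst z - snd z :: 'a) powr ((DIM('a) + 2 * s) / 2)" for z
  have k0: "0 \<le> k z" for z by (simp add: k_def)
  have k2: "(a / k (x, y))\<^sup>2 = a\<^sup>2 / norm (x - y) powr (DIM('a) + 2 * s)" for a x y
  proof -
    have "(k (x, y))\<^sup>2 = norm (x - y) powr (DIM('a) + 2 * s)"
      by (simp add: k_def power2_eq_square powr_add[symmetric])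
    then show ?thesis by (simp add: power_divide)
  qed
  have km: "k \<in> borel_measurable Leb2"
    unfolding k_def[abs_def] by (rule gagliardo_kernel_measurable)
  define Q where "Q f z = (f (fst z) - f (snd z)) / k z" for f :: "'a \<Rightarrow> real" and z
  have gag: "(\<lambda>(x, y). (f x - f y)\<^sup>2 / norm (x - y) powr (DIM('a) + 2 * s)) = (\<lambda>z. (Q f z)\<^sup>2)" for f
    by (auto simp: fun_eq_iff Q_def k2)
  have Qi: "integrable Leb2 (\<lambda>z. (Q w z)\<^sup>2)"
  proof (rule integrable_square_bound)
    show "integrable Leb2 (\<lambda>z. (Q u z)\<^sup>2)" "integrable Leb2 (\<lambda>z. (Q v z)\<^sup>2)"
      using u v s by (auto simp: Hs00_space_def Hs_space_def gag)
    show "Q w \<in> borel_measurable Leb2"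
      unfolding Q_def[abs_def]
      by (intro borel_measurable_divide borel_measurable_diff km
          measurable_lebesgue_on_Times_fst measurable_lebesgue_on_Times_snd w)
    fix z assume "z \<in> space Leb2"
    then have z: "fst z \<in> \<Omega>" "snd z \<in> \<Omega>" by auto
    have "\<bar>Q w z\<bar> = \<bar>w (fst z) - w (snd z)\<bar> / k z" by (simp add: Q_def k0 abs_divide)
    also have "\<dots> \<le> A * (\<bar>u (fst z) - u (snd z)\<bar> + \<bar>v (fst z) - v (snd z)\<bar>) / k z"
      using A(2)[OF z] k0[of z] by (rule divide_right_mono)
    also have "\<dots> = A * (\<bar>Q u z\<bar> + \<bar>Q v z\<bar>)"
      by (simp add: Q_def k0 abs_divide add_divide_distrib distrib_left)
    finally show "\<bar>Q w z\<bar> \<le> A * (\<bar>Q u z\<bar> + \<bar>Q v z\<bar>)" .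
  qed
  have L2: "w \<in> L2_space \<Omega>"
    using integrable_square_bound[of "Leb" u v w A] u v w A(1)
    by (auto simp: Hs00_space_def Hs_space_def L2_space_def)
  have bm: "bdist \<Omega> \<in> borel_measurable Leb"
    by (rule measurable_of_borel[OF id_measurable bdist_measurable])
  have wm: "(\<lambda>x. w x / bdist \<Omega> x powr s) \<in> borel_measurable Leb"
    using w bm by measurable
  have "integrable Leb (\<lambda>x. (w x / bdist \<Omega> x powr s)\<^sup>2)"
  proof (rule integrable_square_bound[OF _ _ wm])
    show "integrable Leb (\<lambda>x. (u x / bdist \<Omega> x powr s)\<^sup>2)"
      "integrable Leb (\<lambda>x. (v x / bdist \<Omega> x powr s)\<^sup>2)"
      using u v by (auto simp: Hs00_space_def L2_space_def)
    fix x assume "x \<in> space Leb"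
    then have x: "x \<in> \<Omega>" by simp
    have "\<bar>w x / bdist \<Omega> x powr s\<bar> = \<bar>w x\<bar> / bdist \<Omega> x powr s" by (simp add: abs_divide)
    also have "\<dots> \<le> A * (\<bar>u x\<bar> + \<bar>v x\<bar>) / bdist \<Omega> x powr s"
      by (rule divide_right_mono[OF A(1)[OF x]]) simp
    also have "\<dots> = A * (\<bar>u x / bdist \<Omega> x powr s\<bar> + \<bar>v x / bdist \<Omega> x powr s\<bar>)"
      by (simp add: abs_divide add_divide_distrib distrib_left)
    finally show "\<bar>w x / bdist \<Omega> x powr s\<bar> \<le> A * (\<bar>u x / bdist \<Omega> x powr s\<bar> + \<bar>v x / bdist \<Omega> x powr s\<bar>)" .
  qed
  then have H: "(\<lambda>x. w x / bdist \<Omega> x powr s) \<in> L2_space \<Omega>"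
    using wm by (simp add: L2_space_def)
  show ?thesis
    unfolding Hs00_space_def Hs_space_def using L2 H Qi s by (auto simp: gag)
qed

text \<open>(L1) makes \<open>J\<close> itself measurable only off the diagonal, but
  \<open>\<bar>x - y\<bar>^2 J\<close> on the whole product. Division by
  \<open>\<bar>x - y\<bar>^2\<close> recovers the integrand; on the diagonal both sides are 0
  because the differences vanish.\<close>

lemma J_product_measurable:
  assumes L1: "cond_L1 \<Omega> J B"
    and u: "u \<in> borel_measurable Leb" and v: "v \<in> borel_measurable Leb"
  shows "(\<lambda>z. J (fst z) (snd z) * (u (fst z) - u (snd z)) * (v (fst z) - v (snd z)))
    \<in> borel_measurable Leb2"
proof -
  have "(\<lambda>z. (norm (fst z - snd z))\<^sup>2 * J (fst z) (snd z)) \<in> borel_measurable Leb2"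
    using L1 unfolding cond_L1_def by (auto simp: split_beta')
  then have "(\<lambda>z. ((norm (fst z - snd z))\<^sup>2 * J (fst z) (snd z)) *
      ((u (fst z) - u (snd z)) * (v (fst z) - v (snd z)) * norm (fst z - snd z) powr (-2)))
      \<in> borel_measurable Leb2"
    by (rule borel_measurable_times)
       (intro borel_measurable_times borel_measurable_diff gagliardo_kernel_measurable
        measurable_lebesgue_on_Times_fst measurable_lebesgue_on_Times_snd u v)
  also have "(\<lambda>z. ((norm (fst z - snd z))\<^sup>2 * J (fst z) (snd z)) *
      ((u (fst z) - u (snd z)) * (v (fst z) - v (snd z)) * norm (fst z - snd z) powr (-2)))
      = (\<lambda>z. J (fst z) (snd z) * (u (fst z) - u (snd z)) * (v (fst z) - v (snd z)))"
  proof
    fix z :: "'a \<times> 'a"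
    show "((norm (fst z - snd z))\<^sup>2 * J (fst z) (snd z)) *
      ((u (fst z) - u (snd z)) * (v (fst z) - v (snd z)) * norm (fst z - snd z) powr (-2))
      = J (fst z) (snd z) * (u (fst z) - u (snd z)) * (v (fst z) - v (snd z))"
    proof (cases "fst z = snd z")
      case False
      then have "norm (fst z - snd z) powr (-2) = 1 / (norm (fst z - snd z))\<^sup>2"
        by (simp add: powr_minus_divide powr_numeral)
      then show ?thesis using False by simp
    qed simp
  qed
  finally show ?thesis .
qed

lemma J_nonneg: "cond_L1 \<Omega> J B \<Longrightarrow> x \<in> \<Omega> \<Longrightarrow> y \<in> \<Omega> \<Longrightarrow> x \<noteq> y \<Longrightarrow> 0 \<le> J x y"
  by (auto simp: cond_L1_def offdiag_def)

lemma B_nonneg: "cond_L1 \<Omega> J B \<Longrightarrow> x \<in> \<Omega> \<Longrightarrow> 0 \<le> B x"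
  by (auto simp: cond_L1_def)

lemma abs_mult_le_squares: "\<bar>a * b\<bar> \<le> a\<^sup>2 + b\<^sup>2" for a b :: real
proof -
  have "2 * (\<bar>a\<bar> * \<bar>b\<bar>) \<le> a\<^sup>2 + b\<^sup>2" using sum_squares_bound[of "\<bar>a\<bar>" "\<bar>b\<bar>"] by simp
  moreover have "0 \<le> \<bar>a\<bar> * \<bar>b\<bar>" by simp
  ultimately show ?thesis unfolding abs_mult by linarith
qed

text \<open>Mixed products are dominated through \<open>\<bar>a b\<bar> \<le> a^2 + b^2\<close>,
  with \<open>J\<close> and \<open>B\<close> as nonnegative factors. On the diagonal, where the sign
  of \<open>J\<close> is unknown, the differences vanish.\<close>

lemma energy_integrable:
  assumes L1: "cond_L1 \<Omega> J B" and u: "u \<in> energy_domain \<Omega> J B" and v: "v \<in> energy_domain \<Omega> J B"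
  shows "integrable Leb2
      (\<lambda>z. J (fst z) (snd z) * (u (fst z) - u (snd z)) * (v (fst z) - v (snd z)))"
    and "integrable Leb (\<lambda>x. B x * u x * v x)"
proof -
  have um: "u \<in> borel_measurable Leb" "v \<in> borel_measurable Leb"
    using u v by (auto simp: energy_domain_def L2_space_def)
  have ui: "integrable Leb2 (\<lambda>z. J (fst z) (snd z) * (u (fst z) - u (snd z))\<^sup>2)"
    "integrable Leb2 (\<lambda>z. J (fst z) (snd z) * (v (fst z) - v (snd z))\<^sup>2)"
    using u v by (auto simp: energy_domain_def split_beta')
  show "integrable Leb2
      (\<lambda>z. J (fst z) (snd z) * (u (fst z) - u (snd z)) * (v (fst z) - v (snd z)))"
  proof (rule Bochner_Integration.integrable_bound)
    show "integrable Leb2 (\<lambda>z. J (fst z) (snd z) * (u (fst z) - u (snd z))\<^sup>2 +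
      J (fst z) (snd z) * (v (fst z) - v (snd z))\<^sup>2)" using ui by (rule Bochner_Integration.integrable_add)
    show "AE z in Leb2.
      norm (J (fst z) (snd z) * (u (fst z) - u (snd z)) * (v (fst z) - v (snd z))) \<le>
      norm (J (fst z) (snd z) * (u (fst z) - u (snd z))\<^sup>2 + J (fst z) (snd z) * (v (fst z) - v (snd z))\<^sup>2)"
    proof (rule AE_I2)
      fix z assume "z \<in> space Leb2"
      then have z: "fst z \<in> \<Omega>" "snd z \<in> \<Omega>" by auto
      let ?a = "u (fst z) - u (snd z)" and ?b = "v (fst z) - v (snd z)" and ?J = "J (fst z) (snd z)"
      show "norm (?J * ?a * ?b) \<le> norm (?J * ?a\<^sup>2 + ?J * ?b\<^sup>2)"
      proof (cases "fst z = snd z")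
        case False
        have J: "0 \<le> ?J" using J_nonneg[OF L1 z False] .
        have "norm (?J * ?a * ?b) = ?J * \<bar>?a * ?b\<bar>" using J by (simp add: abs_mult mult.assoc)
        also have "\<dots> \<le> ?J * (?a\<^sup>2 + ?b\<^sup>2)" by (intro mult_left_mono abs_mult_le_squares J)
        also have "\<dots> \<le> norm (?J * ?a\<^sup>2 + ?J * ?b\<^sup>2)" by (simp add: algebra_simps)
        finally show ?thesis .
      qed simp
    qed
  qed (rule J_product_measurable[OF L1 um])
  have bi: "integrable Leb (\<lambda>x. B x * (u x)\<^sup>2)" "integrable Leb (\<lambda>x. B x * (v x)\<^sup>2)"
    using u v by (auto simp: energy_domain_def)
  show "integrable Leb (\<lambda>x. B x * u x * v x)"
  proof (rule Bochner_Integration.integrable_bound)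
    show "integrable Leb (\<lambda>x. B x * (u x)\<^sup>2 + B x * (v x)\<^sup>2)"
      using bi by (rule Bochner_Integration.integrable_add)
    show "AE x in Leb. norm (B x * u x * v x) \<le> norm (B x * (u x)\<^sup>2 + B x * (v x)\<^sup>2)"
    proof (rule AE_I2)
      fix x assume "x \<in> space Leb"
      then have B: "0 \<le> B x" using B_nonneg[OF L1] by simp
      have "norm (B x * u x * v x) = B x * \<bar>u x * v x\<bar>" using B by (simp add: abs_mult mult.assoc)
      also have "\<dots> \<le> B x * ((u x)\<^sup>2 + (v x)\<^sup>2)" by (intro mult_left_mono abs_mult_le_squares B)
      also have "\<dots> \<le> norm (B x * (u x)\<^sup>2 + B x * (v x)\<^sup>2)" by (simp add: algebra_simps)
      finally show "norm (B x * u x * v x) \<le> norm (B x * (u x)\<^sup>2 + B x * (v x)\<^sup>2)" .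
    qed
    have "B \<in> borel_measurable Leb" using L1 by (simp add: cond_L1_def)
    with um show "(\<lambda>x. B x * u x * v x) \<in> borel_measurable Leb" by measurable
  qed
qed

lemma energy_eq:
  "energy \<Omega> J B u v = 1 / 2 * (\<integral>z. J (fst z) (snd z) * (u (fst z) - u (snd z)) * (v (fst z) - v (snd z))
      \<partial>Leb2) + (\<integral>x. B x * u x * v x \<partial>Leb)"
  by (simp add: energy_def split_beta')

text \<open>Testing the equation of \<open>u\<close> with \<open>v p(u)\<close> and that of \<open>v\<close> with \<open>P(u)\<close>; convexity of \<open>P\<close>
  compares the two integrands pointwise.\<close>
lemma kato_L2:
  assumes L1: "cond_L1 \<Omega> J B" and L4: "cond_L4 \<Omega> J B s" and s: "s < 1"
    and u: "green_solution \<Omega> J B f u" and v: "green_solution \<Omega> J B \<xi> v"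
    and v0: "AE x in Leb. 0 \<le> v x" and W: "\<And>x. x \<in> \<Omega> \<Longrightarrow> \<bar>v x\<bar> \<le> W"
    and k: "kato_pair p P"
  shows "(\<integral>x. P (u x) * \<xi> x \<partial>Leb) \<le> (\<integral>x. p (u x) * f x * v x \<partial>Leb)"
proof -
  have H: "H_space \<Omega> J B = Hs00_space \<Omega> s" using L4 by (simp add: cond_L4_def)
  have uH: "u \<in> Hs00_space \<Omega> s" and vH: "v \<in> Hs00_space \<Omega> s"
    using u v H by (auto simp: green_solution_def)
  have um: "u \<in> borel_measurable Leb" "v \<in> borel_measurable Leb"
    using uH vH by (auto simp: Hs00_space_def Hs_space_def L2_space_def)
  obtain L where L: "\<And>a b. \<bar>p a - p b\<bar> \<le> L * \<bar>a - b\<bar>" using k by (auto simp: kato_pair_def)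
  have p1: "\<bar>p a\<bar> \<le> 1" for a using k by (simp add: kato_pair_def)
  have PH: "(\<lambda>x. P (u x)) \<in> Hs00_space \<Omega> s"
  proof (rule Hs00_space_dominated[OF s uH uH, where A=1])
    show "(\<lambda>x. P (u x)) \<in> borel_measurable Leb"
      using um kato_pair_measurable[OF k] by measurable
    show "\<bar>P (u x)\<bar> \<le> 1 * (\<bar>u x\<bar> + \<bar>u x\<bar>)" for x
      using kato_pair_abs_le[OF k, of "u x"] by auto
    show "\<bar>P (u x) - P (u y)\<bar> \<le> 1 * (\<bar>u x - u y\<bar> + \<bar>u x - u y\<bar>)" for x y
      using kato_pair_lipschitz[OF k, of "u x" "u y"] abs_ge_zero[of "u x - u y"]
      by (simp del: abs_ge_zero)
  qed
  \<comment> \<open>The difference splits as \<open>(v - v') p(u) + v' (p(u) - p(u'))\<close>. The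
    first term needs \<open>\<bar>p\<bar> \<le> 1\<close>, the second the bound \<open>W\<close> of
    \<open>v\<close> and the Lipschitz constant \<open>L\<close> of \<open>p\<close>.\<close>
  have vpH: "(\<lambda>x. v x * p (u x)) \<in> Hs00_space \<Omega> s"
  proof (rule Hs00_space_dominated[OF s uH vH, where A="1 + \<bar>W\<bar> * \<bar>L\<bar>"])
    show "(\<lambda>x. v x * p (u x)) \<in> borel_measurable Leb"
      using um kato_pair_measurable[OF k] by measurable
    have A: "a \<le> (1 + \<bar>W\<bar> * \<bar>L\<bar>) * a" if "0 \<le> a" for a using that by (simp add: algebra_simps)
    have "\<bar>v x * p (u x)\<bar> \<le> \<bar>v x\<bar>" for x
      using mult_left_mono[OF p1[of "u x"], of "\<bar>v x\<bar>"] by (simp add: abs_mult)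
    then show "\<bar>v x * p (u x)\<bar> \<le> (1 + \<bar>W\<bar> * \<bar>L\<bar>) * (\<bar>u x\<bar> + \<bar>v x\<bar>)" for x
      using A[of "\<bar>u x\<bar> + \<bar>v x\<bar>"] by (smt (verit))
    fix x y assume x: "x \<in> \<Omega>" and y: "y \<in> \<Omega>"
    have "v x * p (u x) - v y * p (u y) = (v x - v y) * p (u x) + v y * (p (u x) - p (u y))"
      by (simp add: algebra_simps)
    then have "\<bar>v x * p (u x) - v y * p (u y)\<bar> \<le> \<bar>v x - v y\<bar> * \<bar>p (u x)\<bar> + \<bar>v y\<bar> * \<bar>p (u x) - p (u y)\<bar>"
      by (simp add: abs_mult[symmetric] abs_triangle_ineq)
    also have "\<dots> \<le> \<bar>v x - v y\<bar> * 1 + \<bar>W\<bar> * (\<bar>L\<bar> * \<bar>u x - u y\<bar>)"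
    proof (intro add_mono mult_mono p1)
      show "\<bar>v y\<bar> \<le> \<bar>W\<bar>" using W[OF y] by simp
      have "L * \<bar>u x - u y\<bar> \<le> \<bar>L\<bar> * \<bar>u x - u y\<bar>" by (intro mult_right_mono) auto
      then show "\<bar>p (u x) - p (u y)\<bar> \<le> \<bar>L\<bar> * \<bar>u x - u y\<bar>" using L[of "u x" "u y"] by linarith
    qed auto
    also have "\<dots> \<le> (1 + \<bar>W\<bar> * \<bar>L\<bar>) * (\<bar>u x - u y\<bar> + \<bar>v x - v y\<bar>)"
      by (simp add: algebra_simps)
    finally show "\<bar>v x * p (u x) - v y * p (u y)\<bar> \<le> (1 + \<bar>W\<bar> * \<bar>L\<bar>) * (\<bar>u x - u y\<bar> + \<bar>v x - v y\<bar>)" .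
  qed
  have dom: "u \<in> energy_domain \<Omega> J B" "v \<in> energy_domain \<Omega> J B"
     "(\<lambda>x. P (u x)) \<in> energy_domain \<Omega> J B" "(\<lambda>x. v x * p (u x)) \<in> energy_domain \<Omega> J B"
    using uH vH PH vpH unfolding H[symmetric] by (auto simp: H_space_def)
  have v02: "AE z in Leb2. 0 \<le> v (fst z) \<and> 0 \<le> v (snd z)"
    using v0 by (intro AE_lebesgue_on_Times) auto
  have sub: "P a - P b \<le> p a * (a - b)" for a b using k by (simp add: kato_pair_def)
  have i1: "(\<integral>z. J (fst z) (snd z) * (v (fst z) - v (snd z)) * (P (u (fst z)) - P (u (snd z))) \<partial>Leb2)
    \<le> (\<integral>z. J (fst z) (snd z) * (u (fst z) - u (snd z)) * (v (fst z) * p (u (fst z)) - v (snd z) * p (u (snd z))) \<partial>Leb2)"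
  proof (rule integral_mono_AE)
    show "AE z in Leb2. J (fst z) (snd z) * (v (fst z) - v (snd z)) * (P (u (fst z)) - P (u (snd z)))
      \<le> J (fst z) (snd z) * (u (fst z) - u (snd z)) * (v (fst z) * p (u (fst z)) - v (snd z) * p (u (snd z)))"
      using v02 AE_space
    proof eventually_elim
      case (elim z)
      then have z: "fst z \<in> \<Omega>" "snd z \<in> \<Omega>" by auto
      let ?u = "u (fst z)" and ?u' = "u (snd z)" and ?v = "v (fst z)" and ?v' = "v (snd z)"
      show ?case
      proof (cases "fst z = snd z")
        case False
        \<comment> \<open>The subgradient inequality at \<open>u\<close>, scaled by
          \<open>v \<ge> 0\<close>, and the one at \<open>u'\<close>, scaled by
          \<open>v' \<ge> 0\<close>. Their sum compares the two integrands.\<close>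
        have "?v * (P ?u - P ?u') \<le> ?v * (p ?u * (?u - ?u'))"
          "?v' * (P ?u' - P ?u) \<le> ?v' * (p ?u' * (?u' - ?u))"
          using elim by (auto intro!: mult_left_mono sub)
        then have "(?v - ?v') * (P ?u - P ?u') \<le> (?u - ?u') * (?v * p ?u - ?v' * p ?u')"
          by (simp add: algebra_simps)
        then show ?thesis using mult_left_mono[OF _ J_nonneg[OF L1 z False]] by (simp add: mult.assoc)
      qed simp
    qed
  qed (intro energy_integrable[OF L1] dom)+
  have i2: "(\<integral>x. B x * v x * P (u x) \<partial>Leb) \<le> (\<integral>x. B x * u x * (v x * p (u x)) \<partial>Leb)"
  proof (rule integral_mono_AE)
    show "AE x in Leb. B x * v x * P (u x) \<le> B x * u x * (v x * p (u x))"
      using v0 AE_space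
    proof eventually_elim
      case (elim x)
      have "P (u x) \<le> p (u x) * u x" using sub[of "u x" 0] k by (simp add: kato_pair_def)
      moreover have "0 \<le> B x * v x" using elim B_nonneg[OF L1, of x] by simp
      ultimately have "B x * v x * P (u x) \<le> B x * v x * (p (u x) * u x)" by (rule mult_left_mono)
      then show ?case by (simp add: algebra_simps)
    qed
  qed (intro energy_integrable[OF L1] dom)+
  have "energy \<Omega> J B v (\<lambda>x. P (u x)) \<le> energy \<Omega> J B u (\<lambda>x. v x * p (u x))"
    unfolding energy_eq using i1 i2 by linarith
  moreover have "energy \<Omega> J B v (\<lambda>x. P (u x)) = (\<integral>x. \<xi> x * P (u x) \<partial>Leb)"
    using v PH unfolding H[symmetric] green_solution_def by blast
  moreover have "energy \<Omega> J B u (\<lambda>x. v x * p (u x)) = (\<integral>x. f x * (v x * p (u x)) \<partial>Leb)"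
    using u vpH unfolding H[symmetric] green_solution_def by blast
  ultimately show ?thesis by (simp add: mult_ac)
qed

section \<open>Green potentials of weighted integrable functions\<close>

text \<open>It equals \<open>green_op\<close> on the domain. Thanks to the kernel extended by zero
  it is Borel on the whole space and can be integrated against any admissible measure.\<close>

definition green_pot :: "('a \<Rightarrow> real) \<Rightarrow> 'a \<Rightarrow> real" where
  "green_pot f x = (\<integral>y. green0 x y * f y \<partial>Leb)"

lemma green_pot_measurable:
  assumes f: "f \<in> borel_measurable Leb"
  shows "green_pot f \<in> borel_measurable borel"
proof -
  have "(\<lambda>z. green0 (fst z) (snd z)) \<in> borel_measurable (borel \<Otimes>\<^sub>M Leb)"
    by (rule measurable_of_borel_pair[OF _ id_measurable green0_measurable]) simp
  then have "(\<lambda>z. green0 (fst z) (snd z) * f (snd z)) \<in> borel_measurable (borel \<Otimes>\<^sub>M Leb)"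
    by (intro borel_measurable_times measurable_compose[OF measurable_snd f])
  then show ?thesis
    unfolding green_pot_def[abs_def] by (intro borel_measurable_lebesgue_integral) (simp add: split_beta')
qed

text \<open>Viewing \<open>f\<close> as the measure \<open>\<bar>f\<bar> dx\<close> lets the
  estimates for measures serve for functions too.\<close>

definition abs_density :: "('a \<Rightarrow> real) \<Rightarrow> 'a measure" where
  "abs_density f = density Leb (\<lambda>x. ennreal \<bar>f x\<bar>)"

lemma L1_weighted_iff:
  "f \<in> L1_weighted \<Omega> \<gamma> \<longleftrightarrow>
     f \<in> borel_measurable Leb \<and> integrable Leb (\<lambda>x. \<bar>f x\<bar> * weight x)"
  by (simp add: L1_weighted_def weight_def)

lemma weight_measurable_dom: "weight \<in> borel_measurable Leb"
  by (rule measurable_of_borel[OF id_measurable weight_measurable])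

lemma admissible_dens:
  assumes f: "f \<in> L1_weighted \<Omega> \<gamma>"
  shows "admissible (abs_density f)"
proof -
  have m: "f \<in> borel_measurable Leb" and i: "integrable Leb (\<lambda>x. \<bar>f x\<bar> * weight x)"
    using f by (auto simp: L1_weighted_iff)
  have wm: "(\<lambda>x. ennreal (weight x)) \<in> borel_measurable Leb"
    using weight_measurable_dom by measurable
  have fm: "(\<lambda>x. ennreal \<bar>f x\<bar>) \<in> borel_measurable Leb"
    using m by measurable
  have "(\<integral>\<^sup>+x. ennreal (weight x) \<partial>abs_density f) = (\<integral>\<^sup>+x. ennreal (norm (\<bar>f x\<bar> * weight x)) \<partial>Leb)"
    unfolding abs_density_def nn_integral_density[OF fm wm]
    by (intro nn_integral_cong) (simp add: ennreal_mult weight_nonneg)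
  also have "\<dots> < \<infinity>" using i by (auto simp: integrable_iff_bounded)
  finally show ?thesis
    using id_measurable by (simp add: admissible_def abs_density_def)
qed

definition green_bound :: "'a measure \<Rightarrow> 'a \<Rightarrow> real" where
  "green_bound P x = green_const * enn2real (riesz_pot P x)"

lemma green_bound_integrable: "admissible P \<Longrightarrow> integrable Leb (green_bound P)"
  unfolding green_bound_def[abs_def] by (intro integrable_mult_right riesz_pot_integrable)

lemma
  assumes f: "f \<in> L1_weighted \<Omega> \<gamma>" and x: "x \<in> \<Omega>" and fin: "riesz_pot (abs_density f) x < \<infinity>"
  shows green0_f_integrable: "integrable Leb (\<lambda>y. green0 x y * \<bar>f y\<bar>)"
    and green0_f_integral: "weight x * (\<integral>y. green0 x y * \<bar>f y\<bar> \<partial>Leb) \<le> green_bound (abs_density f) x"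
proof -
  have m: "(\<lambda>y. \<bar>f y\<bar>) \<in> borel_measurable Leb" using f by (auto simp: L1_weighted_iff)
  have Gm: "green0 x \<in> borel_measurable Leb"
    by (rule measurable_of_borel[OF id_measurable green0_measurable1])
  note a = admissible_dens[OF f]
  have "integrable Leb (\<lambda>y. \<bar>f y\<bar> * green0 x y)"
    using green0_integrable[OF a x fin] unfolding abs_density_def
    by (subst (asm) integrable_real_density) (use m Gm in auto)
  then show "integrable Leb (\<lambda>y. green0 x y * \<bar>f y\<bar>)" by (simp add: mult.commute)
  have "(\<integral>y. green0 x y \<partial>abs_density f) = (\<integral>y. \<bar>f y\<bar> * green0 x y \<partial>Leb)"
    unfolding abs_density_def by (rule integral_real_density) (use m Gm in auto)
  then show "weight x * (\<integral>y. green0 x y * \<bar>f y\<bar> \<partial>Leb) \<le> green_bound (abs_density f) x"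
    using green0_integral[OF a x fin] by (simp add: mult.commute green_bound_def)
qed

lemma green0_f_integrable':
  assumes f: "f \<in> L1_weighted \<Omega> \<gamma>" and x: "x \<in> \<Omega>" and fin: "riesz_pot (abs_density f) x < \<infinity>"
  shows "integrable Leb (\<lambda>y. green0 x y * f y)"
proof (rule Bochner_Integration.integrable_bound[OF green0_f_integrable[OF assms]])
  have "f \<in> borel_measurable Leb" using f by (simp add: L1_weighted_iff)
  then show "(\<lambda>y. green0 x y * f y) \<in> borel_measurable Leb"
    by (intro borel_measurable_times measurable_of_borel[OF id_measurable green0_measurable1])
qed (auto simp: abs_mult green0_nonneg)

lemma green_pot_bound:
  assumes f: "f \<in> L1_weighted \<Omega> \<gamma>" and x: "x \<in> \<Omega>" and fin: "riesz_pot (abs_density f) x < \<infinity>"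
    and g: "g \<in> borel_measurable Leb" "\<And>y. \<bar>g y\<bar> \<le> \<bar>f y\<bar>"
  shows "\<bar>green_pot g x\<bar> * weight x \<le> green_bound (abs_density f) x"
proof -
  have "\<bar>green_pot g x\<bar> \<le> (\<integral>y. green0 x y * \<bar>f y\<bar> \<partial>Leb)"
    unfolding green_pot_def
    by (rule integral_abs_bound[THEN order_trans], rule integral_mono')
       (use green0_f_integrable[OF assms(1-3)] in \<open>auto simp: abs_mult green0_nonneg intro!: mult_left_mono g\<close>)
  then have "weight x * \<bar>green_pot g x\<bar> \<le> weight x * (\<integral>y. green0 x y * \<bar>f y\<bar> \<partial>Leb)"
    by (rule mult_left_mono[OF _ weight_nonneg])
  with green0_f_integral[OF assms(1-3)] show ?thesis by (simp add: mult.commute)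
qed

lemma weighted_LinfD:
  assumes "\<xi> \<in> weighted_Linf \<Omega> \<gamma>"
  obtains W where "0 \<le> W" "\<xi> \<in> borel_measurable Leb"
    "AE x in Leb. \<bar>\<xi> x\<bar> \<le> W * weight x"
proof -
  obtain w D where w: "w \<in> borel_measurable Leb" "AE x in Leb. \<bar>w x\<bar> \<le> D"
    and \<xi>: "\<And>x. x \<in> \<Omega> \<Longrightarrow> \<xi> x = weight x * w x"
    using assms by (auto simp: weighted_Linf_def Linf_space_def weight_def)
  have "(\<lambda>x. weight x * w x) \<in> borel_measurable Leb"
    by (intro borel_measurable_times w weight_measurable_dom)
  moreover have "\<xi> \<in> borel_measurable Leb \<longleftrightarrow> (\<lambda>x. weight x * w x) \<in> borel_measurable Leb"
    by (rule measurable_cong) (simp add: \<xi>)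
  moreover have "AE x in Leb. \<bar>\<xi> x\<bar> \<le> \<bar>D\<bar> * weight x"
    using w(2) AE_space
  proof eventually_elim
    case (elim x)
    then have "\<bar>\<xi> x\<bar> = \<bar>w x\<bar> * weight x" using \<xi> weight_nonneg by (simp add: abs_mult)
    also have "\<dots> \<le> \<bar>D\<bar> * weight x" using elim weight_nonneg by (intro mult_right_mono) auto
    finally show ?case .
  qed
  ultimately show ?thesis using that[of "\<bar>D\<bar>"] by auto
qed

lemma weighted_Linf_L2:
  assumes "\<xi> \<in> weighted_Linf \<Omega> \<gamma>"
  shows "\<xi> \<in> L2_space \<Omega>"
proof -
  obtain W where W: "0 \<le> W" "\<xi> \<in> borel_measurable Leb"
    "AE x in Leb. \<bar>\<xi> x\<bar> \<le> W * weight x" using weighted_LinfD[OF assms] .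
  obtain D where D: "0 < D" "\<And>x. x \<in> \<Omega> \<Longrightarrow> weight x \<le> D" using weight_bounded by auto
  have "AE x in Leb. norm ((\<xi> x)\<^sup>2) \<le> (W * D)\<^sup>2"
    using W(3) AE_space
  proof eventually_elim
    case (elim x)
    then have "\<bar>\<xi> x\<bar> \<le> W * D" using D(2)[of x] W(1) by (auto intro: order_trans mult_left_mono)
    then show ?case by (metis abs_ge_zero norm_power power2_abs power_mono real_norm_def)
  qed
  then have "integrable Leb (\<lambda>x. (\<xi> x)\<^sup>2)"
    using W(2) by (intro integrable_const_bound[where B="(W * D)\<^sup>2"]) auto
  then show ?thesis using W(2) by (simp add: L2_space_def)
qed

text \<open>The weight moves from \<open>y\<close> to \<open>x\<close>:
  \<open>green0 x y * weight y\<close> is at most a constant times \<open>weight x\<close> times the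
  Riesz kernel. So the potential again decays like the weight at the boundary, which makes its
  integrals against \<open>f\<close> and \<open>\<mu>\<close> finite.\<close>

lemma green_pot_weighted_bound:
  assumes \<xi>: "\<xi> \<in> borel_measurable Leb" and W: "0 \<le> W" "AE x in Leb. \<bar>\<xi> x\<bar> \<le> W * weight x"
    and x: "x \<in> \<Omega>"
  shows "\<bar>green_pot \<xi> x\<bar> \<le> W * green_const * riesz_const * weight x"
proof -
  have le: "(\<integral>\<^sup>+y. ennreal (riesz x y) \<partial>Leb) \<le> ennreal riesz_const"
  proof -
    have "(\<integral>\<^sup>+y. ennreal (riesz x y) \<partial>Leb) \<le> (\<integral>\<^sup>+y. riesz_top y x \<partial>Leb)"
      by (intro nn_integral_mono) (simp add: riesz_top_def riesz_def norm_minus_commute)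
    also have "\<dots> \<le> ennreal riesz_const" by (rule riesz_const(2)[OF x])
    finally show ?thesis .
  qed
  have Km: "riesz x \<in> borel_measurable Leb"
    by (rule measurable_of_borel[OF id_measurable riesz_measurable1])
  have riesz_top: "integrable Leb (riesz x)"
  proof (rule integrableI_bounded[OF Km])
    show "(\<integral>\<^sup>+y. ennreal (norm (riesz x y)) \<partial>Leb) < \<infinity>"
      using order_le_less_trans[OF le] by (simp add: riesz_nonneg)
  qed
  have "ennreal (\<integral>y. riesz x y \<partial>Leb) \<le> ennreal riesz_const"
    using le nn_integral_eq_integral[OF riesz_top] by (simp add: riesz_nonneg)
  then have K: "(\<integral>y. riesz x y \<partial>Leb) \<le> riesz_const" using riesz_const(1) by (simp add: ennreal_le_iff)
  have AEb: "AE y in Leb. \<bar>green0 x y * \<xi> y\<bar> \<le> W * green_const * weight x * riesz x y"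
    using W(2) AE_space
  proof eventually_elim
    case (elim y)
    then have y: "y \<in> \<Omega>" by simp
    have "\<bar>green0 x y * \<xi> y\<bar> = green0 x y * \<bar>\<xi> y\<bar>" by (simp add: abs_mult green0_nonneg)
    also have "\<dots> \<le> green0 x y * (W * weight y)" using elim by (intro mult_left_mono green0_nonneg) auto
    also have "\<dots> = W * (green0 y x * weight y)" by (simp add: green0_sym[of x y])
    also have "\<dots> \<le> W * (green_const * (weight x * riesz y x))" by (intro mult_left_mono green0_wt_bound x y W)
    finally show ?case by (simp add: riesz_def norm_minus_commute mult_ac)
  qed
  have "\<bar>green_pot \<xi> x\<bar> \<le> (\<integral>y. W * green_const * weight x * riesz x y \<partial>Leb)"
  \<comment> \<open>Without integrability the Bochner integral is 0 by convention and the bound is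
    trivial.\<close>
  proof (cases "integrable Leb (\<lambda>y. green0 x y * \<xi> y)")
    case True
    then show ?thesis unfolding green_pot_def
      by (intro integral_abs_bound[THEN order_trans] integral_mono_AE integrable_abs True
          integrable_mult_right riesz_top AEb)
  next
    case False
    then show ?thesis using W green_const_pos weight_nonneg
      by (simp add: green_pot_def not_integrable_integral_eq riesz_nonneg)
  qed
  also have "\<dots> = W * green_const * weight x * (\<integral>y. riesz x y \<partial>Leb)" by simp
  also have "\<dots> \<le> W * green_const * weight x * riesz_const" using W green_const_pos weight_nonneg by (intro mult_left_mono K) auto
  finally show ?thesis by (simp add: mult_ac)
qed

text \<open>Fubini and the symmetry of the kernel. Absolute integrability on the product comes from
  \<open>\<bar>\<xi> x\<bar> \<le> W * weight x\<close>, which bounds the integrand by a multiple of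
  that of \<open>riesz_pot P\<close>.\<close>

lemma green_pot_duality:
  assumes P: "admissible P" and \<xi>: "\<xi> \<in> weighted_Linf \<Omega> \<gamma>"
  shows "(\<integral>x. (\<integral>y. green0 x y \<partial>P) * \<xi> x \<partial>Leb) = (\<integral>y. green_pot \<xi> y \<partial>P)"
    and "integrable P (green_pot \<xi>)"
proof -
  obtain W where W: "0 \<le> W" "\<xi> \<in> borel_measurable Leb"
    "AE x in Leb. \<bar>\<xi> x\<bar> \<le> W * weight x" using weighted_LinfD[OF \<xi>] .
  interpret QP: sigma_finite_measure P by (rule admissible_sigma_finite[OF P])
  interpret pair_sigma_finite "Leb" P ..
  have sp: "space P = \<Omega>" using P by (simp add: admissible_def)
  have Gm: "(\<lambda>z. green0 (fst z) (snd z)) \<in> borel_measurable (Leb \<Otimes>\<^sub>M P)"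
    by (rule measurable_of_borel_pair[OF id_measurable admissible_id[OF P] green0_measurable])
  then have m: "(\<lambda>z. green0 (fst z) (snd z) * \<xi> (fst z)) \<in> borel_measurable (Leb \<Otimes>\<^sub>M P)"
    by (intro borel_measurable_times measurable_compose[OF measurable_fst W(2)])
  have "integrable (Leb \<Otimes>\<^sub>M P) (\<lambda>z. green0 (fst z) (snd z) * \<xi> (fst z))"
  proof (rule integrableI_bounded[OF m])
    have "(\<integral>\<^sup>+z. ennreal (norm (green0 (fst z) (snd z) * \<xi> (fst z))) \<partial>(Leb \<Otimes>\<^sub>M P))
      = (\<integral>\<^sup>+x. (\<integral>\<^sup>+y. ennreal (norm (green0 x y * \<xi> x)) \<partial>P) \<partial>Leb)"
      using QP.nn_integral_fst[of "\<lambda>z. ennreal (norm (green0 (fst z) (snd z) * \<xi> (fst z)))" "Leb"] m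
      by simp
    also have "\<dots> \<le> (\<integral>\<^sup>+x. ennreal (W * green_const) * riesz_pot P x \<partial>Leb)"
    proof (rule nn_integral_mono_AE)
      show "AE x in Leb. (\<integral>\<^sup>+y. ennreal (norm (green0 x y * \<xi> x)) \<partial>P) \<le> ennreal (W * green_const) * riesz_pot P x"
        using W(3) AE_space
      proof eventually_elim
        case (elim x)
        then have x: "x \<in> \<Omega>" by simp
        have "(\<integral>\<^sup>+y. ennreal (norm (green0 x y * \<xi> x)) \<partial>P)
          \<le> (\<integral>\<^sup>+y. ennreal (W * green_const) * (riesz_top x y * ennreal (weight y)) \<partial>P)"
        proof (rule nn_integral_mono)
          fix y assume "y \<in> space P"
          then have y: "y \<in> \<Omega>" using sp by simp
          show "ennreal (norm (green0 x y * \<xi> x)) \<le> ennreal (W * green_const) * (riesz_top x y * ennreal (weight y))"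
          proof (cases "x = y")
            case True then show ?thesis by (simp add: green0_def offdiag_def)
          next
            case False
            have "norm (green0 x y * \<xi> x) = green0 x y * \<bar>\<xi> x\<bar>" by (simp add: abs_mult green0_nonneg)
            also have "\<dots> \<le> green0 x y * (W * weight x)" using elim by (intro mult_left_mono green0_nonneg) auto
            also have "\<dots> = W * (green0 x y * weight x)" by simp
            also have "\<dots> \<le> W * (green_const * (weight y * riesz x y))" by (intro mult_left_mono green0_wt_bound x y W)
            also have "\<dots> = W * green_const * (riesz x y * weight y)" by simp
            finally have "ennreal (norm (green0 x y * \<xi> x)) \<le> ennreal (W * green_const * (riesz x y * weight y))"
              by (rule ennreal_leI)
            also have "\<dots> = ennreal (W * green_const) * (riesz_top x y * ennreal (weight y))"
              using False W green_const_pos weight_nonneg riesz_nonneg by (simp add: riesz_top_def ennreal_mult)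
            finally show ?thesis .
          qed
        qed
        also have "\<dots> = ennreal (W * green_const) * riesz_pot P x"
          unfolding riesz_pot_def
          by (intro nn_integral_cmult measurable_of_borel[OF admissible_id[OF P]]
              borel_measurable_times_ennreal riesz_top_measurable1 weight_ennreal_measurable)
        finally show ?case .
      qed
    qed
    also have "\<dots> = ennreal (W * green_const) * (\<integral>\<^sup>+x. riesz_pot P x \<partial>Leb)"
      by (intro nn_integral_cmult riesz_pot_measurable P)
    also have "\<dots> < \<infinity>" using riesz_pot_integral[OF P] by (auto simp: ennreal_mult_less_top)
    finally show "(\<integral>\<^sup>+z. ennreal (norm (green0 (fst z) (snd z) * \<xi> (fst z))) \<partial>(Leb \<Otimes>\<^sub>M P)) < \<infinity>" .
  qed
  then have i: "integrable (Leb \<Otimes>\<^sub>M P) (case_prod (\<lambda>x y. green0 x y * \<xi> x))"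
    by (simp add: split_beta')
  have e: "(\<integral>x. green0 x y * \<xi> x \<partial>Leb) = green_pot \<xi> y" for y
    by (simp add: green_pot_def green0_sym[of _ y])
  have "(\<integral>y. (\<integral>x. green0 x y * \<xi> x \<partial>Leb) \<partial>P) = (\<integral>x. (\<integral>y. green0 x y * \<xi> x \<partial>P) \<partial>Leb)"
    by (rule Fubini_integral[OF i])
  then show "(\<integral>x. (\<integral>y. green0 x y \<partial>P) * \<xi> x \<partial>Leb) = (\<integral>y. green_pot \<xi> y \<partial>P)" by (simp add: e)
  show "integrable P (green_pot \<xi>)" using integrable_snd[OF i] by (simp add: e)
qed

lemma L1_weighted_mult_integrable:
  assumes f: "f \<in> L1_weighted \<Omega> \<gamma>" and h: "h \<in> borel_measurable Leb"
    and b: "\<And>x. x \<in> \<Omega> \<Longrightarrow> \<bar>h x\<bar> \<le> A * weight x"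
  shows "integrable Leb (\<lambda>x. f x * h x)"
proof (rule Bochner_Integration.integrable_bound)
  show "integrable Leb (\<lambda>x. A * (\<bar>f x\<bar> * weight x))"
    using f by (auto simp: L1_weighted_iff)
  show "AE x in Leb. norm (f x * h x) \<le> norm (A * (\<bar>f x\<bar> * weight x))"
  proof (rule AE_I2)
    fix x assume "x \<in> space Leb"
    then have "\<bar>f x\<bar> * \<bar>h x\<bar> \<le> \<bar>f x\<bar> * (A * weight x)" by (intro mult_left_mono b) auto
    also have "\<dots> \<le> norm (A * (\<bar>f x\<bar> * weight x))" by (simp add: mult_ac)
    finally show "norm (f x * h x) \<le> norm (A * (\<bar>f x\<bar> * weight x))" by (simp add: abs_mult)
  qed
qed (use f h in \<open>auto simp: L1_weighted_iff\<close>)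

text \<open>Dominated convergence for the two sides of the inequalities. Against
  \<open>\<xi>\<close> a majorant is required only after multiplication by the weight; against the
  potential of \<open>\<xi>\<close>, which decays like the weight, \<open>f\<close> itself serves as
  majorant.\<close>

lemma
  assumes \<xi>: "\<xi> \<in> weighted_Linf \<Omega> \<gamma>"
    and m: "\<And>n. a n \<in> borel_measurable Leb" "a' \<in> borel_measurable Leb"
    and lim: "AE x in Leb. (\<lambda>n. a n x) \<longlonglongrightarrow> a' x"
  shows tendsto_integral_weighted:
      "integrable Leb h \<Longrightarrow> (\<And>n. AE x in Leb. \<bar>a n x\<bar> * weight x \<le> h x) \<Longrightarrow>
        (\<lambda>n. \<integral>x. a n x * \<xi> x \<partial>Leb) \<longlonglongrightarrow> (\<integral>x. a' x * \<xi> x \<partial>Leb)"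
    and tendsto_integral_GO:
      "f \<in> L1_weighted \<Omega> \<gamma> \<Longrightarrow> (\<And>n x. \<bar>a n x\<bar> \<le> \<bar>f x\<bar>) \<Longrightarrow>
        (\<lambda>n. \<integral>x. a n x * green_pot \<xi> x \<partial>Leb) \<longlonglongrightarrow> (\<integral>x. a' x * green_pot \<xi> x \<partial>Leb)"
proof -
  obtain W where W: "0 \<le> W" "\<xi> \<in> borel_measurable Leb"
    "AE x in Leb. \<bar>\<xi> x\<bar> \<le> W * weight x" using weighted_LinfD[OF \<xi>] .
  show "(\<lambda>n. \<integral>x. a n x * \<xi> x \<partial>Leb) \<longlonglongrightarrow> (\<integral>x. a' x * \<xi> x \<partial>Leb)"
    if h: "integrable Leb h" "\<And>n. AE x in Leb. \<bar>a n x\<bar> * weight x \<le> h x"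
  proof (rule integral_dominated_convergence)
    show "integrable Leb (\<lambda>x. W * h x)" by (intro integrable_mult_right h)
    show "AE x in Leb. (\<lambda>n. a n x * \<xi> x) \<longlonglongrightarrow> a' x * \<xi> x"
      using lim by eventually_elim (intro tendsto_mult tendsto_const)
    show "AE x in Leb. norm (a n x * \<xi> x) \<le> W * h x" for n
      using h(2)[of n] W(3)
    proof eventually_elim
      case (elim x)
      have "norm (a n x * \<xi> x) \<le> \<bar>a n x\<bar> * (W * weight x)"
        using elim by (auto simp: abs_mult intro!: mult_left_mono)
      also have "\<dots> = W * (\<bar>a n x\<bar> * weight x)" by simp
      also have "\<dots> \<le> W * h x" using elim W(1) by (intro mult_left_mono) auto
      finally show ?case .
    qed
  qed (intro borel_measurable_times m W(2))+
  show "(\<lambda>n. \<integral>x. a n x * green_pot \<xi> x \<partial>Leb) \<longlonglongrightarrow> (\<integral>x. a' x * green_pot \<xi> x \<partial>Leb)"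
    if f: "f \<in> L1_weighted \<Omega> \<gamma>" and le: "\<And>n x. \<bar>a n x\<bar> \<le> \<bar>f x\<bar>"
  proof (rule integral_dominated_convergence)
    show "integrable Leb (\<lambda>x. \<bar>f x\<bar> * weight x * (W * green_const * riesz_const))"
      using f by (auto simp: L1_weighted_iff)
    show "AE x in Leb. (\<lambda>n. a n x * green_pot \<xi> x) \<longlonglongrightarrow> a' x * green_pot \<xi> x"
      using lim by eventually_elim (intro tendsto_mult tendsto_const)
    show "AE x in Leb. norm (a n x * green_pot \<xi> x) \<le> \<bar>f x\<bar> * weight x * (W * green_const * riesz_const)" for n
      using AE_space
    proof eventually_elim
      case (elim x)
      have "norm (a n x * green_pot \<xi> x) = \<bar>a n x\<bar> * \<bar>green_pot \<xi> x\<bar>" by (simp add: abs_mult)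
      also have "\<dots> \<le> \<bar>f x\<bar> * (W * green_const * riesz_const * weight x)"
        using elim by (intro mult_mono le green_pot_weighted_bound[OF W(2) W(1) W(3)]) auto
      finally show ?case by (simp add: mult_ac)
    qed
  qed (intro borel_measurable_times m measurable_of_borel[OF id_measurable green_pot_measurable[OF W(2)]])+
qed

end

section \<open>From square integrable to integrable data\<close>

text \<open>The inequality for square integrable data becomes the only link to the form; what
  follows inside this locale consists of limit arguments about the kernel.\<close>

locale green_kato = green_kernel +
  assumes kato_L2': "\<And>f \<xi> p P. f \<in> L2_space \<Omega> \<Longrightarrow> \<xi> \<in> weighted_Linf \<Omega> \<gamma> \<Longrightarrow>
    AE x in Leb. 0 \<le> green_pot \<xi> x \<Longrightarrow> kato_pair p P \<Longrightarrow>
    (\<integral>x. P (green_pot f x) * \<xi> x \<partial>Leb) \<le> (\<integral>x. p (green_pot f x) * f x * green_pot \<xi> x \<partial>Leb)"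
begin

text \<open>Truncations at height \<open>n\<close> are bounded on a set of finite measure, hence
  square integrable, and stay below \<open>\<bar>f\<bar>\<close>. Their potentials converge wherever
  the Riesz potential of \<open>\<bar>f\<bar> dx\<close> is finite.\<close>

lemma kato_L1:
  assumes f: "f \<in> L1_weighted \<Omega> \<gamma>" and \<xi>: "\<xi> \<in> weighted_Linf \<Omega> \<gamma>"
    and pos: "AE x in Leb. 0 \<le> green_pot \<xi> x" and k: "kato_pair p P"
  shows "(\<integral>x. P (green_pot f x) * \<xi> x \<partial>Leb) \<le> (\<integral>x. p (green_pot f x) * f x * green_pot \<xi> x \<partial>Leb)"
proof -
  have fm: "f \<in> borel_measurable Leb" using f by (simp add: L1_weighted_iff)
  define fn where "fn n x = max (- real n) (min (real n) (f x))" for n x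
  have fnm: "fn n \<in> borel_measurable Leb" for n
    unfolding fn_def[abs_def] using fm by measurable
  have fn_le: "\<bar>fn n x\<bar> \<le> \<bar>f x\<bar>" for n x by (auto simp: fn_def)
  have fn_lim: "(\<lambda>n. fn n x) \<longlonglongrightarrow> f x" for x
  proof -
    obtain m where m: "\<bar>f x\<bar> \<le> real m" using real_arch_simple by blast
    have "fn n x = f x" if "m \<le> n" for n
      using m of_nat_mono[OF that, where 'a=real] by (auto simp: fn_def)
    then have "eventually (\<lambda>n. fn n x = f x) sequentially" by (auto simp: eventually_sequentially)
    then show ?thesis by (rule tendsto_eventually)
  qed
  have fnL2: "fn n \<in> L2_space \<Omega>" for n
  proof -
    have "norm ((fn n x)\<^sup>2) \<le> (real n)\<^sup>2" for x
    proof -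
      have "\<bar>fn n x\<bar> \<le> real n" by (auto simp: fn_def)
      then show ?thesis by (metis abs_ge_zero norm_power power_mono real_norm_def)
    qed
    then have "integrable Leb (\<lambda>x. (fn n x)\<^sup>2)"
      using fnm by (intro integrable_const_bound[where B="(real n)\<^sup>2"]) auto
    then show ?thesis using fnm by (simp add: L2_space_def)
  qed
  note ad = admissible_dens[OF f]
  have good: "AE x in Leb. x \<in> \<Omega> \<and> riesz_pot (abs_density f) x < \<infinity>"
    using riesz_pot_finite_AE[OF ad] AE_space by eventually_elim simp
  have lim: "(\<lambda>n. green_pot (fn n) x) \<longlonglongrightarrow> green_pot f x" if x: "x \<in> \<Omega>" "riesz_pot (abs_density f) x < \<infinity>" for x
    unfolding green_pot_def
  proof (rule integral_dominated_convergence)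
    show "integrable Leb (\<lambda>y. green0 x y * \<bar>f y\<bar>)" by (rule green0_f_integrable[OF f x])
    show "AE y in Leb. (\<lambda>n. green0 x y * fn n y) \<longlonglongrightarrow> green0 x y * f y"
      by (intro AE_I2 tendsto_mult tendsto_const fn_lim)
    show "AE y in Leb. norm (green0 x y * fn n y) \<le> green0 x y * \<bar>f y\<bar>" for n
      by (intro AE_I2) (auto simp: abs_mult green0_nonneg intro!: mult_left_mono fn_le)
  qed (intro borel_measurable_times measurable_of_borel[OF id_measurable green0_measurable1] fm fnm)+
  have Gm: "green_pot g \<in> borel_measurable Leb" if "g \<in> borel_measurable Leb" for g
    by (rule measurable_of_borel[OF id_measurable green_pot_measurable[OF that]])
  note pm = kato_pair_measurable[OF k]
  have p1: "\<bar>p a\<bar> \<le> 1" for a using k by (simp add: kato_pair_def)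
  have lP: "AE x in Leb. (\<lambda>n. P (green_pot (fn n) x)) \<longlonglongrightarrow> P (green_pot f x)"
    using good by eventually_elim (intro isCont_tendsto_compose[OF kato_pair_isCont(2)[OF k]] lim, auto)
  have lp: "AE x in Leb. (\<lambda>n. p (green_pot (fn n) x) * fn n x) \<longlonglongrightarrow> p (green_pot f x) * f x"
    using good by eventually_elim
      (intro tendsto_mult fn_lim isCont_tendsto_compose[OF kato_pair_isCont(1)[OF k]] lim, auto)
  have b: "AE x in Leb. \<bar>P (green_pot (fn n) x)\<bar> * weight x \<le> green_bound (abs_density f) x" for n
    using good
  proof eventually_elim
    case (elim x)
    have "\<bar>P (green_pot (fn n) x)\<bar> * weight x \<le> \<bar>green_pot (fn n) x\<bar> * weight x"
      by (intro mult_right_mono kato_pair_abs_le[OF k] weight_nonneg)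
    also have "\<dots> \<le> green_bound (abs_density f) x" using elim by (intro green_pot_bound[OF f _ _ fnm fn_le]) auto
    finally show ?case .
  qed
  have l1: "(\<lambda>n. \<integral>x. P (green_pot (fn n) x) * \<xi> x \<partial>Leb) \<longlonglongrightarrow> (\<integral>x. P (green_pot f x) * \<xi> x \<partial>Leb)"
    by (rule tendsto_integral_weighted[OF \<xi> _ _ lP green_bound_integrable[OF ad] b])
       (intro measurable_compose[OF Gm pm(2)] fm fnm)+
  have l2: "(\<lambda>n. \<integral>x. p (green_pot (fn n) x) * fn n x * green_pot \<xi> x \<partial>Leb)
      \<longlonglongrightarrow> (\<integral>x. p (green_pot f x) * f x * green_pot \<xi> x \<partial>Leb)"
  proof (rule tendsto_integral_GO[OF \<xi> _ _ lp f])
    show "\<bar>p (green_pot (fn n) x) * fn n x\<bar> \<le> \<bar>f x\<bar>" for n x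
      using mult_mono[OF p1[of "green_pot (fn n) x"] fn_le[of n x]] by (simp add: abs_mult)
  qed (intro borel_measurable_times measurable_compose[OF Gm pm(1)] fm fnm)+
  show ?thesis
    by (rule LIMSEQ_le[OF l1 l2]) (use kato_L2'[OF fnL2 \<xi> pos k] in blast)
qed

end

subsection \<open>Mollification of measures\<close>

text \<open>If \<open>e > g\<close>, the lower bound is \<open>ennreal\<close> of a negative number,
  that is 0, and imposes nothing; this is consistent with \<open>g - e < 0\<close>.\<close>

lemma tendsto_ennreal_sandwich:
  assumes g: "0 \<le> g"
    and ev: "\<And>e. 0 < e \<Longrightarrow> eventually (\<lambda>n. ennreal (g - e) \<le> X n \<and> X n \<le> ennreal (g + e)) sequentially"
  shows "X \<longlonglongrightarrow> ennreal g"
proof -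
  have "(\<lambda>n. enn2real (X n)) \<longlonglongrightarrow> g"
  proof (rule LIMSEQ_I)
    fix r :: real assume r: "0 < r"
    have "eventually (\<lambda>n. norm (enn2real (X n) - g) < r) sequentially"
      using ev[OF half_gt_zero[OF r]]
    proof eventually_elim
      case (elim n)
      have "X n < top" using elim by (meson ennreal_less_top order_le_less_trans)
      then have X: "X n = ennreal (enn2real (X n))" by simp
      have "0 \<le> g + r / 2" using g r by simp
      moreover have "ennreal (enn2real (X n)) \<le> ennreal (g + r / 2)" "ennreal (g - r / 2) \<le> ennreal (enn2real (X n))"
        using elim X by auto
      ultimately have "enn2real (X n) \<le> g + r / 2" "g - r / 2 \<le> enn2real (X n)"
        by (simp_all only: ennreal_le_iff enn2real_nonneg)
      then show ?case using r by (simp add: abs_if)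
    qed
    then show "\<exists>no. \<forall>n\<ge>no. norm (enn2real (X n) - g) < r" by (simp add: eventually_sequentially)
  qed
  then have "(\<lambda>n. ennreal (enn2real (X n))) \<longlonglongrightarrow> ennreal g" by (rule tendsto_ennrealI)
  moreover have "eventually (\<lambda>n. ennreal (enn2real (X n)) = X n) sequentially"
    using ev[OF zero_less_one]
  proof eventually_elim
    case (elim n)
    then have "X n < top" by (meson ennreal_less_top order_le_less_trans)
    then show ?case by simp
  qed
  ultimately show ?thesis by (rule Lim_transform_eventually)
qed

context green_kernel
begin

text \<open>With a radius proportional to the distance to the boundary, the averages stay inside the domain
  and the weight changes only by a constant factor.\<close>
definition bump_radius :: "nat \<Rightarrow> 'a \<Rightarrow> real" where
  "bump_radius n y = bdist \<Omega> y / (real n + 2)"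

definition bump :: "nat \<Rightarrow> 'a \<Rightarrow> 'a \<Rightarrow> real" where
  "bump n y z = (if dist y z < bump_radius n y then 1 / (unit_ball_vol DIM('a) * bump_radius n y ^ DIM('a)) else 0)"

lemma bdist_nonneg: "0 \<le> bdist \<Omega> y"
  by (simp add: bdist_def infdist_nonneg)

lemma bump_radius_nonneg: "0 \<le> bump_radius n y"
  using bdist_nonneg by (simp add: bump_radius_def)

lemma bump_radius_pos: "y \<in> \<Omega> \<Longrightarrow> 0 < bump_radius n y"
  using bdist_pos by (simp add: bump_radius_def)

lemma bump_radius_le: "bump_radius n y \<le> bdist \<Omega> y"
  using bdist_nonneg[of y] by (simp add: bump_radius_def field_simps)

lemma ball_rad_subset: "ball y (bump_radius n y) \<subseteq> \<Omega>"
proof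
  fix z assume "z \<in> ball y (bump_radius n y)"
  then have "dist y z < bdist \<Omega> y" using bump_radius_le[of n y] by simp
  then show "z \<in> \<Omega>" unfolding bdist_def using infdist_le[of z "- \<Omega>" y] by force
qed

lemma bump_measurable: "(\<lambda>w. bump n (fst w) (snd w)) \<in> borel_measurable (borel \<Otimes>\<^sub>M borel)"
  unfolding bump_def bump_radius_def by measurable

lemma bump_measurable1: "bump n y \<in> borel_measurable borel"
  using measurable_compose[OF measurable_Pair1' bump_measurable, of y] by auto

lemma bump_nn_integral:
  assumes y: "y \<in> \<Omega>" and h: "h \<in> borel_measurable borel"
  shows "(\<integral>\<^sup>+z. h z * ennreal (bump n y z) \<partial>Leb) =
    (\<integral>\<^sup>+z. h z * indicator (ball y (bump_radius n y)) z \<partial>lborel) *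
      ennreal (1 / (unit_ball_vol DIM('a) * bump_radius n y ^ DIM('a)))"
proof -
  let ?c = "1 / (unit_ball_vol DIM('a) * bump_radius n y ^ DIM('a))"
  have b: "ball y (bump_radius n y) \<in> sets borel" by simp
  have "(\<integral>\<^sup>+z. h z * ennreal (bump n y z) \<partial>Leb)
      = (\<integral>\<^sup>+z. h z * ennreal (bump n y z) * indicator \<Omega> z \<partial>lborel)"
    by (simp add: nn_integral_restrict_space nn_integral_completion)
  also have "\<dots> = (\<integral>\<^sup>+z. h z * indicator (ball y (bump_radius n y)) z * ennreal ?c \<partial>lborel)"
    using ball_rad_subset[of y n] by (intro nn_integral_cong) (auto simp: bump_def indicator_def)
  also have "\<dots> = (\<integral>\<^sup>+z. h z * indicator (ball y (bump_radius n y)) z \<partial>lborel) * ennreal ?c"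
    by (intro nn_integral_multc borel_measurable_times_ennreal borel_measurable_indicator)
       (use h b in auto)
  finally show ?thesis .
qed

lemma bump_total:
  assumes y: "y \<in> \<Omega>"
  shows "(\<integral>\<^sup>+z. ennreal (bump n y z) \<partial>Leb) = 1"
proof -
  have V: "0 < unit_ball_vol DIM('a) * bump_radius n y ^ DIM('a)" using bump_radius_pos[OF y] by simp
  have one: "ennreal v * ennreal (1 / v) = 1" if "0 < v" for v :: real
    using that by (simp add: ennreal_mult[symmetric])
  have "(\<integral>\<^sup>+z. ennreal (bump n y z) \<partial>Leb) = (\<integral>\<^sup>+z. 1 * ennreal (bump n y z) \<partial>Leb)"
    by simp
  also have "\<dots> = emeasure lborel (ball y (bump_radius n y)) * ennreal (1 / (unit_ball_vol DIM('a) * bump_radius n y ^ DIM('a)))"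
    by (subst bump_nn_integral[OF y]) auto
  also have "\<dots> = ennreal (unit_ball_vol DIM('a) * bump_radius n y ^ DIM('a)) * ennreal (1 / (unit_ball_vol DIM('a) * bump_radius n y ^ DIM('a)))"
    using bump_radius_nonneg by (simp add: emeasure_ball)
  also have "\<dots> = 1" by (rule one[OF V])
  finally show ?thesis .
qed

lemma weight_ball_le:
  assumes "dist y z < bump_radius n y"
  shows "weight z \<le> 2 powr \<gamma> * weight y"
proof -
  have "bdist \<Omega> z \<le> bdist \<Omega> y + norm (z - y)" by (rule bdist_triangle)
  also have "\<dots> \<le> 2 * bdist \<Omega> y"
    using assms bump_radius_le[of n y] by (simp add: dist_norm norm_minus_commute)
  finally have "weight z \<le> (2 * bdist \<Omega> y) powr \<gamma>"
    unfolding weight_def using \<gamma>_pos bdist_nonneg by (intro powr_mono2) auto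
  also have "\<dots> = 2 powr \<gamma> * weight y" using bdist_nonneg by (simp add: weight_def powr_mult)
  finally show ?thesis .
qed

text \<open>If the radius is at most half of \<open>\<bar>x - y\<bar>\<close>, the kernel is comparable to its value at \<open>y\<close> on the whole
  ball; otherwise the ball lies in the one of three times the radius around \<open>x\<close>.\<close>
lemma riesz_average:
  "\<exists>A>0. \<forall>y\<in>\<Omega>. \<forall>x n. x \<noteq> y \<longrightarrow>
    (\<integral>\<^sup>+z. ennreal (riesz x z) * ennreal (bump n y z) \<partial>Leb) \<le> ennreal (A * riesz x y)"
proof -
  define \<alpha> where "\<alpha> = real DIM('a) - 2 * s"
  define V where "V = unit_ball_vol DIM('a)"
  have V: "0 < V" by (simp add: V_def)
  have \<alpha>: "0 < \<alpha>" using s_dim by (simp add: \<alpha>_def)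
  have riesz: "riesz x z = norm (x - z) powr (- \<alpha>)" for x z by (simp add: riesz_def \<alpha>_def)
  obtain A where A: "0 < A" and A2: "\<forall>x R. 0 < R \<longrightarrow>
      (\<integral>\<^sup>+y. ennreal (riesz x y) * indicator (ball x R) y \<partial>lborel) \<le> ennreal (A * R powr (2 * s))"
    using riesz_ball by (elim exE conjE)
  \<comment> \<open>\<open>2 powr \<alpha>\<close> compares the kernel at distance
    \<open>t / 2\<close> with the one at distance \<open>t\<close>. The summand 1 serves balls away
    from \<open>x\<close>; the other one is the integral over the ball of radius \<open>3 r\<close>
    around \<open>x\<close>, divided by the volume of the averaging ball.\<close>
  define D where "D = 2 powr \<alpha> * (1 + A * 3 powr (2 * s) / V)"
  have D: "0 < D" using A V by (simp add: D_def add_pos_nonneg)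
  have "(\<integral>\<^sup>+z. ennreal (riesz x z) * ennreal (bump n y z) \<partial>Leb) \<le> ennreal (D * riesz x y)"
    if y: "y \<in> \<Omega>" and xy: "x \<noteq> y" for x y n
  proof -
    define r where "r = bump_radius n y"
    define t where "t = norm (x - y)"
    have r: "0 < r" using bump_radius_pos[OF y] by (simp add: r_def)
    have t: "0 < t" using xy by (simp add: t_def)
    have t2: "(t / 2) powr (- \<alpha>) = 2 powr \<alpha> * riesz x y"
      using t by (simp add: riesz t_def powr_divide powr_minus field_simps)
    have h: "(\<lambda>z. ennreal (riesz x z)) \<in> borel_measurable borel"
      using riesz_measurable1[of x] by measurable
    show ?thesis
    proof (cases "r \<le> t / 2")
      case True
      have "(\<integral>\<^sup>+z. ennreal (riesz x z) * ennreal (bump n y z) \<partial>Leb)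
        \<le> (\<integral>\<^sup>+z. ennreal (2 powr \<alpha> * riesz x y) * ennreal (bump n y z) \<partial>Leb)"
      proof (rule nn_integral_mono)
        fix z
        show "ennreal (riesz x z) * ennreal (bump n y z) \<le> ennreal (2 powr \<alpha> * riesz x y) * ennreal (bump n y z)"
        proof (cases "dist y z < r")
          case z: True
          have "t \<le> norm (x - z) + norm (z - y)" unfolding t_def using norm_triangle_ineq[of "x - z" "z - y"] by simp
          then have "t / 2 \<le> norm (x - z)" using z True by (simp add: dist_norm norm_minus_commute)
          then have "riesz x z \<le> (t / 2) powr (- \<alpha>)"
            unfolding riesz using \<alpha> t by (intro powr_mono2') auto
          then show ?thesis unfolding t2 by (intro mult_right_mono ennreal_leI) auto
        qed (simp add: bump_def r_def)
      qed
      also have "\<dots> = ennreal (2 powr \<alpha> * riesz x y) * 1"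
        by (subst nn_integral_cmult)
           (auto simp: bump_total[OF y] intro!: measurable_of_borel[OF id_measurable] measurable_compose[OF bump_measurable1])
      also have "\<dots> \<le> ennreal (D * riesz x y)"
      proof -
        have "2 powr \<alpha> * 1 \<le> D" unfolding D_def using A V by (intro mult_left_mono) auto
        then show ?thesis using riesz_nonneg[of x y] by (auto intro!: ennreal_leI mult_right_mono)
      qed
      finally show ?thesis .
    next
      case False
      have sub: "ball y r \<subseteq> ball x (3 * r)"
      proof
        fix z assume "z \<in> ball y r"
        then have "dist x z < t + r" using dist_triangle[of x z y] by (simp add: t_def dist_norm)
        then show "z \<in> ball x (3 * r)" using False by simp
      qed
      have "(\<integral>\<^sup>+z. ennreal (riesz x z) * ennreal (bump n y z) \<partial>Leb)
        = (\<integral>\<^sup>+z. ennreal (riesz x z) * indicator (ball y r) z \<partial>lborel) * ennreal (1 / (V * r ^ DIM('a)))"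
        unfolding bump_nn_integral[OF y h] r_def V_def ..
      also have "\<dots> \<le> (\<integral>\<^sup>+z. ennreal (riesz x z) * indicator (ball x (3 * r)) z \<partial>lborel) * ennreal (1 / (V * r ^ DIM('a)))"
        using sub by (intro mult_right_mono nn_integral_mono) (auto simp: riesz_def indicator_def)
      also have "\<dots> \<le> ennreal (A * (3 * r) powr (2 * s)) * ennreal (1 / (V * r ^ DIM('a)))"
        using r by (intro mult_right_mono A2[rule_format]) auto
      also have "\<dots> = ennreal (A * (3 * r) powr (2 * s) * (1 / (V * r ^ DIM('a))))"
        using A V r by (intro ennreal_mult[symmetric]) auto
      also have "A * (3 * r) powr (2 * s) * (1 / (V * r ^ DIM('a))) = (A * 3 powr (2 * s) / V) * r powr (- \<alpha>)"
        using r by (simp add: powr_mult \<alpha>_def powr_diff powr_realpow field_simps)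
      also have "ennreal \<dots> \<le> ennreal (D * riesz x y)"
      proof (rule ennreal_leI)
        have "r powr (- \<alpha>) \<le> (t / 2) powr (- \<alpha>)" using False \<alpha> t by (intro powr_mono2') auto
        then have "(A * 3 powr (2 * s) / V) * r powr (- \<alpha>) \<le> (A * 3 powr (2 * s) / V) * (2 powr \<alpha> * riesz x y)"
          unfolding t2 using A V by (intro mult_left_mono) auto
        also have "\<dots> \<le> D * riesz x y"
          using riesz_nonneg[of x y] by (simp add: D_def algebra_simps)
        finally show "(A * 3 powr (2 * s) / V) * r powr (- \<alpha>) \<le> D * riesz x y" .
      qed
      finally show ?thesis .
    qed
  qed
  then show ?thesis using D by blast
qed

definition average_const :: real where
  "average_const = (SOME A. 0 < A \<and> (\<forall>y\<in>\<Omega>. \<forall>x n. x \<noteq> y \<longrightarrow>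
    (\<integral>\<^sup>+z. ennreal (riesz x z) * ennreal (bump n y z) \<partial>Leb) \<le> ennreal (A * riesz x y)))"

lemma average_const: "0 < average_const" "y \<in> \<Omega> \<Longrightarrow> x \<noteq> y \<Longrightarrow>
    (\<integral>\<^sup>+z. ennreal (riesz x z) * ennreal (bump n y z) \<partial>Leb) \<le> ennreal (average_const * riesz x y)"
  using someI_ex[OF riesz_average] by (auto simp: average_const_def)

text \<open>\<open>green_const\<close> bounds the kernel, \<open>2 powr \<gamma>\<close> compares
  the weight across a bump, \<open>average_const\<close> bounds means of the Riesz kernel. None of
  them depends on \<open>n\<close>.\<close>

definition mollify_const :: real where "mollify_const = green_const * 2 powr \<gamma> * average_const"

lemma mollify_const_pos: "0 < mollify_const" using green_const_pos average_const by (simp add: mollify_const_def)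

text \<open>Mean of the kernel over a ball around \<open>y\<close>. By Tonelli its integral over
  \<open>P\<close> is the potential of the mollified measure.\<close>

definition green_avg :: "nat \<Rightarrow> 'a \<Rightarrow> 'a \<Rightarrow> ennreal" where
  "green_avg n x y = (\<integral>\<^sup>+z. ennreal (green0 x z) * ennreal (bump n y z) \<partial>Leb)"

text \<open>Uniform in \<open>n\<close>, hence the majorant for the limit. At \<open>x = y\<close>
  the right side is \<infinity>.\<close>

lemma green_avg_bound:
  assumes x: "x \<in> \<Omega>" and y: "y \<in> \<Omega>"
  shows "green_avg n x y \<le> ennreal (mollify_const / weight x) * (riesz_top x y * ennreal (weight y))"
proof (cases "x = y")
  case True
  have "0 < mollify_const / weight x" using mollify_const_pos weight_pos[OF x] by simp
  then show ?thesis using True weight_pos[OF y] mollify_const_pos by (simp add: riesz_top_def ennreal_mult_top ennreal_top_mult)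
next
  case False
  have m: "(\<lambda>z. ennreal (riesz x z) * ennreal (bump n y z)) \<in> borel_measurable Leb"
    by (intro measurable_of_borel[OF id_measurable] borel_measurable_times_ennreal
        measurable_compose[OF bump_measurable1] measurable_compose[OF riesz_measurable1]) auto
  have c0: "0 \<le> green_const / weight x * (2 powr \<gamma> * weight y)" using green_const_pos weight_nonneg by simp
  have "green_avg n x y \<le> (\<integral>\<^sup>+z. ennreal (green_const / weight x * (2 powr \<gamma> * weight y)) * (ennreal (riesz x z) * ennreal (bump n y z)) \<partial>Leb)"
    unfolding green_avg_def
  proof (rule nn_integral_mono)
    fix z assume "z \<in> space Leb"
    then have z: "z \<in> \<Omega>" by simp
    show "ennreal (green0 x z) * ennreal (bump n y z) \<le> ennreal (green_const / weight x * (2 powr \<gamma> * weight y)) * (ennreal (riesz x z) * ennreal (bump n y z))"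
    proof (cases "dist y z < bump_radius n y")
      case True
      have "green0 x z \<le> green_const / weight x * (weight z * riesz x z)" by (rule green0_le[OF x z])
      also have "\<dots> \<le> green_const / weight x * ((2 powr \<gamma> * weight y) * riesz x z)"
        using green_const_pos weight_nonneg riesz_nonneg by (intro mult_left_mono mult_right_mono weight_ball_le[OF True]) auto
      also have "\<dots> = green_const / weight x * (2 powr \<gamma> * weight y) * riesz x z" by simp
      finally have "ennreal (green0 x z) \<le> ennreal (green_const / weight x * (2 powr \<gamma> * weight y)) * ennreal (riesz x z)"
        unfolding ennreal_mult[OF c0 riesz_nonneg, symmetric] by (rule ennreal_leI)
      then show ?thesis unfolding mult.assoc[symmetric] by (rule mult_right_mono) simp
    qed (simp add: bump_def)
  qed
  also have "\<dots> = ennreal (green_const / weight x * (2 powr \<gamma> * weight y)) * (\<integral>\<^sup>+z. ennreal (riesz x z) * ennreal (bump n y z) \<partial>Leb)"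
    by (rule nn_integral_cmult[OF m])
  also have "\<dots> \<le> ennreal (green_const / weight x * (2 powr \<gamma> * weight y)) * ennreal (average_const * riesz x y)"
    by (intro mult_left_mono average_const y False) auto
  also have "\<dots> = ennreal (green_const / weight x * (2 powr \<gamma> * weight y) * (average_const * riesz x y))"
    using c0 average_const(1) riesz_nonneg by (intro ennreal_mult[symmetric]) auto
  also have "green_const / weight x * (2 powr \<gamma> * weight y) * (average_const * riesz x y) = mollify_const / weight x * (riesz x y * weight y)"
    by (simp add: mollify_const_def)
  also have "ennreal \<dots> = ennreal (mollify_const / weight x) * (riesz_top x y * ennreal (weight y))"
  proof -
    have "0 \<le> mollify_const / weight x" using mollify_const_pos weight_nonneg by simp
    then show ?thesis
      using False by (simp only: riesz_top_def if_False ennreal_mult weight_nonneg riesz_nonneg mult_nonneg_nonneg)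
  qed
  finally show ?thesis .
qed

lemma bump_radius_tendsto: "(\<lambda>n. bump_radius n y) \<longlonglongrightarrow> 0"
proof -
  have "(\<lambda>n. bdist \<Omega> y / real (n + 2)) \<longlonglongrightarrow> 0"
    by (rule LIMSEQ_ignore_initial_segment[OF lim_const_over_n])
  then show ?thesis by (simp add: bump_radius_def add.commute)
qed

text \<open>Joint continuity off the diagonal makes \<open>green0 x\<close> continuous at
  \<open>y\<close>, and means over shrinking balls recover the value there.\<close>

lemma green_avg_tendsto:
  assumes G2: "cond_G2 \<Omega> G" and x: "x \<in> \<Omega>" and y: "y \<in> \<Omega>" and xy: "x \<noteq> y"
  shows "(\<lambda>n. green_avg n x y) \<longlonglongrightarrow> ennreal (green0 x y)"
proof (rule tendsto_ennreal_sandwich[OF green0_nonneg])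
  fix e :: real assume e: "0 < e"
  have "continuous_on (offdiag \<Omega>) (\<lambda>z. green0 (fst z) (snd z))"
    using G2 unfolding cond_G2_def
    by (rule continuous_on_eq) (auto simp: green0_def)
  moreover have "(x, y) \<in> offdiag \<Omega>" using x y xy by (simp add: offdiag_def)
  ultimately have "isCont (\<lambda>z. green0 (fst z) (snd z)) (x, y)"
    using offdiag_open continuous_on_eq_continuous_at by blast
  then have "isCont (\<lambda>z. green0 (fst (x, z)) (snd (x, z))) y"
    by (intro isCont_o2[where f = "\<lambda>z. (x, z)" and g = "\<lambda>z. green0 (fst z) (snd z)"])
       (auto intro!: continuous_intros)
  then have "isCont (\<lambda>z. green0 x z) y" by simp
  then obtain d where d: "0 < d" "\<And>z. dist z y < d \<Longrightarrow> dist (green0 x z) (green0 x y) < e"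
    using e unfolding continuous_at_eps_delta by blast
  have "eventually (\<lambda>n. bump_radius n y < d) sequentially"
    using order_tendstoD(2)[OF bump_radius_tendsto d(1)] .
  then show "eventually (\<lambda>n. ennreal (green0 x y - e) \<le> green_avg n x y \<and> green_avg n x y \<le> ennreal (green0 x y + e)) sequentially"
  proof eventually_elim
    case (elim n)
    have rm: "(\<lambda>z. ennreal (bump n y z)) \<in> borel_measurable Leb"
      by (intro measurable_of_borel[OF id_measurable] measurable_compose[OF bump_measurable1]) auto
    have near: "\<bar>green0 x z - green0 x y\<bar> \<le> e" if "dist y z < bump_radius n y" for z
      using d(2)[of z] that elim by (simp add: dist_commute dist_real_def)
    have c: "(\<integral>\<^sup>+z. ennreal c * ennreal (bump n y z) \<partial>Leb) = ennreal c" for c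
      by (subst nn_integral_cmult[OF rm]) (simp add: bump_total[OF y])
    have "(\<integral>\<^sup>+z. ennreal (green0 x y - e) * ennreal (bump n y z) \<partial>Leb) \<le> green_avg n x y"
      unfolding green_avg_def
    proof (rule nn_integral_mono)
      fix z
      show "ennreal (green0 x y - e) * ennreal (bump n y z) \<le> ennreal (green0 x z) * ennreal (bump n y z)"
        using near[of z] by (cases "dist y z < bump_radius n y") (auto simp: bump_def[of n y z] intro!: mult_right_mono ennreal_leI)
    qed
    moreover have "green_avg n x y \<le> (\<integral>\<^sup>+z. ennreal (green0 x y + e) * ennreal (bump n y z) \<partial>Leb)"
      unfolding green_avg_def
    proof (rule nn_integral_mono)
      fix z
      show "ennreal (green0 x z) * ennreal (bump n y z) \<le> ennreal (green0 x y + e) * ennreal (bump n y z)"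
        using near[of z] by (cases "dist y z < bump_radius n y") (auto simp: bump_def[of n y z] intro!: mult_right_mono ennreal_leI)
    qed
    ultimately show ?case unfolding c by blast
  qed
qed

section \<open>Mollified measures and their potentials\<close>

text \<open>The radius depends on the source point \<open>y\<close>, not on \<open>z\<close>: every
  point mass is spread inside the domain and keeps its mass. Convolution with one fixed kernel would
  lose mass across the boundary.\<close>

definition mollify_nn :: "nat \<Rightarrow> 'a measure \<Rightarrow> 'a \<Rightarrow> ennreal" where
  "mollify_nn n P z = (\<integral>\<^sup>+y. ennreal (bump n y z) \<partial>P)"

definition mollify :: "nat \<Rightarrow> 'a measure \<Rightarrow> 'a \<Rightarrow> real" where
  "mollify n P z = enn2real (mollify_nn n P z)"

lemma mollify_nonneg: "0 \<le> mollify n P z"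
  by (simp add: mollify_def)

lemma bump_ennreal_measurable:
  assumes P: "admissible P"
  shows "(\<lambda>w. ennreal (bump n (fst w) (snd w))) \<in> borel_measurable (P \<Otimes>\<^sub>M Leb)"
    "(\<lambda>w. ennreal (bump n (snd w) (fst w))) \<in> borel_measurable (Leb \<Otimes>\<^sub>M P)"
proof -
  show m: "(\<lambda>w. ennreal (bump n (fst w) (snd w))) \<in> borel_measurable (P \<Otimes>\<^sub>M Leb)"
    by (intro measurable_compose[OF measurable_of_borel_pair[OF admissible_id[OF P] id_measurable bump_measurable]]) auto
  show "(\<lambda>w. ennreal (bump n (snd w) (fst w))) \<in> borel_measurable (Leb \<Otimes>\<^sub>M P)"
    using measurable_compose[OF measurable_pair_swap' m] by (simp add: split_beta')
qed

lemma mollify_nn_measurable: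
  assumes P: "admissible P"
  shows "mollify_nn n P \<in> borel_measurable Leb"
proof -
  interpret QP: sigma_finite_measure P by (rule admissible_sigma_finite[OF P])
  show ?thesis
    unfolding mollify_nn_def[abs_def]
    using QP.borel_measurable_nn_integral_fst[OF bump_ennreal_measurable(2)[OF P]] by simp
qed

lemma mollify_nn_fubini:
  assumes P: "admissible P" and h: "h \<in> borel_measurable Leb"
  shows "(\<integral>\<^sup>+z. h z * mollify_nn n P z \<partial>Leb) = (\<integral>\<^sup>+y. (\<integral>\<^sup>+z. h z * ennreal (bump n y z) \<partial>Leb) \<partial>P)"
    and "(\<lambda>y. \<integral>\<^sup>+z. h z * ennreal (bump n y z) \<partial>Leb) \<in> borel_measurable P"
proof -
  have sf: "sigma_finite_measure Leb" by unfold_locales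
  interpret QP: sigma_finite_measure P by (rule admissible_sigma_finite[OF P])
  interpret pair_sigma_finite P "Leb" ..
  have m: "(\<lambda>w. h (snd w) * ennreal (bump n (fst w) (snd w))) \<in> borel_measurable (P \<Otimes>\<^sub>M Leb)"
    by (intro borel_measurable_times_ennreal bump_ennreal_measurable P measurable_compose[OF measurable_snd h])
  have "(\<integral>\<^sup>+z. h z * mollify_nn n P z \<partial>Leb) = (\<integral>\<^sup>+z. (\<integral>\<^sup>+y. h z * ennreal (bump n y z) \<partial>P) \<partial>Leb)"
  proof (rule nn_integral_cong)
    fix z
    have r: "(\<lambda>y. ennreal (bump n y z)) \<in> borel_measurable P"
      by (rule measurable_of_borel[OF admissible_id[OF P]])
         (use measurable_compose[OF measurable_Pair2' bump_measurable, of z n] in auto)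
    show "h z * mollify_nn n P z = (\<integral>\<^sup>+y. h z * ennreal (bump n y z) \<partial>P)"
      unfolding mollify_nn_def by (rule nn_integral_cmult[OF r, symmetric])
  qed
  also have "\<dots> = (\<integral>\<^sup>+y. (\<integral>\<^sup>+z. h z * ennreal (bump n y z) \<partial>Leb) \<partial>P)"
    using Fubini[OF m] by simp
  finally show "(\<integral>\<^sup>+z. h z * mollify_nn n P z \<partial>Leb) = (\<integral>\<^sup>+y. (\<integral>\<^sup>+z. h z * ennreal (bump n y z) \<partial>Leb) \<partial>P)" .
  show "(\<lambda>y. \<integral>\<^sup>+z. h z * ennreal (bump n y z) \<partial>Leb) \<in> borel_measurable P"
    using sigma_finite_measure.borel_measurable_nn_integral_fst[OF sf m] by simp
qed

lemma mollify_nn_weighted: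
  assumes P: "admissible P"
  shows "(\<integral>\<^sup>+z. ennreal (weight z) * mollify_nn n P z \<partial>Leb) < \<infinity>"
proof -
  have wm: "(\<lambda>z. ennreal (weight z)) \<in> borel_measurable Leb"
    by (rule measurable_of_borel[OF id_measurable weight_ennreal_measurable])
  have "(\<integral>\<^sup>+z. ennreal (weight z) * mollify_nn n P z \<partial>Leb)
      = (\<integral>\<^sup>+y. (\<integral>\<^sup>+z. ennreal (weight z) * ennreal (bump n y z) \<partial>Leb) \<partial>P)"
    by (rule mollify_nn_fubini[OF P wm])
  also have "\<dots> \<le> (\<integral>\<^sup>+y. ennreal (2 powr \<gamma>) * ennreal (weight y) \<partial>P)"
  proof (rule nn_integral_mono)
    fix y assume "y \<in> space P"
    then have y: "y \<in> \<Omega>" using P by (simp add: admissible_def)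
    have rm: "(\<lambda>z. ennreal (bump n y z)) \<in> borel_measurable Leb"
      by (intro measurable_of_borel[OF id_measurable] measurable_compose[OF bump_measurable1]) auto
    have "(\<integral>\<^sup>+z. ennreal (weight z) * ennreal (bump n y z) \<partial>Leb)
        \<le> (\<integral>\<^sup>+z. ennreal (2 powr \<gamma> * weight y) * ennreal (bump n y z) \<partial>Leb)"
    proof (rule nn_integral_mono)
      fix z
      show "ennreal (weight z) * ennreal (bump n y z) \<le> ennreal (2 powr \<gamma> * weight y) * ennreal (bump n y z)"
        using weight_ball_le[of y z n] by (cases "dist y z < bump_radius n y") (auto simp: bump_def[of n y z] intro!: mult_right_mono ennreal_leI)
    qed
    also have "\<dots> = ennreal (2 powr \<gamma>) * ennreal (weight y)"
      by (subst nn_integral_cmult[OF rm]) (simp add: bump_total[OF y] ennreal_mult weight_nonneg)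
    finally show "(\<integral>\<^sup>+z. ennreal (weight z) * ennreal (bump n y z) \<partial>Leb) \<le> ennreal (2 powr \<gamma>) * ennreal (weight y)" .
  qed
  also have "\<dots> = ennreal (2 powr \<gamma>) * (\<integral>\<^sup>+y. ennreal (weight y) \<partial>P)"
    by (intro nn_integral_cmult measurable_of_borel[OF admissible_id[OF P] weight_ennreal_measurable])
  also have "\<dots> < \<infinity>" using P by (auto simp: admissible_def ennreal_mult_less_top)
  finally show ?thesis .
qed

text \<open>\<open>mollify_nn\<close> may be infinite at some points. Weighted integrability and the
  positivity of the weight confine them to a null set, so passing to real values loses
  nothing.\<close>

lemma mollify_nn_eq_mol:
  assumes P: "admissible P"
  shows "AE z in Leb. mollify_nn n P z = ennreal (mollify n P z)"
proof -
  have "(\<lambda>z. ennreal (weight z) * mollify_nn n P z) \<in> borel_measurable Leb"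
    by (intro borel_measurable_times_ennreal mollify_nn_measurable P measurable_of_borel[OF id_measurable weight_ennreal_measurable])
  then have "AE z in Leb. ennreal (weight z) * mollify_nn n P z \<noteq> \<infinity>"
    using mollify_nn_weighted[OF P, of n] by (intro nn_integral_noteq_infinite) auto
  then show ?thesis using AE_space
  proof eventually_elim
    case (elim z)
    then have "mollify_nn n P z \<noteq> \<infinity>" using weight_pos[of z] by (auto simp: ennreal_mult_top)
    then show ?case by (simp add: mollify_def less_top)
  qed
qed

lemma mollify_measurable: "admissible P \<Longrightarrow> mollify n P \<in> borel_measurable Leb"
  unfolding mollify_def[abs_def] using mollify_nn_measurable[of P n] by measurable

lemma mollify_L1_weighted:
  assumes P: "admissible P"
  shows "mollify n P \<in> L1_weighted \<Omega> \<gamma>"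
proof -
  have "(\<integral>\<^sup>+z. ennreal (norm (\<bar>mollify n P z\<bar> * weight z)) \<partial>Leb)
      = (\<integral>\<^sup>+z. ennreal (weight z) * mollify_nn n P z \<partial>Leb)"
    using mollify_nn_eq_mol[OF P, of n]
    by (intro nn_integral_cong_AE, eventually_elim) (simp add: mollify_nonneg weight_nonneg ennreal_mult mult.commute)
  also have "\<dots> < \<infinity>" by (rule mollify_nn_weighted[OF P])
  finally have "integrable Leb (\<lambda>z. \<bar>mollify n P z\<bar> * weight z)"
    using mollify_measurable[OF P, of n] weight_measurable_dom by (intro integrableI_bounded) auto
  then show ?thesis using mollify_measurable[OF P] by (simp add: L1_weighted_iff)
qed

lemma green_pot_mol:
  assumes P: "admissible P"
  shows "green_pot (mollify n P) x = enn2real (\<integral>\<^sup>+y. green_avg n x y \<partial>P)"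
proof -
  have Gm: "green0 x \<in> borel_measurable Leb"
    by (rule measurable_of_borel[OF id_measurable green0_measurable1])
  have Gm': "(\<lambda>z. ennreal (green0 x z)) \<in> borel_measurable Leb" using Gm by measurable
  have "green_pot (mollify n P) x = enn2real (\<integral>\<^sup>+z. ennreal (green0 x z * mollify n P z) \<partial>Leb)"
    unfolding green_pot_def
    by (intro integral_eq_nn_integral borel_measurable_times Gm mollify_measurable P)
       (simp add: green0_nonneg mollify_nonneg)
  also have "(\<integral>\<^sup>+z. ennreal (green0 x z * mollify n P z) \<partial>Leb) = (\<integral>\<^sup>+z. ennreal (green0 x z) * mollify_nn n P z \<partial>Leb)"
    using mollify_nn_eq_mol[OF P, of n]
    by (intro nn_integral_cong_AE, eventually_elim) (simp add: mollify_nonneg green0_nonneg ennreal_mult)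
  also have "\<dots> = (\<integral>\<^sup>+y. green_avg n x y \<partial>P)" unfolding green_avg_def by (rule mollify_nn_fubini(1)[OF P Gm'])
  finally show ?thesis .
qed

lemma green_avg_measurable:
  assumes "admissible P"
  shows "green_avg n x \<in> borel_measurable P"
proof -
  have "(\<lambda>z. ennreal (green0 x z)) \<in> borel_measurable borel" using green0_measurable1[of x] by measurable
  then show ?thesis
    unfolding green_avg_def[abs_def] by (rule mollify_nn_fubini(2)[OF assms measurable_of_borel[OF id_measurable]])
qed

lemma riesz_pot_kernel_measurable1:
  assumes "admissible P"
  shows "(\<lambda>y. riesz_top x y * ennreal (weight y)) \<in> borel_measurable P"
  by (rule measurable_of_borel[OF admissible_id[OF assms]])
     (intro borel_measurable_times_ennreal riesz_top_measurable1 weight_ennreal_measurable)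

definition mollify_bound :: "'a measure \<Rightarrow> 'a \<Rightarrow> real" where
  "mollify_bound P x = mollify_const * enn2real (riesz_pot P x)"

lemma mollify_bound_integrable: "admissible P \<Longrightarrow> integrable Leb (mollify_bound P)"
  unfolding mollify_bound_def[abs_def] by (intro integrable_mult_right riesz_pot_integrable)

lemma green_pot_mol_bound:
  assumes P: "admissible P" and x: "x \<in> \<Omega>" and fin: "riesz_pot P x < \<infinity>"
  shows "\<bar>green_pot (mollify n P) x\<bar> * weight x \<le> mollify_bound P x"
proof -
  have sp: "space P = \<Omega>" using P by (simp add: admissible_def)
  have c: "0 \<le> mollify_const / weight x" using mollify_const_pos weight_nonneg by simp
  have "(\<integral>\<^sup>+y. green_avg n x y \<partial>P) \<le> (\<integral>\<^sup>+y. ennreal (mollify_const / weight x) * (riesz_top x y * ennreal (weight y)) \<partial>P)"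
    using sp by (intro nn_integral_mono green_avg_bound x) auto
  also have "\<dots> = ennreal (mollify_const / weight x) * riesz_pot P x"
    unfolding riesz_pot_def by (intro nn_integral_cmult riesz_pot_kernel_measurable1 P)
  finally have "enn2real (\<integral>\<^sup>+y. green_avg n x y \<partial>P) \<le> enn2real (ennreal (mollify_const / weight x) * riesz_pot P x)"
    using fin by (intro enn2real_mono) (auto simp: ennreal_mult_less_top)
  also have "\<dots> = mollify_const / weight x * enn2real (riesz_pot P x)" using c by (simp add: enn2real_mult)
  finally have "\<bar>green_pot (mollify n P) x\<bar> \<le> mollify_const / weight x * enn2real (riesz_pot P x)" by (simp add: green_pot_mol[OF P])
  then show ?thesis using weight_pos[OF x] by (simp add: mollify_bound_def field_simps)
qed

text \<open>Dominated convergence with respect to \<open>P\<close>. The averages converge only for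
  \<open>y \<noteq> x\<close>, but a finite Riesz potential at \<open>x\<close> excludes an atom
  there.\<close>

lemma green_pot_mol_tendsto:
  assumes G2: "cond_G2 \<Omega> G" and P: "admissible P" and x: "x \<in> \<Omega>" and fin: "riesz_pot P x < \<infinity>"
  shows "(\<lambda>n. green_pot (mollify n P) x) \<longlonglongrightarrow> (\<integral>y. green0 x y \<partial>P)"
proof -
  have sp: "space P = \<Omega>" using P by (simp add: admissible_def)
  have "(\<lambda>n. \<integral>\<^sup>+y. green_avg n x y \<partial>P) \<longlonglongrightarrow> (\<integral>\<^sup>+y. ennreal (green0 x y) \<partial>P)"
  proof (rule nn_integral_dominated_convergence)
    show "(\<lambda>y. ennreal (green0 x y)) \<in> borel_measurable P"
      by (intro measurable_of_borel[OF admissible_id[OF P]] measurable_compose[OF green0_measurable1]) auto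
    show "(\<lambda>y. ennreal (mollify_const / weight x) * (riesz_top x y * ennreal (weight y))) \<in> borel_measurable P"
      by (intro borel_measurable_times_ennreal borel_measurable_const riesz_pot_kernel_measurable1 P)
    have "(\<integral>\<^sup>+y. ennreal (mollify_const / weight x) * (riesz_top x y * ennreal (weight y)) \<partial>P) = ennreal (mollify_const / weight x) * riesz_pot P x"
      unfolding riesz_pot_def by (intro nn_integral_cmult riesz_pot_kernel_measurable1 P)
    then show "(\<integral>\<^sup>+y. ennreal (mollify_const / weight x) * (riesz_top x y * ennreal (weight y)) \<partial>P) < \<infinity>"
      using fin by (auto simp: ennreal_mult_less_top)
    show "AE y in P. green_avg n x y \<le> ennreal (mollify_const / weight x) * (riesz_top x y * ennreal (weight y))" for n
      using sp by (intro AE_I2 green_avg_bound x) auto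
    show "AE y in P. (\<lambda>n. green_avg n x y) \<longlonglongrightarrow> ennreal (green0 x y)"
      using riesz_pot_AE_neq[OF P x fin] AE_space
    proof eventually_elim
      case (elim y)
      then show ?case unfolding sp by (intro green_avg_tendsto[OF G2 x]) auto
    qed
  qed (rule green_avg_measurable[OF P])
  moreover have e: "(\<integral>\<^sup>+y. ennreal (green0 x y) \<partial>P) = ennreal (\<integral>y. green0 x y \<partial>P)"
    by (intro nn_integral_eq_integral green0_integrable P x fin) (simp add: green0_nonneg)
  ultimately have "(\<lambda>n. enn2real (\<integral>\<^sup>+y. green_avg n x y \<partial>P)) \<longlonglongrightarrow> enn2real (ennreal (\<integral>y. green0 x y \<partial>P))"
    by (intro tendsto_enn2real) auto
  then show ?thesis by (simp add: green_pot_mol[OF P] green0_nonneg)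
qed

end

subsection \<open>Approximation of the sign function\<close>

text \<open>Subtracting \<open>e\<close> normalises the value at 0 to 0, as \<open>kato_pair\<close>
  demands; the derivative is \<open>smooth_sgn\<close>.\<close>

definition smooth_abs :: "real \<Rightarrow> real \<Rightarrow> real" where
  "smooth_abs e t = sqrt (t\<^sup>2 + e\<^sup>2) - e"

definition smooth_sgn :: "real \<Rightarrow> real \<Rightarrow> real" where
  "smooth_sgn e t = t / sqrt (t\<^sup>2 + e\<^sup>2)"

lemma sqrt_add_square_pos: "0 < e \<Longrightarrow> 0 < sqrt (t\<^sup>2 + e\<^sup>2)" for e t :: real
  by (simp add: add_nonneg_pos)

lemma smooth_sgn_abs_le: "0 < e \<Longrightarrow> \<bar>smooth_sgn e t\<bar> \<le> 1"
proof -
  assume e: "0 < e"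
  have "\<bar>t\<bar> = sqrt (t\<^sup>2)" by simp
  also have "\<dots> \<le> sqrt (t\<^sup>2 + e\<^sup>2)" by (intro real_sqrt_le_mono) simp
  finally show ?thesis using sqrt_add_square_pos[OF e, of t]
    by (simp add: smooth_sgn_def abs_divide)
qed

text \<open>Cauchy-Schwarz for the plane vectors \<open>(a, e)\<close> and \<open>(b, e)\<close>
  gives \<open>a b + e^2 \<le> A D\<close>. Subtracted from \<open>A^2 = a^2 + e^2\<close> this is
  \<open>A (A - D) \<le> a (a - b)\<close>.\<close>

lemma smooth_abs_subgradient:
  assumes e: "0 < e"
  shows "smooth_abs e a - smooth_abs e b \<le> smooth_sgn e a * (a - b)"
proof -
  define A where "A = sqrt (a\<^sup>2 + e\<^sup>2)"
  define D where "D = sqrt (b\<^sup>2 + e\<^sup>2)"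
  have A: "0 < A" "A * A = a\<^sup>2 + e\<^sup>2" and D: "0 < D"
    using sqrt_add_square_pos[OF e] by (auto simp: A_def D_def)
  have "a * b + e\<^sup>2 \<le> sqrt ((a * b + e\<^sup>2)\<^sup>2)" by simp
  also have "\<dots> \<le> sqrt ((a\<^sup>2 + e\<^sup>2) * (b\<^sup>2 + e\<^sup>2))"
  proof (rule real_sqrt_le_mono)
    have "(a\<^sup>2 + e\<^sup>2) * (b\<^sup>2 + e\<^sup>2) - (a * b + e\<^sup>2)\<^sup>2 = (e * (a - b))\<^sup>2"
      by (simp add: power2_eq_square algebra_simps)
    then show "(a * b + e\<^sup>2)\<^sup>2 \<le> (a\<^sup>2 + e\<^sup>2) * (b\<^sup>2 + e\<^sup>2)" by (metis diff_ge_0_iff_ge zero_le_power2)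
  qed
  also have "\<dots> = A * D" by (simp add: A_def D_def real_sqrt_mult)
  finally have "A * (A - D) \<le> a * (a - b)" using A(2) by (simp add: algebra_simps power2_eq_square)
  then have "A - D \<le> a / A * (a - b)" using A(1) by (simp add: field_simps)
  then show ?thesis by (simp add: smooth_abs_def smooth_sgn_def A_def D_def)
qed

lemma smooth_sgn_lipschitz:
  assumes e: "0 < e"
  shows "\<bar>smooth_sgn e a - smooth_sgn e b\<bar> \<le> 2 / e * \<bar>a - b\<bar>"
proof -
  define A where "A = sqrt (a\<^sup>2 + e\<^sup>2)"
  define D where "D = sqrt (b\<^sup>2 + e\<^sup>2)"
  have A: "0 < A" and D: "0 < D" using sqrt_add_square_pos[OF e] by (auto simp: A_def D_def)
  have eD: "e \<le> D"
  proof -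
    have "e = sqrt (e\<^sup>2)" using e by simp
    also have "\<dots> \<le> D" unfolding D_def by (intro real_sqrt_le_mono) simp
    finally show ?thesis .
  qed
  \<comment> \<open>The subgradient inequality in both directions, with slopes of modulus at most
    1.\<close>
  have AD: "\<bar>D - A\<bar> \<le> \<bar>a - b\<bar>"
  proof -
    have "smooth_abs e s - smooth_abs e t \<le> \<bar>s - t\<bar>" for s t
    proof -
      have "smooth_sgn e s * (s - t) \<le> \<bar>smooth_sgn e s\<bar> * \<bar>s - t\<bar>" by (metis abs_ge_self abs_mult)
      also have "\<dots> \<le> 1 * \<bar>s - t\<bar>" by (intro mult_right_mono smooth_sgn_abs_le e) auto
      finally show ?thesis using smooth_abs_subgradient[OF e, of s t] by simp
    qed
    from this[of a b] this[of b a] show ?thesis unfolding smooth_abs_def A_def D_def by linarith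
  qed
  \<comment> \<open>Each of the two terms is at most \<open>\<bar>a - b\<bar> / e\<close>, whence
    the constant \<open>2 / e\<close>.\<close>
  have "smooth_sgn e a - smooth_sgn e b = (a / A) * ((D - A) / D) + (a - b) / D"
    using A D by (simp add: smooth_sgn_def A_def[symmetric] D_def[symmetric] field_simps)
  then have "\<bar>smooth_sgn e a - smooth_sgn e b\<bar> \<le> \<bar>a / A\<bar> * (\<bar>D - A\<bar> / D) + \<bar>a - b\<bar> / D"
    using D abs_triangle_ineq[of "(a / A) * ((D - A) / D)" "(a - b) / D"] by (simp add: abs_mult abs_divide)
  also have "\<dots> \<le> 1 * (\<bar>a - b\<bar> / e) + \<bar>a - b\<bar> / e"
    using smooth_sgn_abs_le[OF e, of a] AD eD e D
    by (intro add_mono mult_mono frac_le) (auto simp: smooth_sgn_def A_def)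
  finally show ?thesis by (simp add: field_simps)
qed

lemma smooth_sgn_nonneg: "0 \<le> t \<Longrightarrow> 0 \<le> smooth_sgn e t"
  by (simp add: smooth_sgn_def)

lemma kato_pair_smooth_abs: "0 < e \<Longrightarrow> kato_pair (smooth_sgn e) (smooth_abs e)"
  unfolding kato_pair_def
  by (intro conjI exI[of _ "2 / e"] allI smooth_sgn_lipschitz smooth_sgn_abs_le smooth_abs_subgradient)
     (simp_all add: smooth_abs_def)

text \<open>Convexity survives composition with \<open>max t 0\<close> because \<open>p\<close> is
  nonnegative on the half line; for \<open>a < 0\<close> the slope vanishes by
  \<open>p 0 = 0\<close>.\<close>

lemma kato_pair_pos_part:
  assumes k: "kato_pair p P" and p: "\<And>t. 0 \<le> t \<Longrightarrow> 0 \<le> p t" "p 0 = 0"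
  shows "kato_pair (\<lambda>t. p (max t 0)) (\<lambda>t. P (max t 0))"
proof -
  obtain L where L: "\<And>a b. \<bar>p a - p b\<bar> \<le> L * \<bar>a - b\<bar>" using k by (auto simp: kato_pair_def)
  have "\<bar>p (max a 0) - p (max b 0)\<bar> \<le> \<bar>L\<bar> * \<bar>a - b\<bar>" for a b
  proof -
    have "\<bar>p (max a 0) - p (max b 0)\<bar> \<le> L * \<bar>max a 0 - max b 0\<bar>" by (rule L)
    also have "\<dots> \<le> \<bar>L\<bar> * \<bar>a - b\<bar>" by (intro mult_mono) auto
    finally show ?thesis .
  qed
  moreover have "P (max a 0) - P (max b 0) \<le> p (max a 0) * (a - b)" for a b
  proof (cases "0 \<le> a")
    case True
    have "P (max a 0) - P (max b 0) \<le> p (max a 0) * (max a 0 - max b 0)"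
      using k by (simp add: kato_pair_def)
    also have "\<dots> \<le> p (max a 0) * (a - b)" using True by (intro mult_left_mono p) auto
    finally show ?thesis .
  next
    case False
    have "P 0 - P (max b 0) \<le> p 0 * (0 - max b 0)" using k unfolding kato_pair_def by blast
    then show ?thesis using False p(2) by simp
  qed
  ultimately show ?thesis using k by (auto simp: kato_pair_def)
qed

lemma smooth_abs_tendsto: "(\<lambda>n. smooth_abs (1 / real (Suc n)) t) \<longlonglongrightarrow> \<bar>t\<bar>"
proof -
  have "(\<lambda>n. sqrt (t\<^sup>2 + (1 / real (Suc n))\<^sup>2) - 1 / real (Suc n)) \<longlonglongrightarrow> sqrt (t\<^sup>2 + 0\<^sup>2) - 0"
    by (intro tendsto_intros LIMSEQ_Suc[OF lim_const_over_n])
  then show ?thesis by (simp add: smooth_abs_def)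
qed

lemma smooth_sgn_tendsto: "(\<lambda>n. smooth_sgn (1 / real (Suc n)) t) \<longlonglongrightarrow> sgn t"
proof (cases "t = 0")
  case False
  have "(\<lambda>n. t / sqrt (t\<^sup>2 + (1 / real (Suc n))\<^sup>2)) \<longlonglongrightarrow> t / sqrt (t\<^sup>2 + 0\<^sup>2)"
    using False by (intro tendsto_intros LIMSEQ_Suc[OF lim_const_over_n]) auto
  then show ?thesis using False by (simp add: smooth_sgn_def real_sgn_eq)
qed (simp add: smooth_sgn_def)

section \<open>Mollified measures tested with the potential of \<xi>\<close>

context green_kernel
begin

lemma potential_measurable:
  assumes P: "admissible P"
  shows "(\<lambda>x. \<integral>y. green0 x y \<partial>P) \<in> borel_measurable Leb"
proof -
  interpret QP: sigma_finite_measure P by (rule admissible_sigma_finite[OF P])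
  have "(\<lambda>z. green0 (fst z) (snd z)) \<in> borel_measurable (Leb \<Otimes>\<^sub>M P)"
    by (rule measurable_of_borel_pair[OF id_measurable admissible_id[OF P] green0_measurable])
  then show ?thesis by (intro QP.borel_measurable_lebesgue_integral) (simp add: split_beta')
qed

lemma mollify_integral_eq:
  assumes P: "admissible P" and \<xi>: "\<xi> \<in> weighted_Linf \<Omega> \<gamma>"
  shows "(\<integral>x. mollify n P x * green_pot \<xi> x \<partial>Leb) = (\<integral>x. green_pot (mollify n P) x * \<xi> x \<partial>Leb)"
proof -
  have \<xi>m: "\<xi> \<in> borel_measurable Leb" using weighted_LinfD[OF \<xi>] by blast
  note m = mollify_measurable[OF P, of n]
  have abs_density: "(\<integral>y. h y \<partial>abs_density (mollify n P)) = (\<integral>y. mollify n P y * h y \<partial>Leb)"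
    if "h \<in> borel_measurable borel" for h :: "'a \<Rightarrow> real"
  proof -
    have "(\<integral>y. h y \<partial>abs_density (mollify n P)) = (\<integral>y. \<bar>mollify n P y\<bar> * h y \<partial>Leb)"
      unfolding abs_density_def
      by (rule integral_real_density) (use m measurable_of_borel[OF id_measurable that] in auto)
    then show ?thesis by (simp add: mollify_nonneg)
  qed
  have "(\<integral>x. (\<integral>y. green0 x y \<partial>abs_density (mollify n P)) * \<xi> x \<partial>Leb) = (\<integral>y. green_pot \<xi> y \<partial>abs_density (mollify n P))"
    by (rule green_pot_duality(1)[OF admissible_dens[OF mollify_L1_weighted[OF P]] \<xi>])
  then show ?thesis
    by (simp add: abs_density green0_measurable1 green_pot_measurable[OF \<xi>m] green_pot_def[of "mollify n P"] mult.commute)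
qed

text \<open>Both ends are rewritten by duality. The limit then concerns potentials integrated
  against \<open>\<xi>\<close>, which converge almost everywhere under an integrable majorant,
  instead of measures tested with \<open>green_pot \<xi>\<close>.\<close>

lemma mollify_integral_tendsto:
  assumes G2: "cond_G2 \<Omega> G" and P: "admissible P" and \<xi>: "\<xi> \<in> weighted_Linf \<Omega> \<gamma>"
  shows "(\<lambda>n. \<integral>x. mollify n P x * green_pot \<xi> x \<partial>Leb) \<longlonglongrightarrow> (\<integral>y. green_pot \<xi> y \<partial>P)"
proof -
  have good: "AE x in Leb. x \<in> \<Omega> \<and> riesz_pot P x < \<infinity>"
    using riesz_pot_finite_AE[OF P] AE_space by eventually_elim simp
  have lim: "AE x in Leb. (\<lambda>n. green_pot (mollify n P) x) \<longlonglongrightarrow> (\<integral>y. green0 x y \<partial>P)"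
    using good by eventually_elim (intro green_pot_mol_tendsto[OF G2 P], auto)
  have b: "AE x in Leb. \<bar>green_pot (mollify n P) x\<bar> * weight x \<le> mollify_bound P x" for n
    using good by eventually_elim (intro green_pot_mol_bound[OF P], auto)
  have "(\<lambda>n. \<integral>x. green_pot (mollify n P) x * \<xi> x \<partial>Leb) \<longlonglongrightarrow> (\<integral>x. (\<integral>y. green0 x y \<partial>P) * \<xi> x \<partial>Leb)"
    by (rule tendsto_integral_weighted[OF \<xi> _ _ lim mollify_bound_integrable[OF P] b])
       (intro potential_measurable P measurable_of_borel[OF id_measurable green_pot_measurable[OF mollify_measurable[OF P]]])+
  then show ?thesis by (simp add: mollify_integral_eq[OF P \<xi>] green_pot_duality(1)[OF P \<xi>])
qed

lemma mult_GO_integrable: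
  assumes f: "f \<in> L1_weighted \<Omega> \<gamma>" and \<xi>: "\<xi> \<in> weighted_Linf \<Omega> \<gamma>"
    and q: "q \<in> borel_measurable Leb" "\<And>x. \<bar>q x\<bar> \<le> 1"
  shows "integrable Leb (\<lambda>x. q x * f x * green_pot \<xi> x)"
proof -
  obtain W where W: "0 \<le> W" "\<xi> \<in> borel_measurable Leb"
    "AE x in Leb. \<bar>\<xi> x\<bar> \<le> W * weight x" using weighted_LinfD[OF \<xi>] .
  have "integrable Leb (\<lambda>x. f x * (q x * green_pot \<xi> x))"
  proof (rule L1_weighted_mult_integrable[OF f])
    show "(\<lambda>x. q x * green_pot \<xi> x) \<in> borel_measurable Leb"
      by (intro borel_measurable_times q measurable_of_borel[OF id_measurable green_pot_measurable[OF W(2)]])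
    show "\<bar>q x * green_pot \<xi> x\<bar> \<le> (W * green_const * riesz_const) * weight x" if "x \<in> \<Omega>" for x
    proof -
      have "\<bar>q x * green_pot \<xi> x\<bar> \<le> 1 * \<bar>green_pot \<xi> x\<bar>" unfolding abs_mult by (intro mult_right_mono q) auto
      then show ?thesis using green_pot_weighted_bound[OF W(2) W(1) W(3) that] by simp
    qed
  qed
  then show ?thesis by (simp add: mult_ac)
qed

end

section \<open>Measure data with a smoothed sign\<close>

context green_kato
begin

text \<open>\<open>kato_L1\<close> is applied to \<open>f\<close> plus the mollified
  \<open>P\<close> minus the mollified \<open>N\<close>. As the potential of \<open>\<xi>\<close> is
  nonnegative, \<open>p \<le> 1\<close> handles the \<open>P\<close> term, and
  \<open>-p \<le> c\<close> makes the \<open>N\<close> term cost at most \<open>c\<close> times its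
  integral.\<close>

lemma kato_measure_smooth:
  assumes G2: "cond_G2 \<Omega> G" and f: "f \<in> L1_weighted \<Omega> \<gamma>"
    and P: "admissible P" and N: "admissible N" and \<xi>: "\<xi> \<in> weighted_Linf \<Omega> \<gamma>"
    and pos: "AE x in Leb. 0 \<le> green_pot \<xi> x"
    and k: "kato_pair p \<Phi>" and c: "\<And>t. - c \<le> p t"
    and u: "\<And>x. u x = green_pot f x + (\<integral>y. green0 x y \<partial>P) - (\<integral>y. green0 x y \<partial>N)"
  shows "(\<integral>x. \<Phi> (u x) * \<xi> x \<partial>Leb)
    \<le> (\<integral>x. p (u x) * f x * green_pot \<xi> x \<partial>Leb) + ((\<integral>x. green_pot \<xi> x \<partial>P) + c * (\<integral>x. green_pot \<xi> x \<partial>N))"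
proof -
  have fm: "f \<in> borel_measurable Leb" using f by (simp add: L1_weighted_iff)
  define fn where "fn n x = f x + mollify n P x - mollify n N x" for n x
  have fnm: "fn n \<in> borel_measurable Leb" for n
    unfolding fn_def[abs_def]
    by (intro borel_measurable_add borel_measurable_diff fm mollify_measurable P N)
  have fn: "fn n \<in> L1_weighted \<Omega> \<gamma>" for n
  proof -
    have "integrable Leb (\<lambda>x. \<bar>f x\<bar> * weight x + \<bar>mollify n P x\<bar> * weight x + \<bar>mollify n N x\<bar> * weight x)"
      using f mollify_L1_weighted[OF P, of n] mollify_L1_weighted[OF N, of n]
      by (intro Bochner_Integration.integrable_add) (auto simp: L1_weighted_iff)
    then have "integrable Leb (\<lambda>x. \<bar>fn n x\<bar> * weight x)"
    proof (rule Bochner_Integration.integrable_bound)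
      show "AE x in Leb. norm (\<bar>fn n x\<bar> * weight x)
          \<le> norm (\<bar>f x\<bar> * weight x + \<bar>mollify n P x\<bar> * weight x + \<bar>mollify n N x\<bar> * weight x)"
      proof (rule AE_I2)
        fix x
        have "\<bar>fn n x\<bar> * weight x \<le> (\<bar>f x\<bar> + \<bar>mollify n P x\<bar> + \<bar>mollify n N x\<bar>) * weight x"
          unfolding fn_def by (intro mult_right_mono weight_nonneg) linarith
        then show "norm (\<bar>fn n x\<bar> * weight x)
          \<le> norm (\<bar>f x\<bar> * weight x + \<bar>mollify n P x\<bar> * weight x + \<bar>mollify n N x\<bar> * weight x)"
          using weight_nonneg[of x] by (simp add: distrib_right abs_mult)
      qed
      show "(\<lambda>x. \<bar>fn n x\<bar> * weight x) \<in> borel_measurable Leb"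
        by (intro borel_measurable_times borel_measurable_abs fnm weight_measurable_dom)
    qed
    then show ?thesis using fnm by (simp add: L1_weighted_iff)
  qed
  \<comment> \<open>One exceptional null set has to serve all \<open>n\<close>; the densities are
    countably many.\<close>
  have fin: "AE x in Leb. \<forall>n. riesz_pot (abs_density (mollify n Q)) x < \<infinity>" if "admissible Q" for Q
    unfolding AE_all_countable by (intro allI riesz_pot_finite_AE admissible_dens mollify_L1_weighted that)
  have good: "AE x in Leb. x \<in> \<Omega> \<and> riesz_pot (abs_density f) x < \<infinity> \<and> riesz_pot P x < \<infinity> \<and> riesz_pot N x < \<infinity> \<and>
      (\<forall>n. riesz_pot (abs_density (mollify n P)) x < \<infinity>) \<and> (\<forall>n. riesz_pot (abs_density (mollify n N)) x < \<infinity>)"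
    using riesz_pot_finite_AE[OF admissible_dens[OF f]] riesz_pot_finite_AE[OF P] riesz_pot_finite_AE[OF N] fin[OF P] fin[OF N] AE_space
    by eventually_elim simp
  have green_pot_fn: "green_pot (fn n) x = green_pot f x + green_pot (mollify n P) x - green_pot (mollify n N) x"
    if "x \<in> \<Omega>" "riesz_pot (abs_density f) x < \<infinity>" "riesz_pot (abs_density (mollify n P)) x < \<infinity>" "riesz_pot (abs_density (mollify n N)) x < \<infinity>" for n x
  proof -
    note i = green0_f_integrable'[OF f that(1,2)] green0_f_integrable'[OF mollify_L1_weighted[OF P] that(1,3)]
      green0_f_integrable'[OF mollify_L1_weighted[OF N] that(1,4)]
    have "green_pot (fn n) x = (\<integral>y. (green0 x y * f y + green0 x y * mollify n P y) - green0 x y * mollify n N y \<partial>Leb)"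
      unfolding green_pot_def fn_def by (simp add: algebra_simps)
    then show ?thesis unfolding green_pot_def using i by simp
  qed
  have lim: "AE x in Leb. (\<lambda>n. green_pot (fn n) x) \<longlonglongrightarrow> u x"
    using good
  proof eventually_elim
    case (elim x)
    have "(\<lambda>n. green_pot f x + green_pot (mollify n P) x - green_pot (mollify n N) x) \<longlonglongrightarrow> u x"
      unfolding u using elim by (intro tendsto_intros green_pot_mol_tendsto[OF G2] P N) auto
    then show ?case using elim by (simp add: green_pot_fn)
  qed
  have bound: "AE x in Leb. \<bar>green_pot (fn n) x\<bar> * weight x \<le> green_bound (abs_density f) x + mollify_bound P x + mollify_bound N x" for n
    using good
  proof eventually_elim
    case (elim x)
    have "\<bar>green_pot (fn n) x\<bar> \<le> \<bar>green_pot f x\<bar> + \<bar>green_pot (mollify n P) x\<bar> + \<bar>green_pot (mollify n N) x\<bar>"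
      using elim by (simp add: green_pot_fn)
    then have "\<bar>green_pot (fn n) x\<bar> * weight x \<le> (\<bar>green_pot f x\<bar> + \<bar>green_pot (mollify n P) x\<bar> + \<bar>green_pot (mollify n N) x\<bar>) * weight x"
      by (rule mult_right_mono[OF _ weight_nonneg])
    also have "\<dots> = \<bar>green_pot f x\<bar> * weight x + \<bar>green_pot (mollify n P) x\<bar> * weight x + \<bar>green_pot (mollify n N) x\<bar> * weight x"
      by (simp add: algebra_simps)
    also have "\<dots> \<le> green_bound (abs_density f) x + mollify_bound P x + mollify_bound N x"
      using elim by (intro add_mono green_pot_bound[OF f _ _ fm] green_pot_mol_bound P N) auto
    finally show ?case .
  qed
  have Gm: "green_pot g \<in> borel_measurable Leb" if "g \<in> borel_measurable Leb" for g
    by (rule measurable_of_borel[OF id_measurable green_pot_measurable[OF that]])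
  note pm = kato_pair_measurable[OF k]
  have p1: "\<bar>p a\<bar> \<le> 1" for a using k by (simp add: kato_pair_def)
  have um: "u \<in> borel_measurable Leb"
    unfolding u[abs_def]
    by (intro borel_measurable_add borel_measurable_diff Gm fm potential_measurable P N)
  have lP: "AE x in Leb. (\<lambda>n. \<Phi> (green_pot (fn n) x)) \<longlonglongrightarrow> \<Phi> (u x)"
    using lim by eventually_elim (rule isCont_tendsto_compose[OF kato_pair_isCont(2)[OF k]])
  have lp: "AE x in Leb. (\<lambda>n. p (green_pot (fn n) x) * f x) \<longlonglongrightarrow> p (u x) * f x"
    using lim by eventually_elim
      (intro tendsto_mult tendsto_const isCont_tendsto_compose[OF kato_pair_isCont(1)[OF k]])
  have l1: "(\<lambda>n. \<integral>x. \<Phi> (green_pot (fn n) x) * \<xi> x \<partial>Leb) \<longlonglongrightarrow> (\<integral>x. \<Phi> (u x) * \<xi> x \<partial>Leb)"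
  proof (rule tendsto_integral_weighted[OF \<xi> _ _ lP])
    show "integrable Leb (\<lambda>x. green_bound (abs_density f) x + mollify_bound P x + mollify_bound N x)"
      by (intro Bochner_Integration.integrable_add green_bound_integrable mollify_bound_integrable admissible_dens f P N)
    show "AE x in Leb. \<bar>\<Phi> (green_pot (fn n) x)\<bar> * weight x \<le> green_bound (abs_density f) x + mollify_bound P x + mollify_bound N x" for n
      using bound[of n]
      by eventually_elim (rule order_trans[OF mult_right_mono[OF kato_pair_abs_le[OF k] weight_nonneg]])
  qed (intro measurable_compose[OF Gm pm(2)] measurable_compose[OF um pm(2)] fnm)+
  have l2: "(\<lambda>n. \<integral>x. p (green_pot (fn n) x) * f x * green_pot \<xi> x \<partial>Leb)
      \<longlonglongrightarrow> (\<integral>x. p (u x) * f x * green_pot \<xi> x \<partial>Leb)"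
  proof (rule tendsto_integral_GO[OF \<xi> _ _ lp f])
    show "\<bar>p (green_pot (fn n) x) * f x\<bar> \<le> \<bar>f x\<bar>" for n x
      using mult_right_mono[OF p1[of "green_pot (fn n) x"], of "\<bar>f x\<bar>"] by (simp add: abs_mult)
  qed (intro borel_measurable_times measurable_compose[OF Gm pm(1)] measurable_compose[OF um pm(1)] fm fnm)+
  have step: "(\<integral>x. \<Phi> (green_pot (fn n) x) * \<xi> x \<partial>Leb)
    \<le> (\<integral>x. p (green_pot (fn n) x) * f x * green_pot \<xi> x \<partial>Leb) +
      ((\<integral>x. mollify n P x * green_pot \<xi> x \<partial>Leb) + c * (\<integral>x. mollify n N x * green_pot \<xi> x \<partial>Leb))" for n
  proof -
    have pGm: "(\<lambda>x. p (green_pot (fn n) x)) \<in> borel_measurable Leb"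
      by (rule measurable_compose[OF Gm[OF fnm] pm(1)])
    have i1: "integrable Leb (\<lambda>x. p (green_pot (fn n) x) * g x * green_pot \<xi> x)" if "g \<in> L1_weighted \<Omega> \<gamma>" for g
      by (intro mult_GO_integrable that \<xi> pGm p1)
    have i2: "integrable Leb (\<lambda>x. mollify n Q x * green_pot \<xi> x)" if "admissible Q" for Q
      using mult_GO_integrable[OF mollify_L1_weighted[OF that] \<xi>, of "\<lambda>_. 1" n] by simp
    have "(\<integral>x. \<Phi> (green_pot (fn n) x) * \<xi> x \<partial>Leb) \<le> (\<integral>x. p (green_pot (fn n) x) * fn n x * green_pot \<xi> x \<partial>Leb)"
      by (rule kato_L1[OF fn \<xi> pos k])
    also have "\<dots> \<le> (\<integral>x. p (green_pot (fn n) x) * f x * green_pot \<xi> x +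
        (mollify n P x * green_pot \<xi> x + c * (mollify n N x * green_pot \<xi> x)) \<partial>Leb)"
    proof (rule integral_mono_AE)
      show "AE x in Leb. p (green_pot (fn n) x) * fn n x * green_pot \<xi> x
        \<le> p (green_pot (fn n) x) * f x * green_pot \<xi> x + (mollify n P x * green_pot \<xi> x + c * (mollify n N x * green_pot \<xi> x))"
        using pos
      proof eventually_elim
        case (elim x)
        have "p (green_pot (fn n) x) \<le> 1" using p1[of "green_pot (fn n) x"] by simp
        then have "p (green_pot (fn n) x) * (mollify n P x * green_pot \<xi> x) \<le> 1 * (mollify n P x * green_pot \<xi> x)"
          using elim by (intro mult_right_mono) (auto simp: mollify_nonneg)
        moreover have "(- c) * (mollify n N x * green_pot \<xi> x) \<le> p (green_pot (fn n) x) * (mollify n N x * green_pot \<xi> x)"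
          using elim by (intro mult_right_mono c) (auto simp: mollify_nonneg)
        ultimately show ?case by (simp add: fn_def algebra_simps)
      qed
    qed (intro i1 fn Bochner_Integration.integrable_add integrable_mult_right i2 f P N)+
    also have "\<dots> = (\<integral>x. p (green_pot (fn n) x) * f x * green_pot \<xi> x \<partial>Leb) +
      ((\<integral>x. mollify n P x * green_pot \<xi> x \<partial>Leb) + c * (\<integral>x. mollify n N x * green_pot \<xi> x \<partial>Leb))"
      using i1[OF f] i2[OF P] i2[OF N] by simp
    finally show ?thesis .
  qed
  have l3: "(\<lambda>n. (\<integral>x. p (green_pot (fn n) x) * f x * green_pot \<xi> x \<partial>Leb) +
      ((\<integral>x. mollify n P x * green_pot \<xi> x \<partial>Leb) + c * (\<integral>x. mollify n N x * green_pot \<xi> x \<partial>Leb)))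
    \<longlonglongrightarrow> (\<integral>x. p (u x) * f x * green_pot \<xi> x \<partial>Leb) + ((\<integral>x. green_pot \<xi> x \<partial>P) + c * (\<integral>x. green_pot \<xi> x \<partial>N))"
    by (intro tendsto_add tendsto_mult tendsto_const l2 mollify_integral_tendsto G2 P N \<xi>)
  show ?thesis by (rule LIMSEQ_le[OF l1 l3]) (use step in blast)
qed

end

section \<open>From smooth approximations to the sign\<close>

context green_kernel
begin

text \<open>\<open>u\<close> stays fixed, only the pair \<open>(p, \<Phi>)\<close> varies.
  \<open>R\<close> collects what does not depend on the pair: 0 for functions, integrals of the
  potential of \<open>\<xi>\<close> for measures.\<close>

lemma kato_sharp_limit:
  assumes f: "f \<in> L1_weighted \<Omega> \<gamma>" and \<xi>: "\<xi> \<in> weighted_Linf \<Omega> \<gamma>"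
    and um: "u \<in> borel_measurable Leb"
    and h: "integrable Leb h" "AE x in Leb. \<bar>u x\<bar> * weight x \<le> h x"
    and k: "\<And>n. kato_pair (p n) (\<Phi> n)"
    and \<sigma>: "\<And>t. (\<lambda>n. p n t) \<longlonglongrightarrow> \<sigma> t" "\<And>t. (\<lambda>n. \<Phi> n t) \<longlonglongrightarrow> Q t"
    and le: "\<And>n. (\<integral>x. \<Phi> n (u x) * \<xi> x \<partial>Leb) \<le> (\<integral>x. p n (u x) * f x * green_pot \<xi> x \<partial>Leb) + R"
  shows "(\<integral>x. Q (u x) * \<xi> x \<partial>Leb) \<le> (\<integral>x. \<sigma> (u x) * f x * green_pot \<xi> x \<partial>Leb) + R"
proof -
  have fm: "f \<in> borel_measurable Leb" using f by (simp add: L1_weighted_iff)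
  have p1: "\<bar>p n a\<bar> \<le> 1" for n a using k[of n] by (simp add: kato_pair_def)
  have mp: "(\<lambda>x. p n (u x)) \<in> borel_measurable Leb"
    "(\<lambda>x. \<Phi> n (u x)) \<in> borel_measurable Leb" for n
    using measurable_compose[OF um kato_pair_measurable(1)[OF k]]
      measurable_compose[OF um kato_pair_measurable(2)[OF k]] by auto
  have ms: "(\<lambda>x. \<sigma> (u x)) \<in> borel_measurable Leb"
    by (rule borel_measurable_LIMSEQ_real[OF _ mp(1)]) (rule \<sigma>)
  have mQ: "(\<lambda>x. Q (u x)) \<in> borel_measurable Leb"
    by (rule borel_measurable_LIMSEQ_real[OF _ mp(2)]) (rule \<sigma>)
  have l1: "(\<lambda>n. \<integral>x. \<Phi> n (u x) * \<xi> x \<partial>Leb) \<longlonglongrightarrow> (\<integral>x. Q (u x) * \<xi> x \<partial>Leb)"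
  proof (rule tendsto_integral_weighted[OF \<xi> mp(2) mQ _ h(1)])
    show "AE x in Leb. \<bar>\<Phi> n (u x)\<bar> * weight x \<le> h x" for n
      using h(2) by eventually_elim (rule order_trans[OF mult_right_mono[OF kato_pair_abs_le[OF k] weight_nonneg]])
  qed (intro AE_I2 \<sigma>)
  have l2: "(\<lambda>n. \<integral>x. p n (u x) * f x * green_pot \<xi> x \<partial>Leb)
      \<longlonglongrightarrow> (\<integral>x. \<sigma> (u x) * f x * green_pot \<xi> x \<partial>Leb)"
  proof (rule tendsto_integral_GO[OF \<xi> _ _ _ f])
    show "\<bar>p n (u x) * f x\<bar> \<le> \<bar>f x\<bar>" for n x
      using mult_right_mono[OF p1[of n "u x"], of "\<bar>f x\<bar>"] by (simp add: abs_mult)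
  qed (intro borel_measurable_times mp ms fm AE_I2 tendsto_mult tendsto_const \<sigma>)+
  show ?thesis
    by (rule LIMSEQ_le[OF l1 tendsto_add[OF l2 tendsto_const]]) (use le in blast)
qed

end

subsection \<open>Exclusion of the order one\<close>

text \<open>The derivative of the rescaled function in direction \<open>v\<close> is the derivative
  of \<open>\<phi>\<close> in direction \<open>t v\<close>, composed with the same affine map.
  Therefore the induction varies \<open>\<phi>\<close>.\<close>

lemma Ck_on_affine:
  fixes \<phi> :: "'a::euclidean_space \<Rightarrow> real"
  assumes "Ck_on k \<phi> UNIV"
  shows "Ck_on k (\<lambda>x. \<phi> (a + t *\<^sub>R (x - p))) UNIV"
  using assms
proof (induction k arbitrary: \<phi>)
  case 0
  have "continuous_on UNIV (\<lambda>x. a + t *\<^sub>R (x - p))" by (intro continuous_intros)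
  then show ?case using 0 continuous_on_compose2[of UNIV \<phi> UNIV "\<lambda>x. a + t *\<^sub>R (x - p)"] by simp
next
  case (Suc k)
  have d: "((\<lambda>x. \<phi> (a + t *\<^sub>R (x - p))) has_derivative
      (\<lambda>v. frechet_derivative \<phi> (at (a + t *\<^sub>R (x - p))) (t *\<^sub>R v))) (at x)" for x
  proof -
    have "(\<phi> has_derivative frechet_derivative \<phi> (at (a + t *\<^sub>R (x - p)))) (at (a + t *\<^sub>R (x - p)))"
      using Suc.prems by (simp add: frechet_derivative_works[symmetric])
    moreover have "((\<lambda>x. a + t *\<^sub>R (x - p)) has_derivative (\<lambda>v. t *\<^sub>R v)) (at x)"
      by (auto intro!: derivative_eq_intros)
    ultimately show ?thesis using has_derivative_compose by blast
  qed
  have e: "frechet_derivative (\<lambda>x. \<phi> (a + t *\<^sub>R (x - p))) (at x) v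
      = frechet_derivative \<phi> (at (a + t *\<^sub>R (x - p))) (t *\<^sub>R v)" for x v
    using frechet_derivative_at[OF d[of x]] by metis
  show ?case
    using Suc.IH[of "\<lambda>x. frechet_derivative \<phi> (at x) (t *\<^sub>R v)" for v] Suc.prems d
    by (auto simp: e differentiable_def)
qed

text \<open>Each directional derivative is continuous and vanishes off a compact set, hence is
  bounded. Expansion in \<open>Basis\<close> bounds the full derivative, and the mean value
  inequality concludes; adding 1 makes the constant positive.\<close>

lemma test_function_lipschitz:
  fixes \<phi> :: "'a::euclidean_space \<Rightarrow> real"
  assumes "\<phi> \<in> test_functions S"
  shows "\<exists>L>0. \<forall>x y. \<bar>\<phi> x - \<phi> y\<bar> \<le> L * norm (x - y)"
proof -
  define K where "K = closure {x. \<phi> x \<noteq> 0}"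
  define D where "D x = frechet_derivative \<phi> (at x)" for x
  have K: "compact K" and C1: "Ck_on (Suc 0) \<phi> UNIV"
    using assms unfolding test_functions_def K_def by blast+
  have d: "(\<phi> has_derivative D x) (at x)" for x
    using C1 by (simp add: D_def frechet_derivative_works[symmetric])
  have c: "continuous_on UNIV (\<lambda>x. D x v)" for v using C1 by (simp add: D_def)
  have z: "D x v = 0" if "x \<notin> K" for x v
  proof -
    have "((\<lambda>x. 0) has_derivative D x) (at x)"
    proof (rule has_derivative_transform_within_open[OF d])
      show "open (- K)" using K by (simp add: compact_imp_closed open_Compl)
      show "x \<in> - K" using that by simp
      show "\<phi> y = 0" if "y \<in> - K" for y
        using that closure_subset[of "{x. \<phi> x \<noteq> 0}"] by (auto simp: K_def)
    qed
    then have "D x = (\<lambda>v. 0)" using has_derivative_unique has_derivative_const by blast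
    then show ?thesis by simp
  qed
  have "\<exists>M\<ge>0. \<forall>x. \<bar>D x v\<bar> \<le> M" for v
  proof -
    have "compact ((\<lambda>x. D x v) ` K)"
      using K c continuous_on_subset by (blast intro: compact_continuous_image)
    then obtain M where "\<forall>y\<in>(\<lambda>x. D x v) ` K. norm y \<le> M"
      using compact_imp_bounded bounded_iff by metis
    then have "\<bar>D x v\<bar> \<le> max M 0" for x by (cases "x \<in> K") (auto simp: z le_max_iff_disj)
    then show ?thesis by (intro exI[of _ "max M 0"]) auto
  qed
  then obtain M where M: "\<And>v. 0 \<le> M v" "\<And>x v. \<bar>D x v\<bar> \<le> M v" by metis
  define L where "L = (\<Sum>b\<in>Basis. M b)"
  have L: "0 \<le> L" unfolding L_def by (intro sum_nonneg M)
  have b: "\<bar>D x v\<bar> \<le> L * norm v" for x v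
  proof -
    interpret linear "D x" using d has_derivative_linear by blast
    have "D x v = D x (\<Sum>b\<in>Basis. (v \<bullet> b) *\<^sub>R b)" by (simp add: euclidean_representation)
    also have "\<dots> = (\<Sum>b\<in>Basis. (v \<bullet> b) * D x b)" by (simp add: sum scaleR)
    finally have "\<bar>D x v\<bar> \<le> (\<Sum>b\<in>Basis. \<bar>(v \<bullet> b) * D x b\<bar>)" by (simp add: sum_abs)
    also have "\<dots> \<le> (\<Sum>b\<in>Basis. norm v * M b)"
      by (intro sum_mono) (auto simp: abs_mult Basis_le_norm intro!: mult_mono M)
    finally show ?thesis by (simp add: L_def sum_distrib_right sum_distrib_left mult.commute)
  qed
  have "norm (\<phi> x - \<phi> y) \<le> L * norm (x - y)" for x y
    by (rule differentiable_bound[of UNIV \<phi> D]) (use d b in \<open>auto intro!: onorm_le\<close>)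
  then have "\<bar>\<phi> x - \<phi> y\<bar> \<le> (L + 1) * norm (x - y)" for x y
    by (smt (verit) mult_right_mono norm_ge_zero real_norm_def)
  then show ?thesis using L by (intro exI[of _ "L + 1"]) auto
qed

lemma test_function_bounded:
  fixes \<phi> :: "'a::euclidean_space \<Rightarrow> real"
  assumes "\<phi> \<in> test_functions S"
  shows "\<exists>M>0. \<forall>x. \<bar>\<phi> x\<bar> \<le> M"
proof -
  define K where "K = closure {x. \<phi> x \<noteq> 0}"
  have K: "compact K" and C0: "Ck_on 0 \<phi> UNIV"
    using assms unfolding test_functions_def K_def by blast+
  have "compact (\<phi> ` K)"
    using K C0 continuous_on_subset by (auto intro!: compact_continuous_image)
  then obtain M where M: "\<forall>y\<in>\<phi> ` K. norm y \<le> M"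
    using compact_imp_bounded bounded_iff by metis
  have "\<bar>\<phi> x\<bar> \<le> \<bar>M\<bar> + 1" for x
  proof (cases "\<phi> x = 0")
    case False
    then have "x \<in> K" using closure_subset[of "{x. \<phi> x \<noteq> 0}"] by (auto simp: K_def)
    then show ?thesis using M by force
  qed simp
  then show ?thesis by (intro exI[of _ "\<bar>M\<bar> + 1"]) auto
qed

text \<open>A grid with \<open>n\<close> points per axis and spacing \<open>R / (N n)\<close>, where
  \<open>N\<close> is the dimension: each coordinate moves a point by at most \<open>R / N\<close>,
  so all points stay within \<open>R\<close> of \<open>c\<close>.\<close>

lemma lattice_in_ball:
  fixes c :: "'a::euclidean_space"
  assumes R: "0 < R" and n: "0 < n"
  shows "\<exists>X. finite X \<and> card X = n ^ DIM('a) \<and> X \<subseteq> cball c R \<and>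
    (\<forall>p\<in>X. \<forall>q\<in>X. p \<noteq> q \<longrightarrow> R / DIM('a) / n \<le> dist p q)"
proof -
  define l where "l = R / DIM('a) / real n"
  define F where "F = (Basis :: 'a set) \<rightarrow>\<^sub>E {..<n}"
  define pt where "pt z = c + (\<Sum>b\<in>Basis. (l * real (z b)) *\<^sub>R b)" for z :: "'a \<Rightarrow> nat"
  have l: "0 < l" using R n by (simp add: l_def)
  have inner: "(pt z - pt w) \<bullet> b = l * (real (z b) - real (w b))" if "b \<in> Basis" for z w b
    using that by (simp add: pt_def inner_diff_left inner_add_left algebra_simps)
  have sep: "l \<le> dist (pt z) (pt w)" if zw: "z \<in> F" "w \<in> F" "z \<noteq> w" for z w
  proof -
    have "\<exists>b\<in>Basis. z b \<noteq> w b"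
    proof (rule ccontr)
      assume "\<not> (\<exists>b\<in>Basis. z b \<noteq> w b)"
      then have "z = w" by (intro PiE_ext[OF zw(1,2)[unfolded F_def]]) auto
      then show False using zw(3) by simp
    qed
    then obtain b where b: "b \<in> Basis" "z b \<noteq> w b" by blast
    have "1 \<le> \<bar>real (z b) - real (w b)\<bar>" using b(2) by linarith
    then have "l * 1 \<le> l * \<bar>real (z b) - real (w b)\<bar>" using l by (intro mult_left_mono) auto
    also have "\<dots> = \<bar>(pt z - pt w) \<bullet> b\<bar>" using l by (simp add: inner[OF b(1)] abs_mult)
    also have "\<dots> \<le> dist (pt z) (pt w)" using Basis_le_norm[OF b(1)] by (simp add: dist_norm)
    finally show ?thesis by simp
  qed
  have inj: "inj_on pt F"
  proof (rule inj_onI, rule ccontr)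
    fix z w assume "z \<in> F" "w \<in> F" "pt z = pt w" "z \<noteq> w"
    then show False using sep[of z w] l by simp
  qed
  have "card (pt ` F) = n ^ DIM('a)"
    using card_image[OF inj] by (simp add: F_def card_PiE)
  moreover have "finite (pt ` F)" by (simp add: F_def finite_PiE)
  moreover have "pt ` F \<subseteq> cball c R"
  proof safe
    fix z assume z: "z \<in> F"
    have "dist c (pt z) = norm (\<Sum>b\<in>Basis. (l * real (z b)) *\<^sub>R b)"
      by (simp add: pt_def dist_norm norm_minus_cancel)
    also have "\<dots> \<le> (\<Sum>b\<in>(Basis::'a set). R / DIM('a))"
    proof (rule sum_norm_le)
      fix b :: 'a assume b: "b \<in> Basis"
      have "real (z b) \<le> real n" using z b by (auto simp: F_def PiE_def Pi_def less_imp_le)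
      from this have "l * real (z b) \<le> l * real n" using l by (intro mult_left_mono) auto
      also have "l * real n = R / DIM('a)" using n by (simp add: l_def)
      finally show "norm ((l * real (z b)) *\<^sub>R b) \<le> R / DIM('a)" using l b by (simp add: abs_mult)
    qed
    also have "\<dots> = R" by simp
    finally show "pt z \<in> cball c R" by simp
  qed
  ultimately show ?thesis using sep unfolding l_def by (intro exI[of _ "pt ` F"]) auto
qed

section \<open>Energy of test functions and capacity of balls\<close>

context green_kernel
begin

lemma test_function_measurable:
  "\<phi> \<in> test_functions \<Omega> \<Longrightarrow> \<phi> \<in> borel_measurable Leb"
proof -
  assume "\<phi> \<in> test_functions \<Omega>"
  then have "Ck_on 0 \<phi> UNIV" unfolding test_functions_def by blast
  then have "\<phi> \<in> borel_measurable borel" by (simp add: borel_measurable_continuous_onI)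
  then show ?thesis by (rule measurable_of_borel[OF id_measurable])
qed

text \<open>The Lipschitz bound reduces the \<open>J\<close> integral to that of
  \<open>\<bar>x - y\<bar>^2 J\<close>; on the compact support \<open>B\<close> is bounded.\<close>

lemma test_function_energy_domain:
  assumes L1: "cond_L1 \<Omega> J B" and \<phi>: "\<phi> \<in> test_functions \<Omega>"
  shows "\<phi> \<in> energy_domain \<Omega> J B"
proof -
  obtain L where L: "0 < L" "\<And>x y. \<bar>\<phi> x - \<phi> y\<bar> \<le> L * norm (x - y)"
    using test_function_lipschitz[OF \<phi>] by blast
  obtain S where S: "0 < S" "\<And>x. \<bar>\<phi> x\<bar> \<le> S" using test_function_bounded[OF \<phi>] by blast
  note m = test_function_measurable[OF \<phi>]
  have sq: "(\<phi> x)\<^sup>2 \<le> S\<^sup>2" for x using S(2)[of x] by (metis abs_ge_zero power2_abs power_mono)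
  have L2: "\<phi> \<in> L2_space \<Omega>"
  proof -
    have "integrable Leb (\<lambda>x. (\<phi> x)\<^sup>2)"
      using m sq by (intro integrable_const_bound[where B="S\<^sup>2"]) auto
    then show ?thesis using m by (simp add: L2_space_def)
  qed
  have q: "integrable Leb2 (\<lambda>z. (norm (fst z - snd z))\<^sup>2 * J (fst z) (snd z))"
    using L1 by (auto simp: cond_L1_def split_beta')
  have "integrable Leb2 (\<lambda>z. J (fst z) (snd z) * (\<phi> (fst z) - \<phi> (snd z))\<^sup>2)"
  proof (rule Bochner_Integration.integrable_bound)
    show "integrable Leb2 (\<lambda>z. L\<^sup>2 * ((norm (fst z - snd z))\<^sup>2 * J (fst z) (snd z)))"
      by (rule integrable_mult_right[OF q])
    show "(\<lambda>z. J (fst z) (snd z) * (\<phi> (fst z) - \<phi> (snd z))\<^sup>2) \<in> borel_measurable Leb2"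
      using J_product_measurable[OF L1 m m] by (simp add: power2_eq_square mult.assoc)
    show "AE z in Leb2. norm (J (fst z) (snd z) * (\<phi> (fst z) - \<phi> (snd z))\<^sup>2)
        \<le> norm (L\<^sup>2 * ((norm (fst z - snd z))\<^sup>2 * J (fst z) (snd z)))"
    proof (rule AE_I2)
      fix z :: "'a \<times> 'a"
      have "(\<phi> (fst z) - \<phi> (snd z))\<^sup>2 \<le> (L * norm (fst z - snd z))\<^sup>2"
        using L(2)[of "fst z" "snd z"] by (metis abs_ge_zero power2_abs power_mono)
      then have "\<bar>J (fst z) (snd z)\<bar> * (\<phi> (fst z) - \<phi> (snd z))\<^sup>2 \<le> \<bar>J (fst z) (snd z)\<bar> * (L * norm (fst z - snd z))\<^sup>2"
        by (rule mult_left_mono) simp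
      then show "norm (J (fst z) (snd z) * (\<phi> (fst z) - \<phi> (snd z))\<^sup>2)
        \<le> norm (L\<^sup>2 * ((norm (fst z - snd z))\<^sup>2 * J (fst z) (snd z)))"
        by (simp add: abs_mult power_mult_distrib mult_ac)
    qed
  qed
  moreover have "integrable Leb (\<lambda>x. B x * (\<phi> x)\<^sup>2)"
  proof -
    have "compact (closure {x. \<phi> x \<noteq> 0}) \<and> closure {x. \<phi> x \<noteq> 0} \<subseteq> \<Omega>"
      using \<phi> by (simp add: test_functions_def)
    then have "bounded (B ` closure {x. \<phi> x \<noteq> 0})" using L1 unfolding cond_L1_def by blast
    then obtain b where b: "\<And>x. x \<in> closure {x. \<phi> x \<noteq> 0} \<Longrightarrow> \<bar>B x\<bar> \<le> b"
      by (auto simp: bounded_iff)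
    have "norm (B x * (\<phi> x)\<^sup>2) \<le> \<bar>b\<bar> * S\<^sup>2" for x
    proof (cases "\<phi> x = 0")
      case False
      then have "x \<in> closure {x. \<phi> x \<noteq> 0}" by (intro closure_subset[THEN subsetD]) simp
      from b[OF this] have "\<bar>B x\<bar> \<le> \<bar>b\<bar>" by linarith
      then show ?thesis using sq[of x] by (auto simp: abs_mult intro!: mult_mono)
    qed simp
    moreover have "B \<in> borel_measurable Leb" using L1 by (simp add: cond_L1_def)
    ultimately show ?thesis
      using m by (intro integrable_const_bound[where B="\<bar>b\<bar> * S\<^sup>2"]) auto
  qed
  ultimately show ?thesis using L2 by (simp add: energy_domain_def split_beta')
qed

lemma test_function_H_space:
  assumes L1: "cond_L1 \<Omega> J B" and \<phi>: "\<phi> \<in> test_functions \<Omega>"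
  shows "\<phi> \<in> H_space \<Omega> J B"
  unfolding H_space_def
proof (intro CollectI conjI test_function_energy_domain assms allI impI)
  fix e :: real assume "0 < e"
  then show "\<exists>\<psi>\<in>test_functions \<Omega>. (\<integral>x. (\<phi> x - \<psi> x)\<^sup>2 \<partial>Leb) +
      energy \<Omega> J B (\<lambda>x. \<phi> x - \<psi> x) (\<lambda>x. \<phi> x - \<psi> x) < e"
    using \<phi> by (intro bexI[of _ \<phi>]) (simp_all add: energy_eq)
qed

lemma energy_self_nonneg:
  assumes L1: "cond_L1 \<Omega> J B"
  shows "0 \<le> energy \<Omega> J B u u"
proof -
  have "0 \<le> (\<integral>z. J (fst z) (snd z) * (u (fst z) - u (snd z)) * (u (fst z) - u (snd z)) \<partial>Leb2)"
  proof (rule integral_nonneg_AE, rule AE_I2)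
    fix z assume "z \<in> space Leb2"
    then have z: "fst z \<in> \<Omega>" "snd z \<in> \<Omega>" by auto
    show "0 \<le> J (fst z) (snd z) * (u (fst z) - u (snd z)) * (u (fst z) - u (snd z))"
      using J_nonneg[OF L1 z] by (cases "fst z = snd z") (auto simp: mult.assoc)
  qed
  moreover have "0 \<le> (\<integral>x. B x * u x * u x \<partial>Leb)"
    using B_nonneg[OF L1] by (intro integral_nonneg_AE AE_I2) (auto simp: mult.assoc)
  ultimately show ?thesis unfolding energy_eq by simp
qed

text \<open>Young's inequality under the integrals stands in for Cauchy-Schwarz; the parameter
  \<open>t\<close> is left free for optimisation.\<close>

lemma energy_young:
  assumes L1: "cond_L1 \<Omega> J B" and u: "u \<in> energy_domain \<Omega> J B" and v: "v \<in> energy_domain \<Omega> J B"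
    and t: "0 < t"
  shows "2 * energy \<Omega> J B u v \<le> t * energy \<Omega> J B u u + energy \<Omega> J B v v / t"
proof -
  have y: "2 * (a * b) \<le> t * (a * a) + b * b / t" for a b :: real
  proof -
    have "0 \<le> (t * a - b)\<^sup>2 / t" using t by simp
    also have "\<dots> = t * (a * a) + b * b / t - 2 * (a * b)"
      using t by (simp add: power2_eq_square field_simps)
    finally show ?thesis by simp
  qed
  note i = energy_integrable[OF L1]
  have "(\<integral>z. 2 * (J (fst z) (snd z) * (u (fst z) - u (snd z)) * (v (fst z) - v (snd z))) \<partial>Leb2)
    \<le> (\<integral>z. t * (J (fst z) (snd z) * (u (fst z) - u (snd z)) * (u (fst z) - u (snd z))) +
        J (fst z) (snd z) * (v (fst z) - v (snd z)) * (v (fst z) - v (snd z)) / t \<partial>Leb2)"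
  proof (rule integral_mono)
    fix z assume "z \<in> space Leb2"
    then have z: "fst z \<in> \<Omega>" "snd z \<in> \<Omega>" by auto
    let ?a = "u (fst z) - u (snd z)" and ?b = "v (fst z) - v (snd z)" and ?J = "J (fst z) (snd z)"
    show "2 * (?J * ?a * ?b) \<le> t * (?J * ?a * ?a) + ?J * ?b * ?b / t"
    proof (cases "fst z = snd z")
      case False
      from mult_left_mono[OF y[of ?a ?b] J_nonneg[OF L1 z False]]
      show ?thesis by (simp add: algebra_simps)
    qed simp
  qed (intro integrable_mult_right Bochner_Integration.integrable_add integrable_divide i u v)+
  also have "\<dots> = t * (\<integral>z. J (fst z) (snd z) * (u (fst z) - u (snd z)) * (u (fst z) - u (snd z)) \<partial>Leb2) +
        (\<integral>z. J (fst z) (snd z) * (v (fst z) - v (snd z)) * (v (fst z) - v (snd z)) \<partial>Leb2) / t"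
    using i(1)[OF u u] i(1)[OF v v] by simp
  finally have 1: "2 * (\<integral>z. J (fst z) (snd z) * (u (fst z) - u (snd z)) * (v (fst z) - v (snd z)) \<partial>Leb2)
    \<le> \<dots>" by simp
  have "(\<integral>x. 2 * (B x * u x * v x) \<partial>Leb)
    \<le> (\<integral>x. t * (B x * u x * u x) + B x * v x * v x / t \<partial>Leb)"
  proof (rule integral_mono)
    fix x assume "x \<in> space Leb"
    then have "0 \<le> B x" using B_nonneg[OF L1] by simp
    from mult_left_mono[OF y[of "u x" "v x"] this]
    show "2 * (B x * u x * v x) \<le> t * (B x * u x * u x) + B x * v x * v x / t"
      by (simp add: algebra_simps)
  qed (intro integrable_mult_right Bochner_Integration.integrable_add integrable_divide i u v)+
  also have "\<dots> = t * (\<integral>x. B x * u x * u x \<partial>Leb) + (\<integral>x. B x * v x * v x \<partial>Leb) / t"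
    using i(2)[OF u u] i(2)[OF v v] by simp
  finally have 2: "2 * (\<integral>x. B x * u x * v x \<partial>Leb) \<le> \<dots>" by simp
  show ?thesis unfolding energy_eq using 1 2 by (simp add: algebra_simps add_divide_distrib)
qed

lemma green0_le_Kr: "green0 x y \<le> C * riesz x y"
proof (cases "x \<in> \<Omega> \<and> y \<in> \<Omega> \<and> x \<noteq> y")
  case True
  define t where "t = norm (x - y)"
  have t: "0 < t" using True by (simp add: t_def)
  have k: "1 / t powr (real DIM('a) - 2 * s) = riesz x y"
    using t by (simp add: riesz_def t_def powr_minus[symmetric] inverse_eq_divide[symmetric])
  have "green_profile \<Omega> s \<gamma> x y = riesz x y * min (bdist \<Omega> x / t) 1 powr \<gamma> * min (bdist \<Omega> y / t) 1 powr \<gamma>"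
    by (simp add: green_profile_def k[symmetric] t_def)
  also have "\<dots> \<le> riesz x y * 1 * 1"
    using bdist_nonneg t \<gamma>_pos
    by (intro mult_mono powr_le1) (auto simp: riesz_nonneg)
  finally have "C * green_profile \<Omega> s \<gamma> x y \<le> C * riesz x y" using C_pos by simp
  then show ?thesis using True G_upper[of x y] by (auto simp: green0_def offdiag_def)
next
  case False
  then show ?thesis using C_pos riesz_nonneg[of x y] by (auto simp: green0_def offdiag_def)
qed

text \<open>The ball lies in the one of radius \<open>2 \<rho>\<close> around any of its points
  \<open>x\<close>, over which the Riesz kernel has an integral of order
  \<open>\<rho> powr (2 * s)\<close>.\<close>

lemma ball_potential_bound:
  "\<exists>A>0. \<forall>x0 \<rho> x f. ball x0 \<rho> \<subseteq> \<Omega> \<longrightarrow> 0 < \<rho> \<longrightarrow> x \<in> ball x0 \<rho> \<longrightarrow> f \<in> borel_measurable Leb \<longrightarrow>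
     (\<forall>y. \<bar>f y\<bar> \<le> indicator (ball x0 \<rho>) y) \<longrightarrow> \<bar>green_pot f x\<bar> \<le> A * \<rho> powr (2 * s)"
proof -
  obtain A where A: "0 < A" and A2: "\<forall>x R. 0 < R \<longrightarrow>
      (\<integral>\<^sup>+y. ennreal (riesz x y) * indicator (ball x R) y \<partial>lborel) \<le> ennreal (A * R powr (2 * s))"
    using riesz_ball by (elim exE conjE)
  have "\<bar>green_pot f x\<bar> \<le> (C * A * 2 powr (2 * s)) * \<rho> powr (2 * s)"
    if \<rho>: "0 < \<rho>" and x: "x \<in> ball x0 \<rho>" and f: "f \<in> borel_measurable Leb"
      "\<And>y. \<bar>f y\<bar> \<le> indicator (ball x0 \<rho>) y" for x0 \<rho> x f
  proof -
    have m: "(\<lambda>y. green0 x y * f y) \<in> borel_measurable Leb"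
      by (intro borel_measurable_times measurable_of_borel[OF id_measurable green0_measurable1] f)
    have sub: "y \<in> ball x (2 * \<rho>)" if "y \<in> ball x0 \<rho>" for y
      using that x dist_triangle[of x y x0] by (simp add: dist_commute)
    have "(\<integral>\<^sup>+y. ennreal (norm (green0 x y * f y)) \<partial>Leb)
      = (\<integral>\<^sup>+y. ennreal (norm (green0 x y * f y)) * indicator \<Omega> y \<partial>lebesgue)"
      by (simp add: nn_integral_restrict_space)
    also have "\<dots> \<le> (\<integral>\<^sup>+y. ennreal C * (ennreal (riesz x y) * indicator (ball x (2 * \<rho>)) y) \<partial>lebesgue)"
    proof (rule nn_integral_mono)
      fix y
      have "norm (green0 x y * f y) \<le> C * riesz x y * indicator (ball x (2 * \<rho>)) y"
      proof (cases "y \<in> ball x0 \<rho>")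
        case True
        have "norm (green0 x y * f y) = green0 x y * \<bar>f y\<bar>" by (simp add: abs_mult green0_nonneg)
        also have "\<dots> \<le> (C * riesz x y) * 1"
          using f(2)[of y] True C_pos by (intro mult_mono green0_le_Kr) (auto simp: riesz_nonneg)
        finally show ?thesis using sub[OF True] by simp
      next
        case False
        then have "f y = 0" using f(2)[of y] by simp
        then show ?thesis using C_pos riesz_nonneg[of x y] by simp
      qed
      then have "ennreal (norm (green0 x y * f y)) \<le> ennreal (C * riesz x y * indicator (ball x (2 * \<rho>)) y)"
        by (rule ennreal_leI)
      also have "\<dots> = ennreal C * (ennreal (riesz x y) * indicator (ball x (2 * \<rho>)) y)"
        using C_pos by (auto simp: indicator_def riesz_def ennreal_mult)
      finally show "ennreal (norm (green0 x y * f y)) * indicator \<Omega> y \<le> ennreal C * (ennreal (riesz x y) * indicator (ball x (2 * \<rho>)) y)"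
        by (auto simp: indicator_def split: if_splits)
    qed
    also have "\<dots> = ennreal C * (\<integral>\<^sup>+y. ennreal (riesz x y) * indicator (ball x (2 * \<rho>)) y \<partial>lborel)"
    proof -
      have b: "ball x (2 * \<rho>) \<in> sets borel" by simp
      have "(\<lambda>y. ennreal (riesz x y) * indicator (ball x (2 * \<rho>)) y) \<in> borel_measurable lborel"
        by (intro borel_measurable_times_ennreal borel_measurable_indicator)
           (use b riesz_measurable1[of x] in \<open>auto intro!: measurable_compose[OF riesz_measurable1]\<close>)
      then show ?thesis unfolding nn_integral_completion riesz_def by (rule nn_integral_cmult)
    qed
    also have "\<dots> \<le> ennreal C * ennreal (A * (2 * \<rho>) powr (2 * s))"
      using \<rho> by (intro mult_left_mono A2[rule_format]) auto
    also have "\<dots> = ennreal (C * (A * (2 * \<rho>) powr (2 * s)))"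
      using C_pos A by (intro ennreal_mult[symmetric]) auto
    also have "C * (A * (2 * \<rho>) powr (2 * s)) = (C * A * 2 powr (2 * s)) * \<rho> powr (2 * s)"
      using \<rho> by (simp add: powr_mult)
    finally have le: "(\<integral>\<^sup>+y. ennreal (norm (green0 x y * f y)) \<partial>Leb) \<le> ennreal ((C * A * 2 powr (2 * s)) * \<rho> powr (2 * s))" .
    have i: "integrable Leb (\<lambda>y. green0 x y * f y)"
      by (rule integrableI_bounded[OF m]) (rule order_le_less_trans[OF le], simp)
    have "ennreal \<bar>green_pot f x\<bar> \<le> (\<integral>\<^sup>+y. ennreal (norm (green0 x y * f y)) \<partial>Leb)"
      unfolding green_pot_def using integral_norm_bound_ennreal[OF i] by simp
    with le have "ennreal \<bar>green_pot f x\<bar> \<le> ennreal ((C * A * 2 powr (2 * s)) * \<rho> powr (2 * s))" by (rule order_trans[rotated])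
    then show ?thesis using C_pos A by (subst (asm) ennreal_le_iff) auto
  qed
  moreover have "0 < C * A * 2 powr (2 * s)" using C_pos A by simp
  ultimately show ?thesis by blast
qed

text \<open>A dual bound for the capacity. The potential \<open>w\<close> of the signed indicator of
  the ball is at most \<open>A \<rho>^2\<close> there, so its energy is at most that times the
  volume, while pairing \<open>w\<close> with \<open>\<phi>\<close> gives at least \<open>m\<close>
  times the volume. The sign \<open>c\<close> admits \<open>\<phi>\<close> negative on the ball; the
  factor \<open>\<rho>^2\<close> avoids a division.\<close>

lemma capacity_lower_bound:
  assumes s: "s = 1" and L1: "cond_L1 \<Omega> J B"
    and sol: "\<forall>f\<in>L2_space \<Omega>. green_solution \<Omega> J B f (green_op \<Omega> G f)"
  shows "\<exists>\<kappa>>0. \<forall>p \<rho> m c \<phi>. 0 < \<rho> \<longrightarrow> ball p \<rho> \<subseteq> \<Omega> \<longrightarrow> \<phi> \<in> test_functions \<Omega> \<longrightarrow> 0 < m \<longrightarrow>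
    \<bar>c\<bar> = 1 \<longrightarrow> (\<forall>z\<in>ball p \<rho>. m \<le> c * \<phi> z) \<longrightarrow>
    \<kappa> * m\<^sup>2 * \<rho> ^ DIM('a) \<le> \<rho>\<^sup>2 * energy \<Omega> J B \<phi> \<phi>"
proof -
  obtain A where A: "0 < A" and A2: "\<forall>x0 \<rho> x f. ball x0 \<rho> \<subseteq> \<Omega> \<longrightarrow> 0 < \<rho> \<longrightarrow> x \<in> ball x0 \<rho> \<longrightarrow>
     f \<in> borel_measurable Leb \<longrightarrow>
     (\<forall>y. \<bar>f y\<bar> \<le> indicator (ball x0 \<rho>) y) \<longrightarrow> \<bar>green_pot f x\<bar> \<le> A * \<rho> powr (2 * s)"
    using ball_potential_bound by (elim exE conjE)
  define V where "V = unit_ball_vol DIM('a)"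
  have V: "0 < V" by (simp add: V_def)
  have "V / A * m\<^sup>2 * \<rho> ^ DIM('a) \<le> \<rho>\<^sup>2 * energy \<Omega> J B \<phi> \<phi>"
    if \<rho>: "0 < \<rho>" and sub: "ball p \<rho> \<subseteq> \<Omega>" and \<phi>: "\<phi> \<in> test_functions \<Omega>" and m: "0 < m" and c: "\<bar>c\<bar> = 1"
      and ge: "\<And>z. z \<in> ball p \<rho> \<Longrightarrow> m \<le> c * \<phi> z" for p \<rho> m c \<phi>
  proof -
    define f where "f y = c * indicator (ball p \<rho>) y" for y :: 'a
    have b: "ball p \<rho> \<in> sets Leb" using sub by (simp add: sets_restrict_space_iff)
    have fm: "f \<in> borel_measurable Leb"
      unfolding f_def[abs_def] by (intro borel_measurable_times borel_measurable_const borel_measurable_indicator b)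
    have f1: "\<bar>f y\<bar> \<le> indicator (ball p \<rho>) y" for y using c by (simp add: f_def abs_mult indicator_def)
    have fL2: "f \<in> L2_space \<Omega>"
    proof -
      have "norm ((f y)\<^sup>2) \<le> 1" for y
      proof -
        have "\<bar>f y\<bar> \<le> 1" using f1[of y] indicator_le_1[of "ball p \<rho>" y] by (rule order_trans)
        then show ?thesis by (simp add: abs_square_le_1)
      qed
      then have "integrable Leb (\<lambda>y. (f y)\<^sup>2)"
        using fm by (intro integrable_const_bound[where B=1]) auto
      then show ?thesis using fm by (simp add: L2_space_def)
    qed
    define w where "w = green_op \<Omega> G f"
    have w: "green_solution \<Omega> J B f w" unfolding w_def using sol fL2 by blast
    then have wd: "w \<in> energy_domain \<Omega> J B" by (simp add: green_solution_def H_space_def)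
    have wm: "w \<in> borel_measurable Leb" using wd by (simp add: energy_domain_def L2_space_def)
    have wb: "\<bar>w x\<bar> \<le> A * \<rho>\<^sup>2" if "x \<in> ball p \<rho>" for x
    proof -
      have "x \<in> \<Omega>" using that sub by auto
      then have "\<bar>w x\<bar> \<le> A * \<rho> powr (2 * s)"
        unfolding w_def green_op_eq[OF \<open>x \<in> \<Omega>\<close>] green_pot_def[symmetric]
        using A2[rule_format, OF sub \<rho> that fm f1] by simp
      then show ?thesis using \<rho> s by simp
    qed
    have meas: "measure Leb (ball p \<rho>) = V * \<rho> ^ DIM('a)"
      using sub \<rho> by (simp add: measure_restrict_space content_ball V_def)
    have bi: "integrable Leb (\<lambda>y. d * indicator (ball p \<rho>) y)" for d :: real
      using b by (intro integrable_mult_right integrable_real_indicator) (auto simp: less_top[symmetric])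
    have ib: "(\<integral>y. d * indicator (ball p \<rho>) y \<partial>Leb) = d * (V * \<rho> ^ DIM('a))" for d :: real
      using meas sub by (simp add: Int_absorb2 Int_absorb1)
    have "energy \<Omega> J B w w = (\<integral>y. f y * w y \<partial>Leb)"
      using w by (simp add: green_solution_def)
    also have "\<dots> \<le> (\<integral>y. (A * \<rho>\<^sup>2) * indicator (ball p \<rho>) y \<partial>Leb)"
    proof (rule integral_mono_AE)
      have bd: "\<bar>f y * w y\<bar> \<le> (A * \<rho>\<^sup>2) * indicator (ball p \<rho>) y" for y
        using wb[of y] c by (auto simp: f_def abs_mult indicator_def)
      show "integrable Leb (\<lambda>y. f y * w y)"
        by (rule Bochner_Integration.integrable_bound[OF bi[of "A * \<rho>\<^sup>2"]])
           (use fm wm bd A in \<open>auto simp: abs_mult\<close>)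
      show "AE y in Leb. f y * w y \<le> (A * \<rho>\<^sup>2) * indicator (ball p \<rho>) y"
        by (rule AE_I2) (rule order_trans[OF abs_ge_self bd])
    qed (rule bi)
    also have "\<dots> = A * \<rho>\<^sup>2 * (V * \<rho> ^ DIM('a))" by (rule ib)
    finally have E1: "energy \<Omega> J B w w \<le> A * \<rho>\<^sup>2 * (V * \<rho> ^ DIM('a))" .
    obtain S where S: "\<And>x. \<bar>\<phi> x\<bar> \<le> S" using test_function_bounded[OF \<phi>] by blast
    have "m * (V * \<rho> ^ DIM('a)) = (\<integral>y. m * indicator (ball p \<rho>) y \<partial>Leb)" by (rule ib[symmetric])
    also have "\<dots> \<le> (\<integral>y. f y * \<phi> y \<partial>Leb)"
    proof (rule integral_mono_AE)
      show "integrable Leb (\<lambda>y. f y * \<phi> y)"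
      proof (rule Bochner_Integration.integrable_bound[OF bi[of S]])
        show "AE y in Leb. norm (f y * \<phi> y) \<le> norm (S * indicator (ball p \<rho>) y)"
        proof (rule AE_I2)
          fix y
          have "\<bar>\<phi> y\<bar> \<le> \<bar>S\<bar>" using S[of y] by linarith
          then show "norm (f y * \<phi> y) \<le> norm (S * indicator (ball p \<rho>) y)"
            using c by (simp add: f_def abs_mult indicator_def)
        qed
      qed (use fm test_function_measurable[OF \<phi>] in auto)
      show "AE y in Leb. m * indicator (ball p \<rho>) y \<le> f y * \<phi> y"
        by (rule AE_I2) (use ge in \<open>auto simp: f_def indicator_def\<close>)
    qed (rule bi)
    also have "\<dots> = energy \<Omega> J B w \<phi>"
      using w test_function_H_space[OF L1 \<phi>] by (simp add: green_solution_def)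
    finally have E2: "m * (V * \<rho> ^ DIM('a)) \<le> energy \<Omega> J B w \<phi>" .
    \<comment> \<open>With this choice \<open>t\<close> times the bound for the energy of
      \<open>w\<close> is exactly \<open>m\<close> times the volume and absorbs half of the left
      side.\<close>
    define t where "t = m / (A * \<rho>\<^sup>2)"
    have t: "0 < t" using m A \<rho> by (simp add: t_def)
    have "2 * (m * (V * \<rho> ^ DIM('a))) \<le> 2 * energy \<Omega> J B w \<phi>" using E2 by simp
    also have "\<dots> \<le> t * energy \<Omega> J B w w + energy \<Omega> J B \<phi> \<phi> / t"
      by (rule energy_young[OF L1 wd test_function_energy_domain[OF L1 \<phi>] t])
    also have "t * energy \<Omega> J B w w \<le> t * (A * \<rho>\<^sup>2 * (V * \<rho> ^ DIM('a)))"
      using E1 t by (intro mult_left_mono) auto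
    also have "t * (A * \<rho>\<^sup>2 * (V * \<rho> ^ DIM('a))) = m * (V * \<rho> ^ DIM('a))"
      using A \<rho> by (simp add: t_def)
    finally have "m * (V * \<rho> ^ DIM('a)) \<le> energy \<Omega> J B \<phi> \<phi> / t" by linarith
    then have "m / A * (m * (V * \<rho> ^ DIM('a))) \<le> m / A * (energy \<Omega> J B \<phi> \<phi> / t)"
      using m A by (intro mult_left_mono) auto
    also have "\<dots> = \<rho>\<^sup>2 * energy \<Omega> J B \<phi> \<phi>" using m A \<rho> by (simp add: t_def)
    finally show ?thesis by (simp add: power2_eq_square mult_ac)
  qed
  moreover have "0 < V / A" using V A by simp
  ultimately show ?thesis by blast
qed

text \<open>An indirect argument instead of an explicit bump function: if all test functions
  vanished, every element of their closure \<open>H_space\<close> would vanish almost everywhere.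
  But the potential of the constant 1 belongs to it and is positive, because the kernel is.\<close>

lemma nonzero_test_function:
  assumes ne: "\<Omega> \<noteq> {}" and L1: "cond_L1 \<Omega> J B"
    and sol: "\<forall>f\<in>L2_space \<Omega>. green_solution \<Omega> J B f (green_op \<Omega> G f)"
  shows "\<exists>\<phi>\<in>test_functions \<Omega>. \<exists>a. \<phi> a \<noteq> 0"
proof (rule ccontr)
  assume "\<not> ?thesis"
  then have z: "\<And>\<phi> a. \<phi> \<in> test_functions \<Omega> \<Longrightarrow> \<phi> a = 0" by blast
  have one: "(\<lambda>_. 1) \<in> L2_space \<Omega>" by (simp add: L2_space_def)
  define w where "w = green_op \<Omega> G (\<lambda>_. 1)"
  have "green_solution \<Omega> J B (\<lambda>_. 1) w" unfolding w_def using sol one by blast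
  then have wH: "w \<in> H_space \<Omega> J B" by (simp add: green_solution_def)
  then have wL2: "integrable Leb (\<lambda>x. (w x)\<^sup>2)"
    by (simp add: H_space_def energy_domain_def L2_space_def)
  have small: "(\<integral>x. (w x)\<^sup>2 \<partial>Leb) < e" if "0 < e" for e
  proof -
    obtain \<phi> where \<phi>: "\<phi> \<in> test_functions \<Omega>" "(\<integral>x. (w x - \<phi> x)\<^sup>2 \<partial>Leb) +
       energy \<Omega> J B (\<lambda>x. w x - \<phi> x) (\<lambda>x. w x - \<phi> x) < e"
      using wH \<open>0 < e\<close> unfolding H_space_def by blast
    then show ?thesis using energy_self_nonneg[OF L1, of "\<lambda>x. w x - \<phi> x"] by (simp add: z)
  qed
  have "(\<integral>x. (w x)\<^sup>2 \<partial>Leb) = 0"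
  proof (rule antisym)
    show "(\<integral>x. (w x)\<^sup>2 \<partial>Leb) \<le> 0"
      using small[of "\<integral>x. (w x)\<^sup>2 \<partial>Leb"] by (meson less_irrefl not_le)
  qed simp
  then have w0: "AE x in Leb. (w x)\<^sup>2 = 0"
    using integral_nonneg_eq_0_iff_AE[OF wL2] by simp
  have "(\<lambda>_. 1) \<in> L1_weighted \<Omega> \<gamma>"
  proof -
    obtain D where D: "\<And>x. x \<in> \<Omega> \<Longrightarrow> weight x \<le> D" using weight_bounded by auto
    have "integrable Leb weight"
      using D by (intro integrable_const_bound[where B=D] AE_I2 weight_measurable_dom) (simp add: weight_nonneg)
    then show ?thesis by (simp add: L1_weighted_iff)
  qed
  note L1w = this
  have noF: "\<not> (AE x in Leb. False)"
  proof
    assume "AE x in Leb. False"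
    then have "emeasure Leb (space Leb) = 0"
      using ae_filter_eq_bot_iff[of "Leb"] by (simp add: eventually_False)
    then have "\<Omega> \<in> null_sets lebesgue" by (auto simp: emeasure_restrict_space null_sets_def)
    then show False using open_not_negligible[OF open_dom ne] by (simp add: negligible_iff_null_sets)
  qed
  have "AE x in Leb. False"
    using w0 riesz_pot_finite_AE[OF admissible_dens[OF L1w]] AE_space
  proof eventually_elim
    case (elim x)
    then have x: "x \<in> \<Omega>" and fin: "riesz_pot (abs_density (\<lambda>_. 1)) x < \<infinity>" and "w x = 0" by auto
    then have "(\<integral>y. green0 x y \<partial>Leb) = 0" by (simp add: w_def green_op_eq)
    moreover have "integrable Leb (green0 x)" using green0_f_integrable[OF L1w x fin] by simp
    ultimately have "AE y in Leb. green0 x y = 0"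
      using integral_nonneg_eq_0_iff_AE[of "Leb" "green0 x"] by (simp add: green0_nonneg)
    moreover have "AE y in Leb. y \<noteq> x"
    proof -
      have "AE y in lebesgue. y \<noteq> x" using AE_lborel_singleton[of x] by (rule AE_completion)
      then show ?thesis by (simp add: AE_restrict_space_iff, elim eventually_mono) simp
    qed
    ultimately have "AE y in Leb. False"
      using AE_space
    proof eventually_elim
      case (elim y)
      then have "y \<in> \<Omega>" by simp
      then have "0 < green0 x y" using G_pos[OF x \<open>y \<in> \<Omega>\<close>] elim(2) x by (auto simp: green0_def offdiag_def)
      then show ?case using elim by simp
    qed
    then show ?case using noF by simp
  qed
  then show False using noF by simp
qed

text \<open>For \<open>s = 1\<close> the Green function bound makes the capacity of a ball of radius \<open>r\<close> at least of
  order \<open>r\<^sup>N\<^sup>-\<^sup>2\<close>. On the other hand \<open>\<bar>x - y\<bar>\<^sup>2 J\<close> is integrable, so \<open>n\<^sup>N\<close> disjoint test functions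
  at scale \<open>1 / n\<close> have total energy \<open>o(n\<^sup>2)\<close>.\<close>
lemma order_not_one:
  assumes s: "s = 1" and ne: "\<Omega> \<noteq> {}" and L1: "cond_L1 \<Omega> J B"
    and sol: "\<forall>f\<in>L2_space \<Omega>. green_solution \<Omega> J B f (green_op \<Omega> G f)"
  shows False
proof -
  obtain \<kappa> where \<kappa>: "0 < \<kappa>" and cap: "\<forall>p \<rho> m c \<phi>. 0 < \<rho> \<longrightarrow> ball p \<rho> \<subseteq> \<Omega> \<longrightarrow> \<phi> \<in> test_functions \<Omega> \<longrightarrow> 0 < m \<longrightarrow>
    \<bar>c\<bar> = 1 \<longrightarrow> (\<forall>z\<in>ball p \<rho>. m \<le> c * \<phi> z) \<longrightarrow>
    \<kappa> * m\<^sup>2 * \<rho> ^ DIM('a) \<le> \<rho>\<^sup>2 * energy \<Omega> J B \<phi> \<phi>"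
    using capacity_lower_bound[OF s L1 sol] by (elim exE conjE)
  obtain \<phi> a where \<phi>: "\<phi> \<in> test_functions \<Omega>" and a: "\<phi> a \<noteq> 0"
    using nonzero_test_function[OF ne L1 sol] by blast
  obtain L where L: "0 < L" "\<And>x y. \<bar>\<phi> x - \<phi> y\<bar> \<le> L * norm (x - y)"
    using test_function_lipschitz[OF \<phi>] by blast
  obtain S where S: "0 < S" "\<And>x. \<bar>\<phi> x\<bar> \<le> S" using test_function_bounded[OF \<phi>] by blast
  define c where "c = sgn (\<phi> a)"
  \<comment> \<open>With \<open>\<rho> = m / L\<close> the Lipschitz bound lets
    \<open>\<phi>\<close> lose at most half of its value at \<open>a\<close> within distance
    \<open>\<rho>\<close>.\<close>
  define m where "m = \<bar>\<phi> a\<bar> / 2"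
  have c: "\<bar>c\<bar> = 1" and m: "0 < m" using a by (auto simp: c_def m_def abs_sgn_eq)
  define \<rho> where "\<rho> = m / L"
  have \<rho>: "0 < \<rho>" using m L by (simp add: \<rho>_def)
  have near: "m \<le> c * \<phi> z" if "dist a z < \<rho>" for z
  proof -
    have "\<bar>\<phi> z - \<phi> a\<bar> \<le> L * norm (z - a)" by (rule L)
    also have "\<dots> \<le> L * \<rho>" using that L by (intro mult_left_mono) (auto simp: dist_norm norm_minus_commute)
    also have "\<dots> = m" using L by (simp add: \<rho>_def)
    finally have "\<bar>\<phi> z - \<phi> a\<bar> \<le> \<bar>\<phi> a\<bar> / 2" by (simp add: m_def)
    then show ?thesis using a by (auto simp: c_def m_def sgn_if abs_if split: if_splits)
  qed
  have "bounded {z. \<phi> z \<noteq> 0}"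
    using \<phi> compact_imp_bounded bounded_subset closure_subset unfolding test_functions_def by blast
  then obtain R where R: "\<And>z. \<phi> z \<noteq> 0 \<Longrightarrow> norm z \<le> R" by (auto simp: bounded_iff)
  define R1 where "R1 = \<bar>R\<bar> + norm a + 1"
  have R1: "0 < R1" by (simp add: R1_def add_nonneg_pos)
  have supp: "norm (z - a) \<le> R1" if "\<phi> z \<noteq> 0" for z
    using R[OF that] norm_triangle_ineq4[of z a] by (simp add: R1_def)
  obtain x0 where "x0 \<in> \<Omega>" using ne by blast
  then obtain r where r: "0 < r" "cball x0 r \<subseteq> \<Omega>" using open_dom open_contains_cball by blast
  define R0 where "R0 = r / 2"
  have R0: "0 < R0" "cball x0 (2 * R0) \<subseteq> \<Omega>" using r by (auto simp: R0_def)
  define l where "l = R0 / DIM('a)"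
  have l: "0 < l" using R0 by (simp add: l_def)
  have lR0: "l \<le> R0"
  proof -
    have "R0 / DIM('a) \<le> R0 / 1" using R0 by (intro divide_left_mono) (auto simp: Suc_le_eq)
    then show ?thesis by (simp add: l_def)
  qed
  \<comment> \<open>Scaling by \<open>t = \<tau> n\<close> shrinks the support to radius at most
    \<open>R1 / t = l / (3 n)\<close>. The centres are \<open>l / n\<close> apart, so the supports
    are disjoint.\<close>
  define \<tau> where "\<tau> = 3 * R1 / l"
  have \<tau>: "0 < \<tau>" using R1 l by (simp add: \<tau>_def)
  \<comment> \<open>Contains all supports: the centres lie within \<open>R0\<close> of
    \<open>x0\<close>, and the support radius is at most \<open>l / 3 \<le> R0\<close>.\<close>
  define K where "K = cball x0 (2 * R0)"
  have "compact K \<and> K \<subseteq> \<Omega>" using R0 by (simp add: K_def)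
  then have "bounded (B ` K)" using L1 unfolding cond_L1_def by blast
  then obtain b where b: "\<And>x. x \<in> K \<Longrightarrow> \<bar>B x\<bar> \<le> b" by (auto simp: bounded_iff)
  \<comment> \<open>Bounds the \<open>B\<close> term of the total energy: at each point at most one
    of the functions is nonzero.\<close>
  define \<beta> where "\<beta> = measure Leb \<Omega> * (\<bar>b\<bar> * S\<^sup>2)"
  define q where "q z = (norm (fst z - snd z))\<^sup>2 * J (fst z) (snd z)" for z :: "'a \<times> 'a"
  \<comment> \<open>\<open>n^2 g n\<close> majorises the sum of the \<open>J\<close> integrands. The
    minimum combines two bounds for a difference, \<open>2 S\<close> and
    \<open>L \<tau> n \<bar>x - y\<bar>\<close>, squared and divided by
    \<open>(n \<bar>x - y\<bar>)^2\<close>; the factor 2 counts the functions that are nonzero at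
    one of the two points. The first bound sends \<open>g n\<close> to 0 pointwise, the second
    dominates it.\<close>
  define g where "g n z = q z * (2 * min (4 * S\<^sup>2 / (norm (fst z - snd z) * real n)\<^sup>2) ((L * \<tau>)\<^sup>2))" for n z
  have qi: "integrable Leb2 q"
    using L1 unfolding q_def[abs_def] by (auto simp: cond_L1_def split_beta')
  have q0: "0 \<le> q z" if "fst z \<in> \<Omega>" "snd z \<in> \<Omega>" for z
    using J_nonneg[OF L1 that] by (cases "fst z = snd z") (auto simp: q_def)
  have nm: "(\<lambda>z. norm (fst z - snd z :: 'a)) \<in> borel_measurable Leb2"
  proof -
    have "(\<lambda>z :: 'a \<times> 'a. norm (fst z - snd z)) \<in> borel_measurable borel"
      by (intro borel_measurable_continuous_onI continuous_intros)
    then show ?thesis by (intro measurable_restrict_space1 measurable_completion) simp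
  qed
  have gm: "g n \<in> borel_measurable Leb2" for n
    unfolding g_def[abs_def] using qi nm by measurable
  have gb: "norm (g n z) \<le> norm (2 * (L * \<tau>)\<^sup>2 * q z)" for n z
  proof -
    have "norm (g n z) = \<bar>q z\<bar> * (2 * min (4 * S\<^sup>2 / (norm (fst z - snd z) * real n)\<^sup>2) ((L * \<tau>)\<^sup>2))"
      by (simp add: g_def abs_mult)
    also have "\<dots> \<le> \<bar>q z\<bar> * (2 * (L * \<tau>)\<^sup>2)" by (intro mult_left_mono) auto
    finally show ?thesis by (simp add: abs_mult mult_ac)
  qed
  have gi: "integrable Leb2 (g n)" for n
    by (rule Bochner_Integration.integrable_bound[OF integrable_mult_right[OF qi] gm]) (rule AE_I2, rule gb)
  have glim: "(\<lambda>n. \<integral>z. g n z \<partial>Leb2) \<longlonglongrightarrow> (\<integral>z. 0 \<partial>Leb2)"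
  proof (rule integral_dominated_convergence)
    show "integrable Leb2 (\<lambda>z. norm (2 * (L * \<tau>)\<^sup>2 * q z))"
      by (intro integrable_norm integrable_mult_right qi)
    show "AE z in Leb2. (\<lambda>n. g n z) \<longlonglongrightarrow> 0"
    proof (rule AE_I2)
      fix z :: "'a \<times> 'a"
      define d where "d = norm (fst z - snd z)"
      have "(\<lambda>n. 4 * S\<^sup>2 / d\<^sup>2 * (1 / real n)\<^sup>2) \<longlonglongrightarrow> 4 * S\<^sup>2 / d\<^sup>2 * 0\<^sup>2"
        by (intro tendsto_intros lim_const_over_n)
      then have "(\<lambda>n. 4 * S\<^sup>2 / (d * real n)\<^sup>2) \<longlonglongrightarrow> 0"
        by (simp add: power_mult_distrib power_divide)
      then have "(\<lambda>n. q z * (2 * min (4 * S\<^sup>2 / (d * real n)\<^sup>2) ((L * \<tau>)\<^sup>2))) \<longlonglongrightarrow> q z * (2 * min 0 ((L * \<tau>)\<^sup>2))"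
        by (intro tendsto_intros)
      then show "(\<lambda>n. g n z) \<longlonglongrightarrow> 0" by (simp add: g_def d_def)
    qed
    show "AE z in Leb2. norm (g n z) \<le> norm (2 * (L * \<tau>)\<^sup>2 * q z)" for n
      by (rule AE_I2) (rule gb)
  qed (use gm in auto)
  \<comment> \<open>The capacity bound summed over \<open>n^N\<close> copies, \<open>N\<close> being
    the dimension. The count cancels the power of \<open>n\<close> in \<open>(\<rho> / t)^N\<close>,
    and \<open>(\<rho> / t)^2\<close> cancels the \<open>n^2\<close> of the energy bound, so a
    positive constant stays below a sequence tending to 0.\<close>
  have key: "\<kappa> * m\<^sup>2 * (\<rho> / \<tau>) ^ DIM('a) \<le> (\<rho> / \<tau>)\<^sup>2 *
      (1 / 2 * (\<integral>z. g n z \<partial>Leb2) + \<beta> / (real n)\<^sup>2)" if n: "0 < n" for n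
  proof -
    define t where "t = \<tau> * real n"
    have t: "0 < t" using \<tau> n by (simp add: t_def)
    have "\<exists>X. finite X \<and> card X = n ^ DIM('a) \<and> X \<subseteq> cball x0 R0 \<and>
      (\<forall>p\<in>X. \<forall>q\<in>X. p \<noteq> q \<longrightarrow> R0 / DIM('a) / n \<le> dist p q)"
      by (rule lattice_in_ball[OF R0(1) n])
    then obtain X where X: "finite X" "card X = n ^ DIM('a)" "X \<subseteq> cball x0 R0"
      "\<And>p q. p \<in> X \<Longrightarrow> q \<in> X \<Longrightarrow> p \<noteq> q \<Longrightarrow> l / n \<le> dist p q"
      unfolding l_def by blast
    define \<psi> where "\<psi> p x = \<phi> (a + t *\<^sub>R (x - p))" for p x
    have s1: "dist p x \<le> l / (3 * n)" if "\<psi> p x \<noteq> 0" for p x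
    proof -
      have "norm (a + t *\<^sub>R (x - p) - a) \<le> R1" using that unfolding \<psi>_def by (rule supp)
      then have "t * dist p x \<le> R1" using t by (simp add: dist_norm norm_minus_commute)
      then have "dist p x \<le> R1 / t" using t by (simp add: field_simps)
      also have "R1 / t = l / (3 * n)" using R1 l n by (simp add: t_def \<tau>_def field_simps)
      finally show ?thesis .
    qed
    have l3: "l / (3 * n) \<le> R0"
    proof -
      have "l / (3 * n) \<le> l / 1" using l n by (intro divide_left_mono) auto
      then show ?thesis using lR0 by simp
    qed
    have s2: "x \<in> K" if "p \<in> X" "\<psi> p x \<noteq> 0" for p x
    proof -
      have "dist x0 p \<le> R0" using that X(3) by auto
      then show ?thesis using s1[OF that(2)] l3 dist_triangle[of x0 x p] by (simp add: K_def)
    qed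
    have uniq: "p = p'" if "p \<in> X" "p' \<in> X" "\<psi> p x \<noteq> 0" "\<psi> p' x \<noteq> 0" for p p' x
    proof (rule ccontr)
      assume "p \<noteq> p'"
      then have "l / n \<le> dist p p'" using X(4) that by blast
      also have "\<dots> \<le> dist p x + dist p' x" by (metis dist_commute dist_triangle)
      also have "\<dots> \<le> l / (3 * n) + l / (3 * n)" by (intro add_mono s1 that)
      finally show False using l n by (simp add: field_simps)
    qed
    have \<psi>t: "\<psi> p \<in> test_functions \<Omega>" if p: "p \<in> X" for p
    proof -
      have "\<And>k. Ck_on k (\<psi> p) UNIV"
        using \<phi> Ck_on_affine unfolding test_functions_def \<psi>_def[abs_def] by blast
      moreover have "{x. \<psi> p x \<noteq> 0} \<subseteq> K" using s2[OF p] by auto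
      then have "closure {x. \<psi> p x \<noteq> 0} \<subseteq> K" unfolding K_def by (rule closure_minimal) simp
      moreover have "compact (closure {x. \<psi> p x \<noteq> 0})"
        using compact_closure bounded_subset[OF bounded_cball] \<open>{x. \<psi> p x \<noteq> 0} \<subseteq> K\<close> unfolding K_def by blast
      ultimately show ?thesis using R0(2) unfolding test_functions_def K_def by blast
    qed
    have \<psi>b: "\<bar>\<psi> p x\<bar> \<le> S" for p x unfolding \<psi>_def by (rule S)
    have \<psi>L: "\<bar>\<psi> p x - \<psi> p y\<bar> \<le> L * t * norm (x - y)" for p x y
    proof -
      have "\<bar>\<psi> p x - \<psi> p y\<bar> \<le> L * norm (a + t *\<^sub>R (x - p) - (a + t *\<^sub>R (y - p)))"
        unfolding \<psi>_def by (rule L)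
      also have "a + t *\<^sub>R (x - p) - (a + t *\<^sub>R (y - p)) = t *\<^sub>R (x - y)" by (simp add: algebra_simps)
      finally show ?thesis using t by simp
    qed
    have card1: "card {p \<in> X. \<psi> p x \<noteq> 0} \<le> 1" for x
      using uniq X(1) by (auto simp: card_le_Suc0_iff_eq)
    have low: "\<kappa> * m\<^sup>2 * (\<rho> / t) ^ DIM('a) \<le> (\<rho> / t)\<^sup>2 * energy \<Omega> J B (\<psi> p) (\<psi> p)" if p: "p \<in> X" for p
    proof -
      have in_ball: "m \<le> c * \<psi> p z" if "z \<in> ball p (\<rho> / t)" for z
      proof -
        have "dist a (a + t *\<^sub>R (z - p)) = t * dist p z" using t by (simp add: dist_norm norm_minus_commute)
        also have "\<dots> < \<rho>" using that t by (simp add: field_simps)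
        finally show ?thesis unfolding \<psi>_def by (rule near)
      qed
      have "ball p (\<rho> / t) \<subseteq> \<Omega>"
      proof
        fix z assume "z \<in> ball p (\<rho> / t)"
        then have "\<psi> p z \<noteq> 0" using in_ball m by fastforce
        then show "z \<in> \<Omega>" using s2[OF p] R0 unfolding K_def by blast
      qed
      then show ?thesis using cap[rule_format, OF _ _ \<psi>t[OF p] m c in_ball] \<rho> t by simp
    qed
    have Esum: "(\<Sum>p\<in>X. energy \<Omega> J B (\<psi> p) (\<psi> p)) \<le> 1 / 2 * ((real n)\<^sup>2 * (\<integral>z. g n z \<partial>Leb2)) + \<beta>"
    proof -
      note i = energy_integrable[OF L1 test_function_energy_domain[OF L1 \<psi>t] test_function_energy_domain[OF L1 \<psi>t]]
      have "(\<Sum>p\<in>X. \<integral>z. J (fst z) (snd z) * (\<psi> p (fst z) - \<psi> p (snd z)) * (\<psi> p (fst z) - \<psi> p (snd z)) \<partial>Leb2)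
        = (\<integral>z. (\<Sum>p\<in>X. J (fst z) (snd z) * (\<psi> p (fst z) - \<psi> p (snd z)) * (\<psi> p (fst z) - \<psi> p (snd z))) \<partial>Leb2)"
        by (rule Bochner_Integration.integral_sum[symmetric]) (rule i)
      also have "\<dots> \<le> (\<integral>z. (real n)\<^sup>2 * g n z \<partial>Leb2)"
      proof (rule integral_mono)
        fix z assume "z \<in> space Leb2"
        then have z: "fst z \<in> \<Omega>" "snd z \<in> \<Omega>" by auto
        let ?x = "fst z" and ?y = "snd z"
        define d where "d = norm (?x - ?y)"
        define M where "M = min (4 * S\<^sup>2) ((L * t * d)\<^sup>2)"
        show "(\<Sum>p\<in>X. J ?x ?y * (\<psi> p ?x - \<psi> p ?y) * (\<psi> p ?x - \<psi> p ?y)) \<le> (real n)\<^sup>2 * g n z"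
        proof (cases "?x = ?y")
          case True
          then show ?thesis by (simp add: g_def q_def)
        next
          case False
          then have d: "0 < d" by (simp add: d_def)
          have J: "0 \<le> J ?x ?y" by (rule J_nonneg[OF L1 z False])
          have M: "(\<psi> p ?x - \<psi> p ?y)\<^sup>2 \<le> M" for p
          proof -
            have "\<bar>\<psi> p ?x - \<psi> p ?y\<bar> \<le> 2 * S" using \<psi>b[of p ?x] \<psi>b[of p ?y] by linarith
            then have "(\<psi> p ?x - \<psi> p ?y)\<^sup>2 \<le> (2 * S)\<^sup>2" by (metis abs_ge_zero power2_abs power_mono)
            moreover have "(\<psi> p ?x - \<psi> p ?y)\<^sup>2 \<le> (L * t * d)\<^sup>2"
              using \<psi>L[of p ?x ?y] unfolding d_def by (metis abs_ge_zero power2_abs power_mono)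
            ultimately show ?thesis by (simp add: M_def power_mult_distrib)
          qed
          have M0: "0 \<le> M" by (simp add: M_def)
          \<comment> \<open>Functions outside \<open>Z\<close> vanish at both points; by
            disjointness each of the two sets has at most one element.\<close>
          define Z where "Z = {p \<in> X. \<psi> p ?x \<noteq> 0} \<union> {p \<in> X. \<psi> p ?y \<noteq> 0}"
          have "(\<Sum>p\<in>X. (\<psi> p ?x - \<psi> p ?y)\<^sup>2) = (\<Sum>p\<in>Z. (\<psi> p ?x - \<psi> p ?y)\<^sup>2)"
            by (rule sum.mono_neutral_right) (auto simp: Z_def X(1))
          also have "\<dots> \<le> real (card Z) * M" by (rule sum_bounded_above) (rule M)
          also have "\<dots> \<le> 2 * M"
          proof (rule mult_right_mono[OF _ M0])
            have "card Z \<le> 1 + 1" unfolding Z_def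
              by (rule order_trans[OF card_Un_le add_mono[OF card1 card1]])
            then show "real (card Z) \<le> 2" by simp
          qed
          finally have "J ?x ?y * (\<Sum>p\<in>X. (\<psi> p ?x - \<psi> p ?y)\<^sup>2) \<le> J ?x ?y * (2 * M)"
            using J by (rule mult_left_mono)
          also have "\<dots> = (real n)\<^sup>2 * g n z"
          proof -
            have "(d * real n)\<^sup>2 * min (4 * S\<^sup>2 / (d * real n)\<^sup>2) ((L * \<tau>)\<^sup>2) = M"
              using d n unfolding M_def t_def
              by (subst min_mult_distrib_left) (auto simp: power_mult_distrib mult_ac)
            then show ?thesis unfolding g_def q_def d_def[symmetric] by (simp add: power_mult_distrib mult_ac)
          qed
          finally show ?thesis by (simp add: sum_distrib_left power2_eq_square mult.assoc)
        qed
      qed ((intro Bochner_Integration.integrable_sum i; assumption), intro integrable_mult_right gi)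
      also have "\<dots> = (real n)\<^sup>2 * (\<integral>z. g n z \<partial>Leb2)" by simp
      finally have E1: "(\<Sum>p\<in>X. \<integral>z. J (fst z) (snd z) * (\<psi> p (fst z) - \<psi> p (snd z)) * (\<psi> p (fst z) - \<psi> p (snd z)) \<partial>Leb2)
        \<le> (real n)\<^sup>2 * (\<integral>z. g n z \<partial>Leb2)" .
      have "(\<Sum>p\<in>X. \<integral>x. B x * \<psi> p x * \<psi> p x \<partial>Leb)
        = (\<integral>x. (\<Sum>p\<in>X. B x * \<psi> p x * \<psi> p x) \<partial>Leb)"
        by (rule Bochner_Integration.integral_sum[symmetric]) (rule i)
      also have "\<dots> \<le> (\<integral>x. \<bar>b\<bar> * S\<^sup>2 \<partial>Leb)"
      proof (rule integral_mono)
        fix x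
        have "(\<Sum>p\<in>X. B x * \<psi> p x * \<psi> p x) = (\<Sum>p\<in>{p \<in> X. \<psi> p x \<noteq> 0}. B x * \<psi> p x * \<psi> p x)"
          by (rule sum.mono_neutral_right) (auto simp: X(1))
        also have "\<dots> \<le> real (card {p \<in> X. \<psi> p x \<noteq> 0}) * (\<bar>b\<bar> * S\<^sup>2)"
        proof (rule sum_bounded_above)
          fix p assume p: "p \<in> {p \<in> X. \<psi> p x \<noteq> 0}"
          then have "\<bar>B x\<bar> \<le> \<bar>b\<bar>" using b[OF s2[of p x]] by auto
          moreover have "(\<psi> p x)\<^sup>2 \<le> S\<^sup>2" using \<psi>b[of p x] by (metis abs_ge_zero power2_abs power_mono)
          ultimately have "\<bar>B x\<bar> * (\<psi> p x)\<^sup>2 \<le> \<bar>b\<bar> * S\<^sup>2" by (intro mult_mono) auto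
          moreover have "B x * \<psi> p x * \<psi> p x \<le> \<bar>B x\<bar> * (\<psi> p x)\<^sup>2"
            unfolding mult.assoc power2_eq_square by (intro mult_right_mono) auto
          ultimately show "B x * \<psi> p x * \<psi> p x \<le> \<bar>b\<bar> * S\<^sup>2" by linarith
        qed
        also have "\<dots> \<le> 1 * (\<bar>b\<bar> * S\<^sup>2)" using card1[of x] by (intro mult_right_mono) auto
        finally show "(\<Sum>p\<in>X. B x * \<psi> p x * \<psi> p x) \<le> \<bar>b\<bar> * S\<^sup>2" by simp
      qed ((intro Bochner_Integration.integrable_sum i; assumption), intro integrable_const)
      also have "\<dots> = \<beta>" by (simp add: \<beta>_def)
      finally have E2: "(\<Sum>p\<in>X. \<integral>x. B x * \<psi> p x * \<psi> p x \<partial>Leb) \<le> \<beta>" .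
      show ?thesis unfolding energy_eq sum.distrib sum_distrib_left[symmetric] using E1 E2 by linarith
    qed
    have "\<kappa> * m\<^sup>2 * (\<rho> / \<tau>) ^ DIM('a) = real (card X) * (\<kappa> * m\<^sup>2 * (\<rho> / t) ^ DIM('a))"
      using n \<tau> by (simp add: X(2) t_def power_divide power_mult_distrib field_simps)
    also have "\<dots> = (\<Sum>p\<in>X. \<kappa> * m\<^sup>2 * (\<rho> / t) ^ DIM('a))" by simp
    also have "\<dots> \<le> (\<Sum>p\<in>X. (\<rho> / t)\<^sup>2 * energy \<Omega> J B (\<psi> p) (\<psi> p))" by (rule sum_mono) (rule low)
    also have "\<dots> = (\<rho> / t)\<^sup>2 * (\<Sum>p\<in>X. energy \<Omega> J B (\<psi> p) (\<psi> p))" by (rule sum_distrib_left[symmetric])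
    also have "\<dots> \<le> (\<rho> / t)\<^sup>2 * (1 / 2 * ((real n)\<^sup>2 * (\<integral>z. g n z \<partial>Leb2)) + \<beta>)"
      by (intro mult_left_mono Esum) simp
    also have "\<dots> = (\<rho> / \<tau>)\<^sup>2 * (1 / 2 * (\<integral>z. g n z \<partial>Leb2) + \<beta> / (real n)\<^sup>2)"
      using n \<tau> by (simp add: t_def power_divide power_mult_distrib field_simps)
    finally show ?thesis .
  qed
  have "(\<lambda>n. \<beta> * (1 / real n)\<^sup>2) \<longlonglongrightarrow> \<beta> * 0\<^sup>2" by (intro tendsto_intros lim_const_over_n)
  then have "(\<lambda>n. \<beta> / (real n)\<^sup>2) \<longlonglongrightarrow> 0" by (simp add: power_divide)
  then have "(\<lambda>n. (\<rho> / \<tau>)\<^sup>2 * (1 / 2 * (\<integral>z. g n z \<partial>Leb2) + \<beta> / (real n)\<^sup>2))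
      \<longlonglongrightarrow> (\<rho> / \<tau>)\<^sup>2 * (1 / 2 * 0 + 0)"
    using glim by (intro tendsto_intros) simp_all
  then have "\<kappa> * m\<^sup>2 * (\<rho> / \<tau>) ^ DIM('a) \<le> (\<rho> / \<tau>)\<^sup>2 * (1 / 2 * 0 + 0)"
    by (rule LIMSEQ_le_const) (use key in \<open>auto intro!: exI[of _ 1]\<close>)
  moreover have "0 < \<kappa> * m\<^sup>2 * (\<rho> / \<tau>) ^ DIM('a)" using \<kappa> m \<rho> \<tau> by simp
  ultimately show False by simp
qed

end

subsection \<open>Measures given by the variations\<close>

text \<open>Additivity on indicators extends by induction over nonnegative measurable functions. It
  is meant for \<open>total_variation\<close>, which is defined through its values on sets
  only.\<close>

lemma nn_integral_measure_sum:
  assumes sets: "sets T = sets P" "sets N = sets P"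
    and T: "\<And>A. A \<in> sets P \<Longrightarrow> emeasure T A = emeasure P A + emeasure N A"
    and f: "f \<in> borel_measurable P"
  shows "(\<integral>\<^sup>+x. f x \<partial>T) = (\<integral>\<^sup>+x. f x \<partial>P) + (\<integral>\<^sup>+x. f x \<partial>N)"
  using f
proof (induction rule: borel_measurable_induct)
  case (cong f g)
  have "space T = space P" "space N = space P" using sets by (auto dest: sets_eq_imp_space_eq)
  with cong(3) have "(\<integral>\<^sup>+x. f x \<partial>P) = (\<integral>\<^sup>+x. g x \<partial>P)" "(\<integral>\<^sup>+x. f x \<partial>N) = (\<integral>\<^sup>+x. g x \<partial>N)"
    "(\<integral>\<^sup>+x. f x \<partial>T) = (\<integral>\<^sup>+x. g x \<partial>T)"
    by (auto intro!: nn_integral_cong)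
  with cong(4) show ?case by simp
next
  case (set A)
  then show ?case using sets T by simp
next
  case (mult u c)
  have "u \<in> borel_measurable T" "u \<in> borel_measurable N"
    using mult(2) sets by (auto cong: measurable_cong_sets)
  with mult show ?case by (simp add: nn_integral_cmult distrib_left)
next
  case (add u v)
  have "u \<in> borel_measurable T" "u \<in> borel_measurable N" "v \<in> borel_measurable T" "v \<in> borel_measurable N"
    using add.hyps sets by (auto cong: measurable_cong_sets)
  with add show ?case by (simp add: nn_integral_add add_ac)
next
  case (seq V)
  have m: "\<And>i. V i \<in> borel_measurable T" "\<And>i. V i \<in> borel_measurable N"
    using seq.hyps(1) sets by (auto cong: measurable_cong_sets)
  have inc: "incseq (\<lambda>i. integral\<^sup>N M (V i))" for M
    using seq.hyps(3) by (intro incseq_SucI nn_integral_mono) (auto simp: incseq_Suc_iff le_fun_def)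
  have e: "integral\<^sup>N T (V i) = integral\<^sup>N P (V i) + integral\<^sup>N N (V i)" for i
    by (rule seq.IH)
  show ?case
    unfolding seq.hyps(4) SUP_apply
    by (simp add: nn_integral_monotone_convergence_SUP[OF seq.hyps(3)] seq.hyps(1) m e ennreal_SUP_add[OF inc inc])
qed

lemma integral_measure_sum:
  fixes f :: "'b \<Rightarrow> real"
  assumes sets: "sets T = sets P" "sets N = sets P"
    and T: "\<And>A. A \<in> sets P \<Longrightarrow> emeasure T A = emeasure P A + emeasure N A"
    and P: "integrable P f" and N: "integrable N f"
  shows "(\<integral>x. f x \<partial>T) = (\<integral>x. f x \<partial>P) + (\<integral>x. f x \<partial>N)"
proof -
  have m: "f \<in> borel_measurable P" using P by simp
  have mT: "f \<in> borel_measurable T" using m sets by (auto cong: measurable_cong_sets)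
  note s = nn_integral_measure_sum[OF sets T]
  have fin: "(\<integral>\<^sup>+x. ennreal (f x) \<partial>M) < top" "(\<integral>\<^sup>+x. ennreal (- f x) \<partial>M) < top" if "integrable M f" for M
    using that by (auto simp: real_integrable_def less_top)
  have "integrable T f"
    using mT s[of "\<lambda>x. ennreal (f x)"] s[of "\<lambda>x. ennreal (- f x)"] m fin[OF P] fin[OF N]
    by (auto simp: real_integrable_def)
  then show ?thesis
    using s[of "\<lambda>x. ennreal (f x)"] s[of "\<lambda>x. ennreal (- f x)"] m fin[OF P] fin[OF N] P N
    by (simp add: real_lebesgue_integral_def enn2real_plus)
qed

lemma
  shows sets_pos_part: "sets (pos_part \<Omega> \<mu>) = sets (restrict_space borel \<Omega>)"
    and sets_neg_part: "sets (neg_part \<Omega> \<mu>) = sets (restrict_space borel \<Omega>)"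
    and sets_total_variation: "sets (total_variation \<Omega> \<mu>) = sets (restrict_space borel \<Omega>)"
proof -
  have "sigma_sets \<Omega> (sets (restrict_space borel \<Omega>)) = sets (restrict_space borel \<Omega>)"
    using sets.sigma_sets_eq[of "restrict_space borel \<Omega>"] by (simp add: space_restrict_space)
  moreover have "sets (restrict_space borel \<Omega>) \<subseteq> Pow \<Omega>"
    using sets.sets_into_space[of _ "restrict_space borel \<Omega>"] by (auto simp: space_restrict_space)
  ultimately show "sets (pos_part \<Omega> \<mu>) = sets (restrict_space borel \<Omega>)"
    "sets (neg_part \<Omega> \<mu>) = sets (restrict_space borel \<Omega>)"
    "sets (total_variation \<Omega> \<mu>) = sets (restrict_space borel \<Omega>)"
    by (simp_all add: pos_part_def neg_part_def total_variation_def)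
qed

text \<open>Countable additivity of the sum is inherited from \<open>pos_part\<close> and
  \<open>neg_part\<close>, which are measures by their type.\<close>

lemma emeasure_total_variation:
  assumes A: "A \<in> sets (restrict_space borel \<Omega>)"
  shows "emeasure (total_variation \<Omega> \<mu>) A = emeasure (pos_part \<Omega> \<mu>) A + emeasure (neg_part \<Omega> \<mu>) A"
proof (rule emeasure_measure_of[OF total_variation_def])
  show "sets (restrict_space borel \<Omega>) \<subseteq> Pow \<Omega>"
    using sets.sets_into_space[of _ "restrict_space borel \<Omega>"] by (auto simp: space_restrict_space)
  show "A \<in> sets (total_variation \<Omega> \<mu>)" using A by (simp add: sets_total_variation)
  show "positive (sets (total_variation \<Omega> \<mu>)) (\<lambda>A. emeasure (pos_part \<Omega> \<mu>) A + emeasure (neg_part \<Omega> \<mu>) A)"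
    by (simp add: positive_def)
  show "countably_additive (sets (total_variation \<Omega> \<mu>)) (\<lambda>A. emeasure (pos_part \<Omega> \<mu>) A + emeasure (neg_part \<Omega> \<mu>) A)"
  proof (rule countably_additiveI)
    fix F :: "nat \<Rightarrow> 'a set"
    assume F: "range F \<subseteq> sets (total_variation \<Omega> \<mu>)" "disjoint_family F"
    show "(\<Sum>i. emeasure (pos_part \<Omega> \<mu>) (F i) + emeasure (neg_part \<Omega> \<mu>) (F i))
        = emeasure (pos_part \<Omega> \<mu>) (\<Union>i. F i) + emeasure (neg_part \<Omega> \<mu>) (\<Union>i. F i)"
      using F suminf_emeasure[of F "pos_part \<Omega> \<mu>"] suminf_emeasure[of F "neg_part \<Omega> \<mu>"]
      by (simp add: suminf_add[symmetric] summableI sets_pos_part sets_neg_part sets_total_variation)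
  qed
qed

section \<open>Variation measures as data, and the link to the form\<close>

context green_kernel
begin

lemma admissible_of_sets:
  assumes "sets P = sets (restrict_space borel \<Omega>)" "(\<integral>\<^sup>+x. ennreal (weight x) \<partial>P) < \<infinity>"
  shows "admissible P"
proof -
  have "(\<lambda>x. x) \<in> measurable (restrict_space borel \<Omega>) borel"
    by (rule measurable_restrict_space1) simp
  then have "(\<lambda>x. x) \<in> borel_measurable P"
    using assms(1) by (simp cong: measurable_cong_sets)
  moreover have "space P = \<Omega>" using sets_eq_imp_space_eq[OF assms(1)] by (simp add: space_restrict_space)
  ultimately show ?thesis using assms(2) by (simp add: admissible_def)
qed

lemma admissible_parts:
  assumes \<mu>: "\<mu> \<in> weighted_measures \<Omega> \<gamma>"
  shows "admissible (pos_part \<Omega> \<mu>)" "admissible (neg_part \<Omega> \<mu>)"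
proof -
  have "(\<lambda>x. ennreal (weight x)) \<in> borel_measurable (restrict_space borel \<Omega>)"
    by (rule measurable_restrict_space1) (rule weight_ennreal_measurable)
  then have m: "(\<lambda>x. ennreal (weight x)) \<in> borel_measurable (pos_part \<Omega> \<mu>)"
    by (simp add: sets_pos_part cong: measurable_cong_sets)
  have "(\<integral>\<^sup>+x. ennreal (weight x) \<partial>total_variation \<Omega> \<mu>)
      = (\<integral>\<^sup>+x. ennreal (weight x) \<partial>pos_part \<Omega> \<mu>) + (\<integral>\<^sup>+x. ennreal (weight x) \<partial>neg_part \<Omega> \<mu>)"
    by (rule nn_integral_measure_sum[OF _ _ _ m])
       (simp_all add: sets_pos_part sets_neg_part sets_total_variation emeasure_total_variation)
  moreover have "(\<integral>\<^sup>+x. ennreal (weight x) \<partial>total_variation \<Omega> \<mu>) < \<infinity>"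
    using \<mu> by (simp add: weighted_measures_def weight_def)
  ultimately show "admissible (pos_part \<Omega> \<mu>)" "admissible (neg_part \<Omega> \<mu>)"
    by (auto intro!: admissible_of_sets simp: sets_pos_part sets_neg_part)
qed

lemma integral_total_variation:
  assumes "\<mu> \<in> weighted_measures \<Omega> \<gamma>" "\<xi> \<in> weighted_Linf \<Omega> \<gamma>"
  shows "(\<integral>x. green_pot \<xi> x \<partial>total_variation \<Omega> \<mu>) = (\<integral>x. green_pot \<xi> x \<partial>pos_part \<Omega> \<mu>) + (\<integral>x. green_pot \<xi> x \<partial>neg_part \<Omega> \<mu>)"
  by (rule integral_measure_sum)
     (simp_all add: sets_pos_part sets_neg_part sets_total_variation emeasure_total_variation
       green_pot_duality(2) admissible_parts assms)

lemma potential_restrict: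
  assumes P: "sets P = sets (restrict_space borel \<Omega>)" and x: "x \<in> \<Omega>"
  shows "(\<integral>y. G x y \<partial>restrict_space P (\<Omega> - {x})) = (\<integral>y. green0 x y \<partial>P)"
proof -
  have sp: "space P = \<Omega>" using sets_eq_imp_space_eq[OF P] by (simp add: space_restrict_space)
  have "\<Omega> - {x} \<in> sets borel" by (intro sets.Diff) auto
  then have "\<Omega> - {x} \<in> sets (restrict_space borel \<Omega>)" by (simp add: sets_restrict_space_iff)
  then have "(\<integral>y. G x y \<partial>restrict_space P (\<Omega> - {x})) = (\<integral>y. indicator (\<Omega> - {x}) y *\<^sub>R G x y \<partial>P)"
    using sp P by (intro integral_restrict_space) (simp add: Int_absorb2)
  also have "\<dots> = (\<integral>y. green0 x y \<partial>P)"
    using sp x by (intro Bochner_Integration.integral_cong) (auto simp: green0_def offdiag_def indicator_def)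
  finally show ?thesis .
qed

lemma green_pot_eq: "x \<in> \<Omega> \<Longrightarrow> green_op \<Omega> G f x = green_pot f x"
  by (simp add: green_op_eq green_pot_def)

text \<open>\<open>kato_L2\<close> asks for a bounded \<open>v\<close>. For the potential of
  \<open>\<xi>\<close> the bound comes from its decay like the weight and the boundedness of the
  weight on the domain.\<close>

lemma green_kato_of_conditions:
  assumes L1: "cond_L1 \<Omega> J B" and L4: "cond_L4 \<Omega> J B s" and s: "s < 1"
    and sol: "\<forall>f\<in>L2_space \<Omega>. green_solution \<Omega> J B f (green_op \<Omega> G f)"
  shows "green_kato \<Omega> G s \<gamma> C"
proof unfold_locales
  fix f \<xi> p P
  assume f: "f \<in> L2_space \<Omega>" and \<xi>: "\<xi> \<in> weighted_Linf \<Omega> \<gamma>"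
    and pos: "AE x in Leb. 0 \<le> green_pot \<xi> x" and k: "kato_pair p P"
  obtain W where W: "0 \<le> W" "\<xi> \<in> borel_measurable Leb"
    "AE x in Leb. \<bar>\<xi> x\<bar> \<le> W * weight x" using weighted_LinfD[OF \<xi>] .
  obtain D where D: "0 < D" "\<And>x. x \<in> \<Omega> \<Longrightarrow> weight x \<le> D" using weight_bounded by auto
  have b: "\<bar>green_op \<Omega> G \<xi> x\<bar> \<le> W * green_const * riesz_const * D" if x: "x \<in> \<Omega>" for x
  proof -
    have "W * green_const * riesz_const * weight x \<le> W * green_const * riesz_const * D"
      using W(1) green_const_pos riesz_const(1) by (intro mult_left_mono D x) auto
    then show ?thesis using green_pot_weighted_bound[OF W(2) W(1) W(3) x] green_pot_eq[OF x] by simp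
  qed
  have pos': "AE x in Leb. 0 \<le> green_op \<Omega> G \<xi> x"
    using pos AE_space by eventually_elim (simp add: green_pot_eq)
  have "(\<integral>x. P (green_op \<Omega> G f x) * \<xi> x \<partial>Leb)
      \<le> (\<integral>x. p (green_op \<Omega> G f x) * f x * green_op \<Omega> G \<xi> x \<partial>Leb)"
    using sol f weighted_Linf_L2[OF \<xi>] by (intro kato_L2[OF L1 L4 s _ _ pos' b k]) blast+
  also have "(\<integral>x. P (green_op \<Omega> G f x) * \<xi> x \<partial>Leb) = (\<integral>x. P (green_pot f x) * \<xi> x \<partial>Leb)"
    by (intro Bochner_Integration.integral_cong) (auto simp: green_pot_eq)
  also have "(\<integral>x. p (green_op \<Omega> G f x) * f x * green_op \<Omega> G \<xi> x \<partial>Leb)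
      = (\<integral>x. p (green_pot f x) * f x * green_pot \<xi> x \<partial>Leb)"
    by (intro Bochner_Integration.integral_cong) (auto simp: green_pot_eq)
  finally show "(\<integral>x. P (green_pot f x) * \<xi> x \<partial>Leb) \<le> (\<integral>x. p (green_pot f x) * f x * green_pot \<xi> x \<partial>Leb)" .
qed

end

lemma kato_pair_smooth_pos:
  "0 < e \<Longrightarrow> kato_pair (\<lambda>t. smooth_sgn e (max t 0)) (\<lambda>t. smooth_abs e (max t 0))"
  by (intro kato_pair_pos_part kato_pair_smooth_abs smooth_sgn_nonneg) (auto simp: smooth_sgn_def)

lemma smooth_pos_tendsto:
  "(\<lambda>n. smooth_sgn (1 / real (Suc n)) (max t 0)) \<longlonglongrightarrow> sgn_plus t"
  "(\<lambda>n. smooth_abs (1 / real (Suc n)) (max t 0)) \<longlonglongrightarrow> max t 0"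
proof -
  have "sgn_plus t = sgn (max t 0)" by (auto simp: sgn_plus_def sgn_if max_def)
  then show "(\<lambda>n. smooth_sgn (1 / real (Suc n)) (max t 0)) \<longlonglongrightarrow> sgn_plus t"
    using smooth_sgn_tendsto[of "max t 0"] by simp
  show "(\<lambda>n. smooth_abs (1 / real (Suc n)) (max t 0)) \<longlonglongrightarrow> max t 0"
    using smooth_abs_tendsto[of "max t 0"] by simp
qed

section \<open>The inequalities with the sign functions\<close>

context green_kato
begin

lemma kato_sharp_L1:
  assumes f: "f \<in> L1_weighted \<Omega> \<gamma>" and \<xi>: "\<xi> \<in> weighted_Linf \<Omega> \<gamma>"
    and pos: "AE x in Leb. 0 \<le> green_pot \<xi> x"
  shows "(\<integral>x. \<bar>green_pot f x\<bar> * \<xi> x \<partial>Leb) \<le> (\<integral>x. sgn (green_pot f x) * f x * green_pot \<xi> x \<partial>Leb)" (is ?a)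
    and "(\<integral>x. max (green_pot f x) 0 * \<xi> x \<partial>Leb) \<le> (\<integral>x. sgn_plus (green_pot f x) * f x * green_pot \<xi> x \<partial>Leb)" (is ?b)
proof -
  have fm: "f \<in> borel_measurable Leb" using f by (simp add: L1_weighted_iff)
  note um = measurable_of_borel[OF id_measurable green_pot_measurable[OF fm]]
  note h = green_bound_integrable[OF admissible_dens[OF f]]
  have b: "AE x in Leb. \<bar>green_pot f x\<bar> * weight x \<le> green_bound (abs_density f) x"
    using riesz_pot_finite_AE[OF admissible_dens[OF f]] AE_space
    by eventually_elim (rule green_pot_bound[OF f _ _ fm], auto)
  note lim = kato_sharp_limit[OF f \<xi> um h b, where R = 0, simplified]
  show ?a
    by (rule lim[where p = "\<lambda>n. smooth_sgn (1 / real (Suc n))" and \<Phi> = "\<lambda>n. smooth_abs (1 / real (Suc n))"])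
       (intro kato_pair_smooth_abs smooth_sgn_tendsto smooth_abs_tendsto kato_L1 f \<xi> pos; simp)+
  show ?b
    by (rule lim[where p = "\<lambda>n t. smooth_sgn (1 / real (Suc n)) (max t 0)"
          and \<Phi> = "\<lambda>n t. smooth_abs (1 / real (Suc n)) (max t 0)" and Q = "\<lambda>t. max t 0"])
       (intro kato_pair_smooth_pos smooth_pos_tendsto kato_L1[where P = "\<lambda>t. smooth_abs _ (max t 0)"
          and p = "\<lambda>t. smooth_sgn _ (max t 0)"] f \<xi> pos; simp)+
qed

text \<open>The slopes approximating the positive part are nonnegative, so \<open>c = 0\<close>
  removes \<open>N\<close>; those of the absolute value are only bounded below by -1, so
  \<open>c = 1\<close> keeps it.\<close>

lemma kato_sharp_measure:
  assumes G2: "cond_G2 \<Omega> G" and f: "f \<in> L1_weighted \<Omega> \<gamma>"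
    and P: "admissible P" and N: "admissible N" and \<xi>: "\<xi> \<in> weighted_Linf \<Omega> \<gamma>"
    and pos: "AE x in Leb. 0 \<le> green_pot \<xi> x"
    and u: "\<And>x. u x = green_pot f x + (\<integral>y. green0 x y \<partial>P) - (\<integral>y. green0 x y \<partial>N)"
  shows "(\<integral>x. max (u x) 0 * \<xi> x \<partial>Leb)
      \<le> (\<integral>x. sgn_plus (u x) * f x * green_pot \<xi> x \<partial>Leb) + (\<integral>x. green_pot \<xi> x \<partial>P)" (is ?a)
    and "(\<integral>x. \<bar>u x\<bar> * \<xi> x \<partial>Leb)
      \<le> (\<integral>x. sgn (u x) * f x * green_pot \<xi> x \<partial>Leb) + ((\<integral>x. green_pot \<xi> x \<partial>P) + (\<integral>x. green_pot \<xi> x \<partial>N))" (is ?b)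
proof -
  have fm: "f \<in> borel_measurable Leb" using f by (simp add: L1_weighted_iff)
  have um: "u \<in> borel_measurable Leb"
    unfolding u[abs_def]
    by (intro borel_measurable_add borel_measurable_diff measurable_of_borel[OF id_measurable green_pot_measurable[OF fm]]
        potential_measurable P N)
  have h: "integrable Leb (\<lambda>x. green_bound (abs_density f) x + green_bound P x + green_bound N x)"
    by (intro Bochner_Integration.integrable_add green_bound_integrable admissible_dens f P N)
  have b: "AE x in Leb. \<bar>u x\<bar> * weight x \<le> green_bound (abs_density f) x + green_bound P x + green_bound N x"
    using riesz_pot_finite_AE[OF admissible_dens[OF f]] riesz_pot_finite_AE[OF P] riesz_pot_finite_AE[OF N] AE_space
  proof eventually_elim
    case (elim x)
    have x: "x \<in> \<Omega>" using elim by simp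
    have nn: "0 \<le> (\<integral>y. green0 x y \<partial>Q)" for Q by (intro integral_nonneg_AE AE_I2) (rule green0_nonneg)
    have "\<bar>u x\<bar> \<le> \<bar>green_pot f x\<bar> + (\<integral>y. green0 x y \<partial>P) + (\<integral>y. green0 x y \<partial>N)"
      using nn[of P] nn[of N] unfolding u by linarith
    then have "\<bar>u x\<bar> * weight x \<le> (\<bar>green_pot f x\<bar> + (\<integral>y. green0 x y \<partial>P) + (\<integral>y. green0 x y \<partial>N)) * weight x"
      by (rule mult_right_mono[OF _ weight_nonneg])
    also have "\<dots> = \<bar>green_pot f x\<bar> * weight x + weight x * (\<integral>y. green0 x y \<partial>P) + weight x * (\<integral>y. green0 x y \<partial>N)"
      by (simp add: algebra_simps)
    also have "\<dots> \<le> green_bound (abs_density f) x + green_bound P x + green_bound N x"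
      using elim green0_integral[OF P x] green0_integral[OF N x]
      by (intro add_mono green_pot_bound[OF f x _ fm]) (auto simp: green_bound_def)
    finally show ?case .
  qed
  note lim = kato_sharp_limit[OF f \<xi> um h b]
  have ge: "- 1 \<le> smooth_sgn e t" if "0 < e" for e t
    using smooth_sgn_abs_le[OF that, of t] by linarith
  note smooth = kato_measure_smooth[OF G2 f P N \<xi> pos _ _ u]
  show ?a
  proof (rule lim[where p = "\<lambda>n t. smooth_sgn (1 / real (Suc n)) (max t 0)"
          and \<Phi> = "\<lambda>n t. smooth_abs (1 / real (Suc n)) (max t 0)" and Q = "\<lambda>t. max t 0"])
    show "(\<integral>x. smooth_abs (1 / real (Suc n)) (max (u x) 0) * \<xi> x \<partial>Leb)
        \<le> (\<integral>x. smooth_sgn (1 / real (Suc n)) (max (u x) 0) * f x * green_pot \<xi> x \<partial>Leb) + (\<integral>x. green_pot \<xi> x \<partial>P)" for n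
      using smooth[OF kato_pair_smooth_pos, of "1 / real (Suc n)" 0] by (simp add: smooth_sgn_nonneg)
  qed (intro kato_pair_smooth_pos smooth_pos_tendsto; simp)+
  show ?b
  proof (rule lim[where p = "\<lambda>n. smooth_sgn (1 / real (Suc n))" and \<Phi> = "\<lambda>n. smooth_abs (1 / real (Suc n))"])
    show "(\<integral>x. smooth_abs (1 / real (Suc n)) (u x) * \<xi> x \<partial>Leb)
        \<le> (\<integral>x. smooth_sgn (1 / real (Suc n)) (u x) * f x * green_pot \<xi> x \<partial>Leb)
          + ((\<integral>x. green_pot \<xi> x \<partial>P) + (\<integral>x. green_pot \<xi> x \<partial>N))" for n
      using smooth[OF kato_pair_smooth_abs, of "1 / real (Suc n)" 1] ge by simp
  qed (intro kato_pair_smooth_abs smooth_sgn_tendsto smooth_abs_tendsto; simp)+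
qed

end

text \<open>The last inequality carries the total variation: for \<open>f = 0\<close>, a nonzero
  negative \<open>\<mu>\<close> and positive \<open>\<xi>\<close> its left side is positive, whereas
  an integral over the positive part alone would be 0.\<close>

theorem theorem5p4:
  fixes \<Omega> :: "'a::euclidean_space set"
    and J G :: "'a \<Rightarrow> 'a \<Rightarrow> real"
    and B :: "'a \<Rightarrow> real"
    and s \<gamma> :: real
  assumes "DIM('a) \<ge> 3"
    and "C2_domain \<Omega>" and "bounded \<Omega>"
    and "cond_L1 \<Omega> J B"
    and "cond_L2 \<Omega> J B"
    and "cond_L3 \<Omega> J B"
    and "cond_L4 \<Omega> J B s"
    and "cond_G1 \<Omega> J B G s \<gamma>"
  shows
    "(\<forall>f \<in> L1_weighted \<Omega> \<gamma>. \<forall>u. u = green_op \<Omega> G f \<longrightarrow>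
       (\<forall>\<xi> \<in> weighted_Linf \<Omega> \<gamma>. (AE x in lebesgue_on \<Omega>. 0 \<le> green_op \<Omega> G \<xi> x) \<longrightarrow>
          (\<integral>x. \<bar>u x\<bar> * \<xi> x \<partial>lebesgue_on \<Omega>)
            \<le> (\<integral>x. sgn (u x) * f x * green_op \<Omega> G \<xi> x \<partial>lebesgue_on \<Omega>) \<and>
          (\<integral>x. max (u x) 0 * \<xi> x \<partial>lebesgue_on \<Omega>)
            \<le> (\<integral>x. sgn_plus (u x) * f x * green_op \<Omega> G \<xi> x \<partial>lebesgue_on \<Omega>)))
     \<and>
     (cond_G2 \<Omega> G \<and> cond_G3 \<Omega> G \<gamma> \<longrightarrow>
       (\<forall>f \<in> L1_weighted \<Omega> \<gamma>. \<forall>\<mu> \<in> weighted_measures \<Omega> \<gamma>.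
        \<forall>u. u = (\<lambda>x. green_op \<Omega> G f x + green_op_measure \<Omega> G \<mu> x) \<longrightarrow>
         (\<forall>\<xi> \<in> weighted_Linf \<Omega> \<gamma>. (AE x in lebesgue_on \<Omega>. 0 \<le> green_op \<Omega> G \<xi> x) \<longrightarrow>
            (\<integral>x. max (u x) 0 * \<xi> x \<partial>lebesgue_on \<Omega>)
              \<le> (\<integral>x. sgn_plus (u x) * green_op \<Omega> G \<xi> x * f x \<partial>lebesgue_on \<Omega>)
                + (\<integral>x. green_op \<Omega> G \<xi> x \<partial>pos_part \<Omega> \<mu>) \<and>
            (\<integral>x. \<bar>u x\<bar> * \<xi> x \<partial>lebesgue_on \<Omega>)
              \<le> (\<integral>x. sgn (u x) * green_op \<Omega> G \<xi> x * f x \<partial>lebesgue_on \<Omega>)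
                + (\<integral>x. green_op \<Omega> G \<xi> x \<partial>total_variation \<Omega> \<mu>))))"
proof -
  have open_\<Omega>: "open \<Omega>" and ne: "\<Omega> \<noteq> {}" using \<open>C2_domain \<Omega>\<close> by (auto simp: C2_domain_def)
  note L1 = \<open>cond_L1 \<Omega> J B\<close> and L4 = \<open>cond_L4 \<Omega> J B s\<close> and G1 = \<open>cond_G1 \<Omega> J B G s \<gamma>\<close>
  obtain C where C: "0 < C" "\<forall>(x, y)\<in>offdiag \<Omega>. green_profile \<Omega> s \<gamma> x y / C \<le> G x y \<and> G x y \<le> C * green_profile \<Omega> s \<gamma> x y"
    using G1 unfolding cond_G1_def by blast
  have sol: "\<forall>f\<in>L2_space \<Omega>. green_solution \<Omega> J B f (green_op \<Omega> G f)"
    using G1 by (simp add: cond_G1_def)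
  interpret green_kernel \<Omega> G s \<gamma> C
    using G1 C open_\<Omega> \<open>bounded \<Omega>\<close> by unfold_locales (auto simp: cond_G1_def offdiag_def)
  have "s \<noteq> 1" using order_not_one[OF _ ne L1 sol] by blast
  then have "s < 1" using G1 by (simp add: cond_G1_def)
  then interpret green_kato \<Omega> G s \<gamma> C
    by (intro green_kato_of_conditions[OF L1 L4 _ sol])
  have int_green_pot: "(\<integral>x. H x (green_op \<Omega> G f x) (green_op \<Omega> G \<xi> x) \<partial>lebesgue_on \<Omega>)
      = (\<integral>x. H x (green_pot f x) (green_pot \<xi> x) \<partial>lebesgue_on \<Omega>)" for f \<xi> and H :: "'a \<Rightarrow> real \<Rightarrow> real \<Rightarrow> real"
    by (intro Bochner_Integration.integral_cong) (auto simp: green_pot_eq)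
  have pos_green_pot: "AE x in lebesgue_on \<Omega>. 0 \<le> green_pot \<xi> x"
    if "AE x in lebesgue_on \<Omega>. 0 \<le> green_op \<Omega> G \<xi> x" for \<xi>
    using that AE_space by eventually_elim (simp add: green_pot_eq)
  show ?thesis
  proof (intro conjI impI ballI allI)
    fix f u \<xi>
    assume f: "f \<in> L1_weighted \<Omega> \<gamma>" and u: "u = green_op \<Omega> G f" and \<xi>: "\<xi> \<in> weighted_Linf \<Omega> \<gamma>"
      and pos: "AE x in lebesgue_on \<Omega>. 0 \<le> green_op \<Omega> G \<xi> x"
    note kato = kato_sharp_L1[OF f \<xi> pos_green_pot[OF pos]]
    show "(\<integral>x. \<bar>u x\<bar> * \<xi> x \<partial>lebesgue_on \<Omega>) \<le> (\<integral>x. sgn (u x) * f x * green_op \<Omega> G \<xi> x \<partial>lebesgue_on \<Omega>)"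
      using kato(1) int_green_pot[of "\<lambda>x a b. \<bar>a\<bar> * \<xi> x" f \<xi>] int_green_pot[of "\<lambda>x a b. sgn a * f x * b" f \<xi>]
      unfolding u by simp
    show "(\<integral>x. max (u x) 0 * \<xi> x \<partial>lebesgue_on \<Omega>) \<le> (\<integral>x. sgn_plus (u x) * f x * green_op \<Omega> G \<xi> x \<partial>lebesgue_on \<Omega>)"
      using kato(2) int_green_pot[of "\<lambda>x a b. max a 0 * \<xi> x" f \<xi>] int_green_pot[of "\<lambda>x a b. sgn_plus a * f x * b" f \<xi>]
      unfolding u by simp
  next
    fix f \<mu> u \<xi>
    assume G2: "cond_G2 \<Omega> G \<and> cond_G3 \<Omega> G \<gamma>" and f: "f \<in> L1_weighted \<Omega> \<gamma>"
      and \<mu>: "\<mu> \<in> weighted_measures \<Omega> \<gamma>"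
      and u: "u = (\<lambda>x. green_op \<Omega> G f x + green_op_measure \<Omega> G \<mu> x)" and \<xi>: "\<xi> \<in> weighted_Linf \<Omega> \<gamma>"
      and pos: "AE x in lebesgue_on \<Omega>. 0 \<le> green_op \<Omega> G \<xi> x"
    let ?P = "pos_part \<Omega> \<mu>" and ?N = "neg_part \<Omega> \<mu>"
    define v where "v x = green_pot f x + (\<integral>y. green0 x y \<partial>?P) - (\<integral>y. green0 x y \<partial>?N)" for x
    note kato = kato_sharp_measure[OF conjunct1[OF G2] f admissible_parts[OF \<mu>] \<xi> pos_green_pot[OF pos] v_def]
    \<comment> \<open>Only values on the domain enter the integrals, and \<open>v\<close> is
      measurable by the potential estimates.\<close>
    have uv: "u x = v x" if "x \<in> \<Omega>" for x
      using that by (simp add: u v_def green_pot_eq green_op_measure_def potential_restrict sets_pos_part sets_neg_part)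
    have int_v: "(\<integral>x. H x (u x) (green_op \<Omega> G \<xi> x) \<partial>lebesgue_on \<Omega>) = (\<integral>x. H x (v x) (green_pot \<xi> x) \<partial>lebesgue_on \<Omega>)"
      for H :: "'a \<Rightarrow> real \<Rightarrow> real \<Rightarrow> real"
      by (intro Bochner_Integration.integral_cong) (auto simp: green_pot_eq uv)
    have int_Q: "(\<integral>x. green_op \<Omega> G \<xi> x \<partial>Q) = (\<integral>x. green_pot \<xi> x \<partial>Q)" if "sets Q = sets (restrict_space borel \<Omega>)" for Q
      using sets_eq_imp_space_eq[OF that]
      by (intro Bochner_Integration.integral_cong) (auto simp: green_pot_eq space_restrict_space)
    show "(\<integral>x. max (u x) 0 * \<xi> x \<partial>lebesgue_on \<Omega>)
        \<le> (\<integral>x. sgn_plus (u x) * green_op \<Omega> G \<xi> x * f x \<partial>lebesgue_on \<Omega>) + (\<integral>x. green_op \<Omega> G \<xi> x \<partial>?P)"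
      using kato(1) int_v[of "\<lambda>x a b. max a 0 * \<xi> x"] int_v[of "\<lambda>x a b. sgn_plus a * b * f x"]
      by (simp add: int_Q sets_pos_part mult_ac)
    show "(\<integral>x. \<bar>u x\<bar> * \<xi> x \<partial>lebesgue_on \<Omega>)
        \<le> (\<integral>x. sgn (u x) * green_op \<Omega> G \<xi> x * f x \<partial>lebesgue_on \<Omega>) + (\<integral>x. green_op \<Omega> G \<xi> x \<partial>total_variation \<Omega> \<mu>)"
      using kato(2) int_v[of "\<lambda>x a b. \<bar>a\<bar> * \<xi> x"] int_v[of "\<lambda>x a b. sgn a * b * f x"]
      by (simp add: int_Q sets_total_variation integral_total_variation[OF \<mu> \<xi>] mult_ac)
  qed
qed

end
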